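(* Let $\mathcal G$ and $\mathcal G^{-1}$ be the transforms defined in the context. For every $f\in L^2(\mathbb R^d)$, $$\|\mathcal G f\|_{L^2(\Gamma)}=\|f\|_{L^2(\mathbb R^d)}\quad\text{and}\quad f=\mathcal G^{-1}(\mathcal G f),$$ and for every $F\in L^2(\Gamma)$, $$\|\mathcal G^{-1}F\|_{L^2(\mathbb R^d)}=\|F\|_{L^2(\Gamma)}\quad\text{and}\quad F=\mathcal G(\mathcal G^{-1}F).$$
   Context: Let $d',d''\ge1$ be integers, $d=d'+d''$, and write $x=(x',x'')\in\mathbb R^d=\mathbb R^{d'}\times\mathbb R^{d''}$. Put $\mathbb R^{d''}_0=\mathbb R^{d''}\setminus\{0\}$ and $\mathbb N=\{0,1,2,\dots\}$. For $k\in\mathbb N^{d'}$ put $|k|=k_1+\dots+k_{d'}$. Hermite functions: $h_n(u)=(2^n n!\sqrt\pi)^{-1/2}H_n(u)e^{-u^2/2}$ on $\mathbb R$ ($H_n$ the Hermite polynomials), and $h_k(x')=\prod_{j=1}^{d'}h_{k_j}(x'_j)$ for $k\in\mathbb N^{d'}$, $x'\in\mathbb R^{d'}$; they form an orthonormal basis of $L^2(\mathbb R^{d'})$. For $\tau>0$, $h_{k,\tau}(x')=\tau^{d'/4}h_k(\tau^{1/2}x')$; for each $\tau>0$ the family $\{h_{k,\tau}\}_{k\in\mathbb N^{d'}}$ is an orthonormal basis of $L^2(\mathbb R^{d'})$. Scaled Hermite transform: for $\xi''\in\mathbb R^{d''}_0$ and $g\in L^2(\mathbb R^{d'})$, $\mathcal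 H^{sc}_{\xi''}g(k)=\langle g,h_{k,|\xi''|}\rangle_{L^2(\mathbb R^{d'})}$, $k\in\mathbb N^{d'}$. It is a unitary map $L^2(\mathbb R^{d'})\to\ell^2(\mathbb N^{d'})$ with inverse $\mathcal H^{sc;-1}_{\xi''}\{c_k\}=\sum_{k}c_kh_{k,|\xi''|}$. $\mathcal F''$ is the unitary Fourier transform on $L^2(\mathbb R^{d''})$, given for integrable functions by $\mathcal F''g(\xi'')=(2\pi)^{-d''/2}\int_{\mathbb R^{d''}}g(x'')e^{-i\xi''\cdot x''}dx''$; $\mathcal F''^{-1}$ is its inverse. $L^2(\Gamma)$ denotes $L^2(\mathbb N^{d'}\times\mathbb R^{d''})$ with respect to counting measure times Lebesgue measure: $\|F\|_{L^2(\Gamma)}^2=\sum_{k\in\mathbb N^{d'}}\int_{\mathbb R^{d''}}|F(k,\xi'')|^2d\xi''$. For $f\in L^2(\mathbb R^d)$, with $f_{x'}=f(x',\cdot)$, define $$\mathcal Gf(k,\xi'')=\mathcal H^{sc}_{\xi''}\big[x'\mapsto\mathcal F''f_{x'}(\xi'')\big](k),\qquad k\in\mathbb N^{d'},\ \text{a.e. }\xi''\in\mathbb R^{d''}_0.$$ For $F\in L^2(\Gamma)$, with $F_{\xi''}=F(\cdot,\xi'')$, define $$\mathcal G^{-1}F(x',x'')=\mathcal F''^{-1}\big[\xi''\mapsto(\mathcal H^{sc;-1}_{\xi''}F_{\xi''})(x')\big](x'').$$ (Here $\mathcal G^{-1}$ is, a priori, just the notation for the map so defined.) *)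

theory Defs
  imports "HOL-Analysis.Analysis"
begin

text \<open>
  Elements of $L^2$ are represented by functions; equality of elements of $L^2$ is equality almost
  everywhere. The points of $R^d = R^{d'} \times R^{d''}$ have type
  \<open>(real^'m) \<times> (real^'n)\<close>, with \<open>d' = CARD('m)\<close> and \<open>d'' = CARD('n)\<close>.
\<close>

definition L2_space :: "'a measure \<Rightarrow> ('a \<Rightarrow> complex) set" where
  "L2_space M = {f. f \<in> borel_measurable M \<and> integrable M (\<lambda>x. (cmod (f x))\<^sup>2)}"

text \<open>
  The value is only meaningful for members of \<open>L2_space\<close>: the integral of a non-integrable
  function is 0. Membership is therefore always required alongside.
\<close>

definition L2_norm :: "'a measure \<Rightarrow> ('a \<Rightarrow> complex) \<Rightarrow> real" where
  "L2_norm M f = sqrt (\<integral>x. (cmod (f x))\<^sup>2 \<partial>M)"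

definition L2_inner :: "'a measure \<Rightarrow> ('a \<Rightarrow> complex) \<Rightarrow> ('a \<Rightarrow> complex) \<Rightarrow> complex" where
  "L2_inner M f g = (\<integral>x. f x * cnj (g x) \<partial>M)"

definition L2_tendsto ::
    "'a measure \<Rightarrow> ('i \<Rightarrow> 'a \<Rightarrow> complex) \<Rightarrow> ('a \<Rightarrow> complex) \<Rightarrow> 'i filter \<Rightarrow> bool" where
  "L2_tendsto M u g Fil \<longleftrightarrow>
     (\<forall>\<^sub>F i in Fil. u i \<in> L2_space M) \<and> g \<in> L2_space M \<and>
     ((\<lambda>i. L2_norm M (\<lambda>x. u i x - g x)) \<longlongrightarrow> 0) Fil"


text \<open>The Hermite polynomials are those of the physicists, orthogonal for the weight $e^{-u^2}$.\<close>

fun hermite_poly :: "nat \<Rightarrow> real \<Rightarrow> real" where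
  "hermite_poly 0 u = 1"
| "hermite_poly (Suc 0) u = 2 * u"
| "hermite_poly (Suc (Suc n)) u =
     2 * u * hermite_poly (Suc n) u - 2 * real (Suc n) * hermite_poly n u"

definition hermite_fun :: "nat \<Rightarrow> real \<Rightarrow> real" where
  "hermite_fun n u =
     (2 ^ n * fact n * sqrt pi) powr (- 1 / 2) * hermite_poly n u * exp (- u\<^sup>2 / 2)"

definition hermite_multi :: "nat ^ 'm \<Rightarrow> real ^ 'm \<Rightarrow> real" where
  "hermite_multi k x = (\<Prod>j\<in>UNIV. hermite_fun (k $ j) (x $ j))"

definition hermite_scaled :: "real \<Rightarrow> nat ^ 'm \<Rightarrow> real ^ 'm \<Rightarrow> complex" where
  "hermite_scaled \<tau> k x =
     complex_of_real (\<tau> powr (real CARD('m) / 4) * hermite_multi k (sqrt \<tau> *\<^sub>R x))"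

definition Hsc :: "real ^ 'n \<Rightarrow> (real ^ 'm \<Rightarrow> complex) \<Rightarrow> nat ^ 'm \<Rightarrow> complex" where
  "Hsc \<xi> g k = L2_inner lborel g (hermite_scaled (norm \<xi>) k)"

text \<open>The series is the unconditional sum in $L^2(R^{d'})$.\<close>

definition Hsc_inv :: "real ^ 'n \<Rightarrow> (nat ^ 'm \<Rightarrow> complex) \<Rightarrow> real ^ 'm \<Rightarrow> complex" where
  "Hsc_inv \<xi> c =
     (SOME g. L2_tendsto lborel (\<lambda>K x. \<Sum>k\<in>K. c k * hermite_scaled (norm \<xi>) k x) g
        (finite_subsets_at_top UNIV))"


definition fourier_L1 :: "(real ^ 'n \<Rightarrow> complex) \<Rightarrow> real ^ 'n \<Rightarrow> complex" where
  "fourier_L1 g \<xi> =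
     complex_of_real ((2 * pi) powr (- real CARD('n) / 2)) *
     (\<integral>x. g x * exp (- \<i> * complex_of_real (\<xi> \<bullet> x)) \<partial>lborel)"

text \<open>
  The Fourier transform on $L^2$ is the extension by continuity of \<open>fourier_L1\<close> from
  $L^1 \cap L^2$; the choice is between functions that agree almost everywhere.
\<close>

definition fourier_L2 :: "(real ^ 'n \<Rightarrow> complex) \<Rightarrow> real ^ 'n \<Rightarrow> complex" where
  "fourier_L2 g =
     (SOME G. \<exists>u. (\<forall>n::nat. integrable lborel (u n)) \<and>
        L2_tendsto lborel u g sequentially \<and>
        L2_tendsto lborel (\<lambda>n. fourier_L1 (u n)) G sequentially)"

definition fourier_L2_inv :: "(real ^ 'n \<Rightarrow> complex) \<Rightarrow> real ^ 'n \<Rightarrow> complex" where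
  "fourier_L2_inv G = (SOME g. g \<in> L2_space lborel \<and> (AE \<xi> in lborel. fourier_L2 g \<xi> = G \<xi>))"


text \<open>
  In the next three definitions a transform acts on each slice of a function of two variables and
  so is determined only up to a null set of each slice. Integrating it in the other variable makes
  sense only for a jointly measurable version, which is unique up to a null set of the product.
\<close>

definition fourier_slices ::
    "((real ^ 'm) \<times> (real ^ 'n) \<Rightarrow> complex) \<Rightarrow> (real ^ 'm) \<times> (real ^ 'n) \<Rightarrow> complex" where
  "fourier_slices f =
     (SOME \<Phi>. \<Phi> \<in> borel_measurable lborel \<and>
        (AE x' in lborel. AE \<xi> in lborel. \<Phi> (x', \<xi>) = fourier_L2 (\<lambda>x''. f (x', x'')) \<xi>))"

definition fourier_inv_slices ::
    "((real ^ 'm) \<times> (real ^ 'n) \<Rightarrow> complex) \<Rightarrow> (real ^ 'm) \<times> (real ^ 'n) \<Rightarrow> complex" where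
  "fourier_inv_slices \<Phi> =
     (SOME f. f \<in> borel_measurable lborel \<and>
        (AE x' in lborel. AE x'' in lborel. f (x', x'') = fourier_L2_inv (\<lambda>\<xi>. \<Phi> (x', \<xi>)) x''))"

definition Hsc_inv_slices ::
    "((nat ^ 'm) \<times> (real ^ 'n) \<Rightarrow> complex) \<Rightarrow> (real ^ 'm) \<times> (real ^ 'n) \<Rightarrow> complex" where
  "Hsc_inv_slices F =
     (SOME \<Phi>. \<Phi> \<in> borel_measurable lborel \<and>
        (AE \<xi> in lborel. AE x' in lborel. \<Phi> (x', \<xi>) = Hsc_inv \<xi> (\<lambda>k. F (k, \<xi>)) x'))"

definition calG :: "((real ^ 'm) \<times> (real ^ 'n) \<Rightarrow> complex) \<Rightarrow> (nat ^ 'm) \<times> (real ^ 'n) \<Rightarrow> complex" where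
  "calG f = (\<lambda>(k, \<xi>). Hsc \<xi> (\<lambda>x'. fourier_slices f (x', \<xi>)) k)"

definition calG_inv :: "((nat ^ 'm) \<times> (real ^ 'n) \<Rightarrow> complex) \<Rightarrow> (real ^ 'm) \<times> (real ^ 'n) \<Rightarrow> complex" where
  "calG_inv F = fourier_inv_slices (Hsc_inv_slices F)"

definition Gamma_measure :: "((nat ^ 'm) \<times> (real ^ 'n)) measure" where
  "Gamma_measure = count_space UNIV \<Otimes>\<^sub>M lborel"

end

theory Submission
  imports Defs "HOL-Probability.Characteristic_Functions"
begin

text \<open>
  For almost every \<open>\<xi>\<close> the scaled Hermite functions form an orthonormal basis
  of \<open>L\<^sup>2\<close> in \<open>x'\<close>, so passing to coefficients slice by slice is unitary, and the slicewise
  Fourier transform in \<open>x''\<close> is unitary as well; the transform is the composition of the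
  two. The work lies in the two unitarity statements and in the null sets.

  Everything is reduced to expansions in Hermite functions. Lemma \<open>hermite_gauss_fourier\<close> shows that
  they are eigenfunctions of the Fourier transform for the eigenvalues \<open>(- \<i>) ^ |k|\<close>, and
  \<open>hermite_multi_complete\<close> shows that they are complete. Completeness rests on the injectivity of the
  Fourier transform on integrable functions, \<open>fourier_injective\<close>, proved by smoothing with Gaussians.
  Given both, \<open>fourier_L2_hermite_pair\<close> identifies the Fourier transform on \<open>L\<^sup>2\<close> with the
  multiplication of the \<open>k\<close>-th Hermite coefficient by \<open>(- \<i>) ^ |k|\<close>. Plancherel's theorem
  and surjectivity are then immediate from Parseval's identity and the Riesz-Fischer
  theorem.

  Both transforms are thereby instances of one construction, the locale \<open>measurable_basis_field\<close>:
  orthonormal bases of \<open>L\<^sup>2(M)\<close> that depend measurably on a parameter in \<open>N\<close>. Its theorems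
  \<open>coeffs_isometry\<close> and \<open>synthesis\<close> say that the coefficient map on \<open>L\<^sup>2(N \<Otimes> M)\<close> is
  isometric and onto. Synthesis is carried out on the product space, so it yields jointly measurable
  functions whose slices are, almost everywhere, the slicewise transforms. This shows
  that the choices in the definitions of the slicewise transforms are possible, and since
  jointly measurable functions agree almost everywhere once almost all of their slices do, the
  choices are immaterial (\<open>fourier_slices_spec\<close>, \<open>fourier_inv_slices_spec\<close>, \<open>Hsc_inv_slices_spec\<close>).
\<close>

section \<open>Square integrable functions\<close>

lemma borel_measurable_cnj [measurable (raw)]:
  "f \<in> borel_measurable M \<Longrightarrow> (\<lambda>x. cnj (f x)) \<in> borel_measurable M"
  by (rule borel_measurable_continuous_on[where f=cnj]) (auto intro!: continuous_intros)

lemma L2_space_measurable [measurable_dest]: "f \<in> L2_space M \<Longrightarrow> f \<in> borel_measurable M"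
  by (simp add: L2_space_def)

lemma L2_space_integrable: "f \<in> L2_space M \<Longrightarrow> integrable M (\<lambda>x. (cmod (f x))\<^sup>2)"
  by (simp add: L2_space_def)

lemma L2_space_iff_nn_integral:
  assumes [measurable]: "f \<in> borel_measurable M"
  shows "f \<in> L2_space M \<longleftrightarrow> (\<integral>\<^sup>+x. ennreal ((cmod (f x))\<^sup>2) \<partial>M) < \<infinity>"
  unfolding L2_space_def by (simp add: integrable_iff_bounded)

lemma L2_norm_nonneg [simp]: "0 \<le> L2_norm M f"
  by (simp add: L2_norm_def)

lemma L2_norm_power2: "(L2_norm M f)\<^sup>2 = (\<integral>x. (cmod (f x))\<^sup>2 \<partial>M)"
  by (simp add: L2_norm_def)

lemma nn_integral_eq_L2_norm:
  "f \<in> L2_space M \<Longrightarrow> (\<integral>\<^sup>+x. ennreal ((cmod (f x))\<^sup>2) \<partial>M) = ennreal ((L2_norm M f)\<^sup>2)"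
  unfolding L2_norm_power2 by (intro nn_integral_eq_integral L2_space_integrable) auto

text \<open>
  The Bochner integral of a function that is not integrable is \<open>0\<close>, so an equality of
  Bochner integrals does not transfer membership in \<open>L\<^sup>2\<close>. An equality of nonnegative
  integrals transfers membership and norm at once; every isometry below is obtained in this way.
\<close>

lemma L2_norm_eqI_nn_integral:
  assumes "f \<in> borel_measurable M" "g \<in> L2_space N"
    and "(\<integral>\<^sup>+x. ennreal ((cmod (f x))\<^sup>2) \<partial>M) = (\<integral>\<^sup>+x. ennreal ((cmod (g x))\<^sup>2) \<partial>N)"
  shows "f \<in> L2_space M \<and> L2_norm M f = L2_norm N g"
proof -
  have *: "f \<in> L2_space M"
    using assms nn_integral_eq_L2_norm[OF assms(2)] by (subst L2_space_iff_nn_integral) auto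
  have "ennreal ((L2_norm M f)\<^sup>2) = ennreal ((L2_norm N g)\<^sup>2)"
    using assms(3) nn_integral_eq_L2_norm[OF *] nn_integral_eq_L2_norm[OF assms(2)] by simp
  then have "(L2_norm M f)\<^sup>2 = (L2_norm N g)\<^sup>2"
    by (simp add: ennreal_inj)
  with * show ?thesis by (simp add: power2_eq_iff_nonneg)
qed

lemma L2_space_cong_AE:
  assumes "f \<in> L2_space M" "g \<in> borel_measurable M" "AE x in M. f x = g x"
  shows "g \<in> L2_space M" "L2_norm M g = L2_norm M f"
proof -
  have "(\<integral>\<^sup>+x. ennreal ((cmod (g x))\<^sup>2) \<partial>M) = (\<integral>\<^sup>+x. ennreal ((cmod (f x))\<^sup>2) \<partial>M)"
    using assms(3) by (intro nn_integral_cong_AE) auto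
  from L2_norm_eqI_nn_integral[OF assms(2,1) this]
  show "g \<in> L2_space M" "L2_norm M g = L2_norm M f" by auto
qed

lemma L2_inner_cong_AE:
  assumes "f \<in> borel_measurable M" "g \<in> borel_measurable M" "h \<in> borel_measurable M"
    "AE x in M. f x = g x"
  shows "L2_inner M f h = L2_inner M g h"
  unfolding L2_inner_def using assms by (intro integral_cong_AE) auto

lemma cmod_mult_le_squares: "cmod (a * b) \<le> (cmod a)\<^sup>2 + (cmod b)\<^sup>2"
proof -
  have "cmod a * cmod b \<le> (cmod a)\<^sup>2 + (cmod b)\<^sup>2"
    using sum_squares_bound[of "cmod a" "cmod b"] mult_nonneg_nonneg[OF norm_ge_zero[of a] norm_ge_zero[of b]]
    by linarith
  then show ?thesis by (simp add: norm_mult)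
qed

lemma L2_integrable_mult:
  assumes "f \<in> L2_space M" "g \<in> L2_space M"
  shows "integrable M (\<lambda>x. f x * g x)"
proof (rule Bochner_Integration.integrable_bound)
  show "integrable M (\<lambda>x. (cmod (f x))\<^sup>2 + (cmod (g x))\<^sup>2)"
    using assms by (intro Bochner_Integration.integrable_add L2_space_integrable)
  show "AE x in M. norm (f x * g x) \<le> norm ((cmod (f x))\<^sup>2 + (cmod (g x))\<^sup>2)"
    using cmod_mult_le_squares by (intro AE_I2) (metis abs_of_nonneg add_nonneg_nonneg real_norm_def zero_le_power2)
qed (use assms in measurable)

lemma L2_space_cnj: "f \<in> L2_space M \<Longrightarrow> (\<lambda>x. cnj (f x)) \<in> L2_space M"
  by (auto simp: L2_space_def)

lemma L2_inner_integrable: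
  "f \<in> L2_space M \<Longrightarrow> g \<in> L2_space M \<Longrightarrow> integrable M (\<lambda>x. f x * cnj (g x))"
  by (intro L2_integrable_mult L2_space_cnj)

lemma L2_space_zero [simp]: "(\<lambda>x. 0) \<in> L2_space M"
  by (simp add: L2_space_def)

lemma L2_space_add:
  assumes "f \<in> L2_space M" "g \<in> L2_space M"
  shows "(\<lambda>x. f x + g x) \<in> L2_space M"
proof -
  have "integrable M (\<lambda>x. (cmod (f x + g x))\<^sup>2)"
  proof (rule Bochner_Integration.integrable_bound)
    show "integrable M (\<lambda>x. 2 * (cmod (f x))\<^sup>2 + 2 * (cmod (g x))\<^sup>2)"
      using assms by (intro Bochner_Integration.integrable_add integrable_mult_right L2_space_integrable)
    have "(cmod (a + b))\<^sup>2 \<le> 2 * (cmod a)\<^sup>2 + 2 * (cmod b)\<^sup>2" for a b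
    proof -
      have "(cmod (a + b))\<^sup>2 \<le> (cmod a + cmod b)\<^sup>2" by (intro power_mono norm_triangle_ineq) auto
      also have "\<dots> \<le> 2 * (cmod a)\<^sup>2 + 2 * (cmod b)\<^sup>2"
        using sum_squares_bound[of "cmod a" "cmod b"] by (simp add: power2_sum)
      finally show ?thesis .
    qed
    then show "AE x in M. norm ((cmod (f x + g x))\<^sup>2) \<le> norm (2 * (cmod (f x))\<^sup>2 + 2 * (cmod (g x))\<^sup>2)"
      by auto
  qed (use assms in measurable)
  then show ?thesis using assms by (auto simp: L2_space_def)
qed

lemma L2_space_cmult: "f \<in> L2_space M \<Longrightarrow> (\<lambda>x. c * f x) \<in> L2_space M"
  by (auto simp: L2_space_def norm_mult power_mult_distrib)

lemma L2_space_diff: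
  assumes "f \<in> L2_space M" "g \<in> L2_space M"
  shows "(\<lambda>x. f x - g x) \<in> L2_space M"
  using L2_space_add[OF assms(1) L2_space_cmult[OF assms(2), of "-1"]] by simp

lemma L2_space_sum:
  "(\<And>k. k \<in> K \<Longrightarrow> f k \<in> L2_space M) \<Longrightarrow> (\<lambda>x. \<Sum>k\<in>K. f k x) \<in> L2_space M"
  by (induction K rule: infinite_finite_induct) (auto intro: L2_space_add)

lemma L2_inner_diff_left:
  assumes "f \<in> L2_space M" "g \<in> L2_space M" "h \<in> L2_space M"
  shows "L2_inner M (\<lambda>x. f x - g x) h = L2_inner M f h - L2_inner M g h"
  unfolding L2_inner_def left_diff_distrib
  using assms by (intro Bochner_Integration.integral_diff L2_inner_integrable)

lemma L2_inner_cmult_left: "L2_inner M (\<lambda>x. c * f x) h = c * L2_inner M f h"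
  unfolding L2_inner_def by (simp add: mult.assoc)

lemma L2_inner_sum_left:
  assumes "\<And>k. k \<in> K \<Longrightarrow> f k \<in> L2_space M" "h \<in> L2_space M"
  shows "L2_inner M (\<lambda>x. \<Sum>k\<in>K. f k x) h = (\<Sum>k\<in>K. L2_inner M (f k) h)"
  unfolding L2_inner_def sum_distrib_right
  using assms by (intro Bochner_Integration.integral_sum L2_inner_integrable)

lemma L2_inner_commute: "L2_inner M g f = cnj (L2_inner M f g)"
proof -
  have "cnj (L2_inner M f g) = (\<integral>x. cnj (f x * cnj (g x)) \<partial>M)"
    unfolding L2_inner_def by (rule Bochner_Integration.integral_cnj[symmetric])
  then show ?thesis unfolding L2_inner_def by (simp add: mult.commute)
qed

lemma L2_inner_self: "L2_inner M f f = complex_of_real ((L2_norm M f)\<^sup>2)"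
  unfolding L2_inner_def L2_norm_power2 complex_norm_square[symmetric] of_real_power[symmetric]
  by (rule integral_complex_of_real)

text \<open>
  The usual discriminant argument: \<open>s\<^sup>2 * a - 2 * s * c + b\<close> is the integral of a square for
  every real \<open>s\<close>. The case \<open>a = 0\<close> needs its own choice of \<open>s\<close>.
\<close>

lemma L2_Cauchy_Schwarz:
  assumes f: "f \<in> L2_space M" and g: "g \<in> L2_space M"
  shows "cmod (L2_inner M f g) \<le> L2_norm M f * L2_norm M g"
proof -
  define a b c where "a = (L2_norm M f)\<^sup>2" and "b = (L2_norm M g)\<^sup>2"
    and "c = (\<integral>x. cmod (f x) * cmod (g x) \<partial>M)"
  have ab: "a \<ge> 0" "b \<ge> 0" by (auto simp: a_def b_def)
  have int: "integrable M (\<lambda>x. cmod (f x) * cmod (g x))"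
    using integrable_norm[OF L2_inner_integrable[OF f g]] by (simp add: norm_mult)
  have c: "c \<ge> 0" unfolding c_def by (intro integral_nonneg_AE) auto
  have quad: "0 \<le> s\<^sup>2 * a - 2 * s * c + b" for s
  proof -
    have "0 \<le> (\<integral>x. (s * cmod (f x) - cmod (g x))\<^sup>2 \<partial>M)" by (intro integral_nonneg_AE) auto
    also have "\<dots> = (\<integral>x. s\<^sup>2 * (cmod (f x))\<^sup>2 - 2 * s * (cmod (f x) * cmod (g x)) + (cmod (g x))\<^sup>2 \<partial>M)"
      by (intro Bochner_Integration.integral_cong) (auto simp: power2_eq_square algebra_simps)
    also have "\<dots> = s\<^sup>2 * a - 2 * s * c + b"
      unfolding a_def b_def c_def L2_norm_power2
      using int L2_space_integrable[OF f] L2_space_integrable[OF g] by simp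
    finally show ?thesis .
  qed
  have "c\<^sup>2 \<le> a * b"
  proof (cases "a = 0")
    case True
    have "c = 0"
    proof (rule ccontr)
      assume "c \<noteq> 0"
      then show False using quad[of "(b + 1) / (2 * c)"] True by (simp add: field_simps)
    qed
    then show ?thesis using True by simp
  next
    case False
    then have "0 \<le> a * ((c / a)\<^sup>2 * a - 2 * (c / a) * c + b)" using quad[of "c / a"] ab by simp
    also have "\<dots> = a * b - c\<^sup>2" using False by (simp add: field_simps power2_eq_square)
    finally show ?thesis by simp
  qed
  then have "c\<^sup>2 \<le> (L2_norm M f * L2_norm M g)\<^sup>2" by (simp add: a_def b_def power_mult_distrib)
  then have "c \<le> L2_norm M f * L2_norm M g" by (rule power2_le_imp_le) simp
  moreover have "cmod (L2_inner M f g) \<le> c"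
    unfolding L2_inner_def c_def using integral_norm_bound[of M "\<lambda>x. f x * cnj (g x)"]
    by (simp add: norm_mult)
  ultimately show ?thesis by linarith
qed

lemma L2_norm_diff_power2:
  assumes f: "f \<in> L2_space M" and g: "g \<in> L2_space M"
  shows "(L2_norm M (\<lambda>x. f x - g x))\<^sup>2 = (L2_norm M f)\<^sup>2 - 2 * Re (L2_inner M f g) + (L2_norm M g)\<^sup>2"
proof -
  have eq: "(cmod (a - b))\<^sup>2 = (cmod a)\<^sup>2 - 2 * Re (a * cnj b) + (cmod b)\<^sup>2" for a b :: complex
    by (simp add: cmod_power2) (simp add: power2_eq_square algebra_simps)
  define c where "c x = Re (f x * cnj (g x))" for x
  have c: "integrable M c" "Re (L2_inner M f g) = (\<integral>x. c x \<partial>M)"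
    unfolding L2_inner_def c_def
    by (rule integrable_Re integral_Re[symmetric], rule L2_inner_integrable[OF f g])+
  show ?thesis
    unfolding L2_norm_power2 eq c(2) c_def[symmetric]
    using L2_space_integrable[OF f] L2_space_integrable[OF g] c(1) by simp
qed

lemma L2_norm_diff_commute: "L2_norm M (\<lambda>x. f x - g x) = L2_norm M (\<lambda>x. g x - f x)"
  by (simp add: L2_norm_def norm_minus_commute)

lemma L2_norm_diff_le:
  assumes f: "f \<in> L2_space M" and g: "g \<in> L2_space M"
  shows "L2_norm M (\<lambda>x. f x - g x) \<le> L2_norm M f + L2_norm M g"
proof (rule power2_le_imp_le)
  have "- Re (L2_inner M f g) \<le> L2_norm M f * L2_norm M g"
    using L2_Cauchy_Schwarz[OF f g] abs_Re_le_cmod[of "L2_inner M f g"] by linarith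
  then show "(L2_norm M (\<lambda>x. f x - g x))\<^sup>2 \<le> (L2_norm M f + L2_norm M g)\<^sup>2"
    unfolding L2_norm_diff_power2[OF f g] by (simp add: power2_sum)
qed simp

lemma L2_norm_triangle:
  assumes "f \<in> L2_space M" "g \<in> L2_space M" "h \<in> L2_space M"
  shows "L2_norm M (\<lambda>x. f x - h x) \<le> L2_norm M (\<lambda>x. f x - g x) + L2_norm M (\<lambda>x. g x - h x)"
  using L2_norm_diff_le[OF L2_space_diff[OF assms(1,2)] L2_space_diff[OF assms(3,2)]]
  by (simp add: L2_norm_diff_commute[of M g h])

lemma L2_norm_eq_0_AE:
  assumes "f \<in> L2_space M" "L2_norm M f = 0"
  shows "AE x in M. f x = 0"
proof -
  have "(\<integral>x. (cmod (f x))\<^sup>2 \<partial>M) = 0" using assms(2) unfolding L2_norm_power2[symmetric] by simp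
  then have "AE x in M. (cmod (f x))\<^sup>2 = 0"
    using integral_nonneg_eq_0_iff_AE[OF L2_space_integrable[OF assms(1)]] by auto
  then show ?thesis by auto
qed

lemma L2_tendsto_unique:
  assumes u: "L2_tendsto M u g F" and v: "L2_tendsto M u h F" and F: "F \<noteq> bot"
  shows "AE x in M. g x = h x"
proof -
  have gh: "g \<in> L2_space M" "h \<in> L2_space M" using u v by (auto simp: L2_tendsto_def)
  have "((\<lambda>i. L2_norm M (\<lambda>x. u i x - g x) + L2_norm M (\<lambda>x. u i x - h x)) \<longlongrightarrow> 0 + 0) F"
    using u v unfolding L2_tendsto_def by (intro tendsto_add) auto
  moreover have "\<forall>\<^sub>F i in F. L2_norm M (\<lambda>x. g x - h x)
      \<le> L2_norm M (\<lambda>x. u i x - g x) + L2_norm M (\<lambda>x. u i x - h x)"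
    using u unfolding L2_tendsto_def
    by (auto elim!: eventually_mono simp: L2_norm_diff_commute[of M _ g] intro!: L2_norm_triangle gh)
  ultimately have "L2_norm M (\<lambda>x. g x - h x) \<le> 0 + 0"
    by (rule tendsto_lowerbound[OF _ _ F])
  then have "L2_norm M (\<lambda>x. g x - h x) = 0" by (simp add: antisym)
  from L2_norm_eq_0_AE[OF L2_space_diff[OF gh] this] show ?thesis by auto
qed

lemma L2_tendsto_inner:
  assumes u: "L2_tendsto M u g F" and e: "e \<in> L2_space M"
  shows "((\<lambda>i. L2_inner M (u i) e) \<longlongrightarrow> L2_inner M g e) F"
proof -
  have g: "g \<in> L2_space M" using u by (auto simp: L2_tendsto_def)
  have "((\<lambda>i. L2_norm M (\<lambda>x. u i x - g x) * L2_norm M e) \<longlongrightarrow> 0) F"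
    using u unfolding L2_tendsto_def by (intro tendsto_mult_left_zero) auto
  moreover have "\<forall>\<^sub>F i in F. norm (L2_inner M (u i) e - L2_inner M g e)
      \<le> L2_norm M (\<lambda>x. u i x - g x) * L2_norm M e"
    using u unfolding L2_tendsto_def
    by (auto elim!: eventually_mono
        simp: L2_inner_diff_left[OF _ g e, symmetric] intro!: L2_Cauchy_Schwarz L2_space_diff g e)
  ultimately have "((\<lambda>i. L2_inner M (u i) e - L2_inner M g e) \<longlongrightarrow> 0) F"
    by (rule Lim_null_comparison[rotated])
  then show ?thesis by (simp add: LIM_zero_iff)
qed

lemma ennreal_suminf_finite_geometric: "(\<Sum>k. ennreal ((1/2) ^ k)) < \<infinity>"
proof -
  have "(\<Sum>k. ennreal ((1/2) ^ k)) = ennreal (\<Sum>k. (1/2) ^ k)"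
    by (intro suminf_ennreal2 summable_geometric) auto
  then show ?thesis by simp
qed

text \<open>
  A subsequence with \<open>\<parallel>u (r (Suc k)) - u (r k)\<parallel> \<le> (1/2) ^ k\<close> converges almost everywhere, and by
  Fatou's lemma its pointwise limit is also the limit in norm of the whole sequence.
\<close>

theorem L2_complete:
  assumes u: "\<And>n. u n \<in> L2_space M"
    and cau: "\<And>\<epsilon>. \<epsilon> > 0 \<Longrightarrow> \<exists>N. \<forall>m\<ge>N. \<forall>n\<ge>N. L2_norm M (\<lambda>x. u m x - u n x) < \<epsilon>"
  shows "\<exists>g. L2_tendsto M u g sequentially"
proof -
  note [measurable] = L2_space_measurable[OF u]
  obtain R where R: "\<And>k m n. m \<ge> R k \<Longrightarrow> n \<ge> R k \<Longrightarrow> L2_norm M (\<lambda>x. u m x - u n x) < (1/2::real) ^ k"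
    using cau[of "(1/2) ^ k" for k] by (metis zero_less_power half_gt_zero zero_less_one)
  define r where "r k = (\<Sum>i\<le>k. R i)" for k
  have r: "r j \<ge> R k" if "j \<ge> k" for j k
    unfolding r_def using that by (intro member_le_sum) auto
  define v where "v k x = u (r (Suc k)) x - u (r k) x" for k x
  have vL: "v k \<in> L2_space M" for k unfolding v_def by (intro L2_space_diff u)
  note [measurable] = L2_space_measurable[OF vL]
  define g where "g x = lim (\<lambda>k. u (r k) x)" for x
  have g[measurable]: "g \<in> borel_measurable M" unfolding g_def by measurable
  have "(\<integral>\<^sup>+x. (\<Sum>k. ennreal (2 ^ k * (cmod (v k x))\<^sup>2)) \<partial>M)
      = (\<Sum>k. (\<integral>\<^sup>+x. ennreal (2 ^ k * (cmod (v k x))\<^sup>2) \<partial>M))"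
    by (intro nn_integral_suminf) measurable
  also have "\<dots> \<le> (\<Sum>k. ennreal ((1/2) ^ k))"
  proof (intro suminf_le summableI)
    fix k
    have "(\<integral>\<^sup>+x. ennreal (2 ^ k * (cmod (v k x))\<^sup>2) \<partial>M) = ennreal (2 ^ k) * ennreal ((L2_norm M (v k))\<^sup>2)"
      by (simp add: ennreal_mult nn_integral_cmult nn_integral_eq_L2_norm[OF vL])
    also have "\<dots> = ennreal (2 ^ k * (L2_norm M (v k))\<^sup>2)" by (simp add: ennreal_mult)
    also have "\<dots> \<le> ennreal ((1/2) ^ k)"
    proof (intro ennreal_leI)
      have "L2_norm M (v k) \<le> (1/2) ^ k"
        unfolding v_def using r[of k "Suc k"] r[of k k] by (intro less_imp_le[OF R]) auto
      then have "(L2_norm M (v k))\<^sup>2 \<le> ((1/2) ^ k)\<^sup>2" by (intro power_mono) auto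
      then have "2 ^ k * (L2_norm M (v k))\<^sup>2 \<le> 2 ^ k * ((1/2) ^ k)\<^sup>2" by simp
      also have "\<dots> = (1/2) ^ k" by (simp add: power2_eq_square power_divide)
      finally show "2 ^ k * (L2_norm M (v k))\<^sup>2 \<le> (1/2) ^ k" .
    qed
    finally show "(\<integral>\<^sup>+x. ennreal (2 ^ k * (cmod (v k x))\<^sup>2) \<partial>M) \<le> ennreal ((1/2) ^ k)" .
  qed
  also have "\<dots> < \<infinity>" by (rule ennreal_suminf_finite_geometric)
  finally have fin: "(\<integral>\<^sup>+x. (\<Sum>k. ennreal (2 ^ k * (cmod (v k x))\<^sup>2)) \<partial>M) \<noteq> \<infinity>" by simp
  have lim: "AE x in M. (\<lambda>k. u (r k) x) \<longlonglongrightarrow> g x"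
  proof -
    have "AE x in M. (\<Sum>k. ennreal (2 ^ k * (cmod (v k x))\<^sup>2)) \<noteq> \<infinity>"
      using fin by (intro nn_integral_PInf_AE) auto
    then show ?thesis
    proof (eventually_elim)
      case (elim x)
      then have "summable (\<lambda>k. 2 ^ k * (cmod (v k x))\<^sup>2)"
        by (intro summable_suminf_not_top) auto
      then have "summable (\<lambda>k. 2 ^ k * (cmod (v k x))\<^sup>2 + (1/2) ^ k)"
        by (intro summable_add summable_geometric) auto
      then have "summable (\<lambda>k. v k x)"
      proof (rule summable_comparison_test')
        fix k :: nat
        \<comment> \<open>Young's inequality bounds \<open>cmod (v k x)\<close> by the terms of two convergent series.\<close>
        have "cmod (v k x) * 1 \<le> 2 ^ k * (cmod (v k x))\<^sup>2 + (1/2) ^ k"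
        proof -
          define t where "t = (2::real) ^ k"
          have t: "t > 0" "(1/2::real) ^ k = 1 / t" by (auto simp: t_def power_divide)
          have "0 \<le> (t * cmod (v k x) - 1)\<^sup>2 + t * cmod (v k x)" using t by simp
          also have "\<dots> = t * (t * (cmod (v k x))\<^sup>2 + 1 / t - cmod (v k x))"
            using t by (simp add: power2_eq_square field_simps)
          finally have "0 \<le> t * (cmod (v k x))\<^sup>2 + 1 / t - cmod (v k x)"
            using t(1) by (simp add: zero_le_mult_iff)
          then show ?thesis unfolding t(2) t_def[symmetric] by simp
        qed
        then show "norm (v k x) \<le> 2 ^ k * (cmod (v k x))\<^sup>2 + (1/2) ^ k" by simp
      qed
      then have "convergent (\<lambda>n. \<Sum>k<n. v k x)" by (simp add: summable_iff_convergent)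
      moreover have "(\<Sum>k<n. v k x) = u (r n) x - u (r 0) x" for n
        unfolding v_def by (rule sum_lessThan_telescope)
      ultimately have "convergent (\<lambda>n. u (r n) x - u (r 0) x)" by simp
      from convergent_add[OF this convergent_const[of "u (r 0) x"]]
      have "convergent (\<lambda>n. u (r n) x)" by simp
      then show ?case unfolding g_def by (simp add: convergent_LIMSEQ_iff)
    qed
  qed
  have bound: "(\<integral>\<^sup>+x. ennreal ((cmod (u n x - g x))\<^sup>2) \<partial>M) \<le> ennreal (((1/2) ^ k)\<^sup>2)" if n: "n \<ge> R k" for n k
  proof -
    have "(\<integral>\<^sup>+x. ennreal ((cmod (u n x - g x))\<^sup>2) \<partial>M)
      = (\<integral>\<^sup>+x. liminf (\<lambda>j. ennreal ((cmod (u n x - u (r j) x))\<^sup>2)) \<partial>M)"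
      using lim
    proof (intro nn_integral_cong_AE, eventually_elim)
      case (elim x)
      then have "(\<lambda>j. ennreal ((cmod (u n x - u (r j) x))\<^sup>2)) \<longlonglongrightarrow> ennreal ((cmod (u n x - g x))\<^sup>2)"
        by (intro tendsto_intros) auto
      then show ?case by (intro lim_imp_Liminf[symmetric]) auto
    qed
    also have "\<dots> \<le> liminf (\<lambda>j. \<integral>\<^sup>+x. ennreal ((cmod (u n x - u (r j) x))\<^sup>2) \<partial>M)"
      by (intro nn_integral_liminf) measurable
    also have "\<dots> \<le> ennreal (((1/2) ^ k)\<^sup>2)"
    proof (rule Liminf_le)
      show "\<forall>\<^sub>F j in sequentially. (\<integral>\<^sup>+x. ennreal ((cmod (u n x - u (r j) x))\<^sup>2) \<partial>M) \<le> ennreal (((1/2) ^ k)\<^sup>2)"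
        using eventually_ge_at_top[of k]
      proof eventually_elim
        case (elim j)
        have "(L2_norm M (\<lambda>x. u n x - u (r j) x))\<^sup>2 \<le> ((1/2) ^ k)\<^sup>2"
          by (intro power_mono less_imp_le[OF R] n r elim) auto
        then show ?case
          by (subst nn_integral_eq_L2_norm[OF L2_space_diff[OF u u]]) (rule ennreal_leI)
      qed
    qed simp
    finally show ?thesis .
  qed
  have diff: "(\<lambda>x. u n x - g x) \<in> L2_space M" if "n \<ge> R 0" for n
    using bound[OF that] by (subst L2_space_iff_nn_integral) (auto simp: le_less_trans)
  have gL: "g \<in> L2_space M"
    using L2_space_diff[OF u[of "R 0"] diff[of "R 0"]] by simp
  have "(\<lambda>n. L2_norm M (\<lambda>x. u n x - g x)) \<longlonglongrightarrow> 0"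
  proof (rule LIMSEQ_I)
    fix \<epsilon> :: real assume "\<epsilon> > 0"
    then obtain k where k: "(1/2) ^ k < \<epsilon>" using real_arch_pow_inv[of \<epsilon> "1/2"] by auto
    show "\<exists>no. \<forall>n\<ge>no. norm (L2_norm M (\<lambda>x. u n x - g x) - 0) < \<epsilon>"
    proof (intro exI allI impI)
      fix n assume n: "n \<ge> R k"
      have "ennreal ((L2_norm M (\<lambda>x. u n x - g x))\<^sup>2) \<le> ennreal (((1/2) ^ k)\<^sup>2)"
        using bound[OF n] by (simp add: nn_integral_eq_L2_norm[OF L2_space_diff[OF u gL]])
      then have "(L2_norm M (\<lambda>x. u n x - g x))\<^sup>2 \<le> ((1/2) ^ k)\<^sup>2"
        by (simp add: ennreal_le_iff)
      then have "L2_norm M (\<lambda>x. u n x - g x) \<le> (1/2) ^ k" by (rule power2_le_imp_le) simp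
      with k show "norm (L2_norm M (\<lambda>x. u n x - g x) - 0) < \<epsilon>" by simp
    qed
  qed
  then show ?thesis using u gL unfolding L2_tendsto_def by auto
qed

section \<open>Orthonormal bases\<close>

text \<open>
  An exhaustion of a countable index type by finite sets, which makes unconditional sums accessible
  to theorems on sequences.
\<close>

definition first_indices :: "nat \<Rightarrow> 'k::countable set" where
  "first_indices n = {k. to_nat k < n}"

lemma finite_first_indices [simp]: "finite (first_indices n :: 'k::countable set)"
proof -
  have "first_indices n = (to_nat :: 'k \<Rightarrow> nat) -` {..<n}" by (auto simp: first_indices_def)
  then show ?thesis by (simp add: finite_vimageI)
qed

lemma first_indices_mono: "m \<le> n \<Longrightarrow> first_indices m \<subseteq> first_indices n"
  by (auto simp: first_indices_def)

lemma finite_subset_first_indices: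
  assumes "finite K" shows "\<exists>N. \<forall>n\<ge>N. K \<subseteq> first_indices n"
proof (intro exI allI impI subsetI)
  fix n k assume "n \<ge> Suc (\<Sum>k\<in>K. to_nat k)" "k \<in> K"
  moreover from this have "to_nat k \<le> (\<Sum>k\<in>K. to_nat k)" using assms by (intro member_le_sum) auto
  ultimately show "k \<in> first_indices n" by (simp add: first_indices_def)
qed

lemma nn_integral_count_space_eq_has_sum:
  fixes a :: "'k \<Rightarrow> real"
  assumes nn: "\<And>k. a k \<ge> 0" and s: "(a has_sum T) UNIV"
  shows "(\<integral>\<^sup>+k. ennreal (a k) \<partial>count_space UNIV) = ennreal T"
proof -
  have "a summable_on UNIV" using s by (auto simp: summable_on_def)
  then have "Infinite_Sum.abs_summable_on a UNIV" using nn by simp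
  then have *: "Infinite_Set_Sum.abs_summable_on a UNIV" by (rule abs_summable_equivalent[THEN iffD1])
  show ?thesis
    using nn_integral_conv_infsetsum[OF *] nn infsetsum_infsum[OF *] infsumI[OF s] by simp
qed

lemma nn_integral_count_space_finite_imp_summable:
  fixes a :: "'k \<Rightarrow> real"
  assumes nn: "\<And>k. a k \<ge> 0" and fin: "(\<integral>\<^sup>+k. ennreal (a k) \<partial>count_space UNIV) < \<infinity>"
  shows "a summable_on UNIV"
proof -
  have "integrable (count_space UNIV) a"
    using nn fin by (simp add: integrable_iff_bounded)
  then have "Infinite_Set_Sum.abs_summable_on a UNIV"
    by (simp add: Infinite_Set_Sum.abs_summable_on_def)
  then show ?thesis using nn by (simp add: abs_summable_equivalent[symmetric])
qed

lemma L2_inner_sum_right: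
  assumes "\<And>k. k \<in> K \<Longrightarrow> f k \<in> L2_space M" "h \<in> L2_space M"
  shows "L2_inner M h (\<lambda>x. \<Sum>k\<in>K. f k x) = (\<Sum>k\<in>K. L2_inner M h (f k))"
  by (subst L2_inner_commute, subst L2_inner_sum_left[OF assms])
     (auto simp: L2_inner_commute[of M h])

lemma L2_norm_sum_orthogonal:
  assumes \<phi>: "\<And>k. \<phi> k \<in> L2_space M"
    and orth: "\<And>k l. k \<noteq> l \<Longrightarrow> L2_inner M (\<phi> k) (\<phi> l) = 0" and K: "finite K"
  shows "(L2_norm M (\<lambda>x. \<Sum>k\<in>K. \<phi> k x))\<^sup>2 = (\<Sum>k\<in>K. (L2_norm M (\<phi> k))\<^sup>2)"
proof -
  have "complex_of_real ((L2_norm M (\<lambda>x. \<Sum>k\<in>K. \<phi> k x))\<^sup>2)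
      = (\<Sum>k\<in>K. L2_inner M (\<phi> k) (\<lambda>x. \<Sum>l\<in>K. \<phi> l x))"
    unfolding L2_inner_self[symmetric] by (intro L2_inner_sum_left \<phi> L2_space_sum)
  also have "\<dots> = (\<Sum>k\<in>K. \<Sum>l\<in>K. L2_inner M (\<phi> k) (\<phi> l))"
    by (intro sum.cong refl L2_inner_sum_right \<phi>)
  also have "\<dots> = (\<Sum>k\<in>K. \<Sum>l\<in>K. if l = k then complex_of_real ((L2_norm M (\<phi> k))\<^sup>2) else 0)"
    by (intro sum.cong refl) (auto simp: L2_inner_self orth)
  also have "\<dots> = complex_of_real (\<Sum>k\<in>K. (L2_norm M (\<phi> k))\<^sup>2)"
    using K by simp
  finally show ?thesis unfolding of_real_eq_iff .
qed

text \<open>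
  By Pythagoras the partial sums form a Cauchy sequence. This is stated for orthogonal families, not
  for multiples of an orthonormal one, because it is applied both in \<open>L\<^sup>2(M)\<close> and to
  the family \<open>F (k, p) * e p k x\<close> on a product space, where the coefficients depend on the point.
\<close>

lemma orthogonal_series_converges:
  fixes \<phi> :: "'k::countable \<Rightarrow> 'a \<Rightarrow> complex"
  assumes \<phi>: "\<And>k. \<phi> k \<in> L2_space M"
    and orth: "\<And>k l. k \<noteq> l \<Longrightarrow> L2_inner M (\<phi> k) (\<phi> l) = 0"
    and sm: "(\<lambda>k. (L2_norm M (\<phi> k))\<^sup>2) summable_on UNIV"
  shows "\<exists>g. L2_tendsto M (\<lambda>n x. \<Sum>k\<in>first_indices n. \<phi> k x) g sequentially"
proof (rule L2_complete)
  show "(\<lambda>x. \<Sum>k\<in>first_indices n. \<phi> k x) \<in> L2_space M" for n by (intro L2_space_sum \<phi>)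
  define a where "a k = (L2_norm M (\<phi> k))\<^sup>2" for k
  define S where "S n x = (\<Sum>k\<in>first_indices n. \<phi> k x)" for n x
  fix \<epsilon> :: real assume \<epsilon>: "\<epsilon> > 0"
  obtain T where "(a has_sum T) UNIV" using sm by (auto simp: summable_on_def a_def[abs_def])
  then have "\<forall>\<^sub>F K in finite_subsets_at_top UNIV. dist (sum a K) T < \<epsilon>\<^sup>2 / 2"
    unfolding has_sum_def using \<epsilon> by (intro tendstoD) auto
  then obtain X where X: "finite X" "\<And>K. finite K \<Longrightarrow> X \<subseteq> K \<Longrightarrow> dist (sum a K) T < \<epsilon>\<^sup>2 / 2"
    unfolding eventually_finite_subsets_at_top by auto
  obtain N where N: "\<And>n. n \<ge> N \<Longrightarrow> X \<subseteq> first_indices n"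
    using finite_subset_first_indices[OF X(1)] by auto
  have *: "L2_norm M (\<lambda>x. S m x - S n x) < \<epsilon>" if "m \<ge> n" "n \<ge> N" for m n
  proof -
    have sub: "first_indices n \<subseteq> (first_indices m :: 'k set)" using that by (intro first_indices_mono)
    have "S m x - S n x = (\<Sum>k\<in>first_indices m - first_indices n. \<phi> k x)" for x
      unfolding S_def by (rule sum_diff[OF finite_first_indices sub, symmetric])
    then have "(L2_norm M (\<lambda>x. S m x - S n x))\<^sup>2 = (\<Sum>k\<in>first_indices m - first_indices n. a k)"
      using L2_norm_sum_orthogonal[of \<phi> M "first_indices m - first_indices n", OF \<phi> orth]
      by (simp add: a_def)
    also have "\<dots> = sum a (first_indices m) - sum a (first_indices n)"
      by (intro sum_diff sub) simp
    also have "\<dots> < \<epsilon>\<^sup>2"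
      using X(2)[OF finite_first_indices N, of n] X(2)[OF finite_first_indices N, of m] that
      unfolding dist_real_def by linarith
    finally show ?thesis using \<epsilon> by (simp add: power_less_imp_less_base)
  qed
  show "\<exists>N. \<forall>m\<ge>N. \<forall>n\<ge>N. L2_norm M (\<lambda>x. (\<Sum>k\<in>first_indices m. \<phi> k x) - (\<Sum>k\<in>first_indices n. \<phi> k x)) < \<epsilon>"
    unfolding S_def[symmetric]
  proof (intro exI allI impI)
    fix m n assume "m \<ge> N" "n \<ge> N"
    then show "L2_norm M (\<lambda>x. S m x - S n x) < \<epsilon>"
      using *[of n m] *[of m n] by (cases "m \<ge> n") (auto simp: L2_norm_diff_commute[of M "S m"])
  qed
qed

text \<open>
  Completeness is expressed by the triviality of the orthogonal complement, the form in which it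
  is proved for the Hermite functions.
\<close>

locale L2_orthonormal_basis =
  fixes M :: "'a measure" and e :: "'k::countable \<Rightarrow> 'a \<Rightarrow> complex"
  assumes in_L2: "e k \<in> L2_space M"
    and orthonormal: "L2_inner M (e k) (e l) = of_bool (k = l)"
    and complete: "g \<in> L2_space M \<Longrightarrow> (\<And>k. L2_inner M g (e k) = 0) \<Longrightarrow> AE x in M. g x = 0"
begin

lemma term_L2: "(\<lambda>x. c * e k x) \<in> L2_space M"
  by (intro L2_space_cmult in_L2)

lemma term_orthogonal: "k \<noteq> l \<Longrightarrow> L2_inner M (\<lambda>x. c * e k x) (\<lambda>x. d * e l x) = 0"
  unfolding L2_inner_cmult_left
  by (subst L2_inner_commute, subst L2_inner_cmult_left) (simp add: orthonormal)

lemma L2_norm_term: "(L2_norm M (\<lambda>x. c * e k x))\<^sup>2 = (cmod c)\<^sup>2"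
proof -
  have "(L2_norm M (e k))\<^sup>2 = 1"
    using L2_inner_self[of M "e k"] unfolding orthonormal by (simp del: of_real_power)
  then show ?thesis
    unfolding L2_norm_power2 by (simp add: norm_mult power_mult_distrib)
qed

lemma partial_sum_L2: "(\<lambda>x. \<Sum>k\<in>K. c k * e k x) \<in> L2_space M"
  by (intro L2_space_sum term_L2)

lemma partial_sum_norm:
  "finite K \<Longrightarrow> (L2_norm M (\<lambda>x. \<Sum>k\<in>K. c k * e k x))\<^sup>2 = (\<Sum>k\<in>K. (cmod (c k))\<^sup>2)"
  by (subst L2_norm_sum_orthogonal) (auto simp: term_L2 term_orthogonal L2_norm_term)

lemma partial_sum_coeff:
  assumes "finite K"
  shows "L2_inner M (\<lambda>x. \<Sum>k\<in>K. c k * e k x) (e l) = (if l \<in> K then c l else 0)"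
proof -
  have "L2_inner M (\<lambda>x. \<Sum>k\<in>K. c k * e k x) (e l) = (\<Sum>k\<in>K. c k * of_bool (k = l))"
    by (simp add: L2_inner_sum_left term_L2 in_L2 L2_inner_cmult_left orthonormal)
  also have "\<dots> = (\<Sum>k\<in>K. if k = l then c k else 0)" by (intro sum.cong) auto
  also have "\<dots> = (if l \<in> K then c l else 0)" using assms by simp
  finally show ?thesis .
qed

lemma coeff_le_norm:
  assumes "g \<in> L2_space M" shows "cmod (L2_inner M g (e k)) \<le> L2_norm M g"
proof -
  have "(L2_norm M (e k))\<^sup>2 = 1" using L2_norm_term[of 1 k] by simp
  then have "L2_norm M (e k) = 1" using power2_eq_imp_eq[of "L2_norm M (e k)" 1] by simp
  then show ?thesis using L2_Cauchy_Schwarz[OF assms in_L2, of k] by simp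
qed

text \<open>
  Since the error decreases when the index set grows, convergence along one exhaustion by finite
  sets is enough for unconditional convergence.
\<close>

lemma partial_sum_error:
  assumes g: "g \<in> L2_space M" and K: "finite K"
  shows "(L2_norm M (\<lambda>x. (\<Sum>k\<in>K. L2_inner M g (e k) * e k x) - g x))\<^sup>2
    = (L2_norm M g)\<^sup>2 - (\<Sum>k\<in>K. (cmod (L2_inner M g (e k)))\<^sup>2)"
proof -
  define S where "S x = (\<Sum>k\<in>K. L2_inner M g (e k) * e k x)" for x
  have S: "S \<in> L2_space M" unfolding S_def[abs_def] by (rule partial_sum_L2)
  have "L2_inner M S g = (\<Sum>k\<in>K. L2_inner M g (e k) * L2_inner M (e k) g)"
    unfolding S_def[abs_def] by (subst L2_inner_sum_left) (auto intro: term_L2 g simp: L2_inner_cmult_left)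
  also have "\<dots> = complex_of_real (\<Sum>k\<in>K. (cmod (L2_inner M g (e k)))\<^sup>2)"
    unfolding of_real_sum complex_norm_square by (simp only: L2_inner_commute[of M _ g])
  finally have i: "Re (L2_inner M S g) = (\<Sum>k\<in>K. (cmod (L2_inner M g (e k)))\<^sup>2)" by simp
  have n: "(L2_norm M S)\<^sup>2 = (\<Sum>k\<in>K. (cmod (L2_inner M g (e k)))\<^sup>2)"
    unfolding S_def[abs_def] by (rule partial_sum_norm[OF K])
  show ?thesis unfolding S_def[symmetric] L2_norm_diff_power2[OF S g] i n by simp
qed

text \<open>
  Limits of the partial sums have the prescribed coefficients because taking an inner product is
  continuous and the \<open>l\<close>-th coefficient of a partial sum is constant once \<open>l\<close> is included.
\<close>

lemma riesz_fischer:
  assumes "(\<lambda>k. (cmod (c k))\<^sup>2) summable_on UNIV"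
  shows "\<exists>s. L2_tendsto M (\<lambda>n x. \<Sum>k\<in>first_indices n. c k * e k x) s sequentially
    \<and> (\<forall>k. L2_inner M s (e k) = c k)"
proof -
  have "\<exists>s. L2_tendsto M (\<lambda>n x. \<Sum>k\<in>first_indices n. c k * e k x) s sequentially"
    by (rule orthogonal_series_converges) (auto simp: term_L2 term_orthogonal L2_norm_term assms)
  then obtain s where s: "L2_tendsto M (\<lambda>n x. \<Sum>k\<in>first_indices n. c k * e k x) s sequentially" ..
  have "L2_inner M s (e l) = c l" for l
  proof (rule LIMSEQ_unique[OF L2_tendsto_inner[OF s in_L2[of l]]])
    show "(\<lambda>n. L2_inner M (\<lambda>x. \<Sum>k\<in>first_indices n. c k * e k x) (e l)) \<longlonglongrightarrow> c l"
      by (rule tendsto_eventually, rule eventually_sequentiallyI[of "Suc (to_nat l)"])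
         (simp add: partial_sum_coeff, simp add: first_indices_def)
  qed
  with s show ?thesis by auto
qed

lemma AE_eq_if_coeffs_eq:
  assumes "g \<in> L2_space M" "h \<in> L2_space M" "\<And>k. L2_inner M g (e k) = L2_inner M h (e k)"
  shows "AE x in M. g x = h x"
proof -
  have "AE x in M. g x - h x = 0"
    by (rule complete) (auto intro: L2_space_diff assms simp: L2_inner_diff_left assms in_L2)
  then show ?thesis by auto
qed

lemma bessel:
  assumes g: "g \<in> L2_space M" and K: "finite K"
  shows "(\<Sum>k\<in>K. (cmod (L2_inner M g (e k)))\<^sup>2) \<le> (L2_norm M g)\<^sup>2"
  using zero_le_power2[of "L2_norm M (\<lambda>x. (\<Sum>k\<in>K. L2_inner M g (e k) * e k x) - g x)"]
  unfolding partial_sum_error[OF g K] by simp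

lemma coeffs_summable:
  assumes "g \<in> L2_space M"
  shows "(\<lambda>k. (cmod (L2_inner M g (e k)))\<^sup>2) summable_on UNIV"
  by (rule nonneg_bdd_above_summable_on) (auto intro!: bdd_aboveI2 bessel assms)

text \<open>
  The limit provided by \<open>riesz_fischer\<close> has the same coefficients as \<open>g\<close>, hence is \<open>g\<close>.
\<close>

lemma expansion_first_indices:
  assumes g: "g \<in> L2_space M"
  shows "L2_tendsto M (\<lambda>n x. \<Sum>k\<in>first_indices n. L2_inner M g (e k) * e k x) g sequentially"
proof -
  obtain s where s: "L2_tendsto M (\<lambda>n x. \<Sum>k\<in>first_indices n. L2_inner M g (e k) * e k x) s sequentially"
    and c: "\<And>k. L2_inner M s (e k) = L2_inner M g (e k)"
    using riesz_fischer[OF coeffs_summable[OF g]] by auto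
  have sL: "s \<in> L2_space M" using s by (simp add: L2_tendsto_def)
  have eq: "AE x in M. s x = g x" by (rule AE_eq_if_coeffs_eq[OF sL g c])
  have "L2_norm M (\<lambda>x. (\<Sum>k\<in>first_indices n. L2_inner M g (e k) * e k x) - g x)
      = L2_norm M (\<lambda>x. (\<Sum>k\<in>first_indices n. L2_inner M g (e k) * e k x) - s x)" for n
    by (rule L2_space_cong_AE(2)) (use eq in \<open>auto intro!: L2_space_diff L2_space_measurable partial_sum_L2 sL g\<close>)
  then show ?thesis using s g by (simp add: L2_tendsto_def)
qed

theorem expansion:
  assumes g: "g \<in> L2_space M"
  shows "L2_tendsto M (\<lambda>K x. \<Sum>k\<in>K. L2_inner M g (e k) * e k x) g (finite_subsets_at_top UNIV)"
proof -
  define D where "D K = L2_norm M (\<lambda>x. (\<Sum>k\<in>K. L2_inner M g (e k) * e k x) - g x)" for K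
  have mono: "D K \<le> D L" if "finite K" "L \<subseteq> K" for K L
  proof (rule power2_le_imp_le)
    show "(D K)\<^sup>2 \<le> (D L)\<^sup>2"
      unfolding D_def using that finite_subset[OF that(2,1)]
      by (simp add: partial_sum_error[OF g]) (auto intro: sum_mono2)
  qed (simp add: D_def)
  have "(D \<longlongrightarrow> 0) (finite_subsets_at_top UNIV)"
  proof (rule tendstoI)
    fix \<epsilon> :: real assume "\<epsilon> > 0"
    moreover have "(\<lambda>n. D (first_indices n)) \<longlonglongrightarrow> 0"
      using expansion_first_indices[OF g] by (simp add: L2_tendsto_def D_def)
    ultimately obtain n where n: "norm (D (first_indices n)) < \<epsilon>"
      using LIMSEQ_D[of "\<lambda>n. D (first_indices n)" 0 \<epsilon>] by auto
    show "\<forall>\<^sub>F K in finite_subsets_at_top UNIV. dist (D K) 0 < \<epsilon>"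
      unfolding eventually_finite_subsets_at_top
    proof (intro exI[of _ "first_indices n"] conjI allI impI)
      fix K :: "'k set" assume "finite K \<and> first_indices n \<subseteq> K \<and> K \<subseteq> UNIV"
      then have "D K \<le> D (first_indices n)" by (intro mono) auto
      moreover have "0 \<le> D K" by (simp add: D_def)
      ultimately show "dist (D K) 0 < \<epsilon>" using n by simp
    qed auto
  qed
  then show ?thesis unfolding D_def L2_tendsto_def using g by (simp add: partial_sum_L2)
qed

theorem parseval:
  assumes g: "g \<in> L2_space M"
  shows "(\<integral>\<^sup>+k. ennreal ((cmod (L2_inner M g (e k)))\<^sup>2) \<partial>count_space UNIV)
    = (\<integral>\<^sup>+x. ennreal ((cmod (g x))\<^sup>2) \<partial>M)"
proof -
  have "((\<lambda>k. (cmod (L2_inner M g (e k)))\<^sup>2) has_sum (L2_norm M g)\<^sup>2) UNIV"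
    unfolding has_sum_def
  proof -
    define D where "D K = L2_norm M (\<lambda>x. (\<Sum>k\<in>K. L2_inner M g (e k) * e k x) - g x)" for K
    have "((\<lambda>K. (L2_norm M g)\<^sup>2 - (D K)\<^sup>2) \<longlongrightarrow> (L2_norm M g)\<^sup>2 - 0\<^sup>2) (finite_subsets_at_top UNIV)"
      using expansion[OF g] unfolding D_def L2_tendsto_def
      by (intro tendsto_intros) auto
    then have lim: "((\<lambda>K. (L2_norm M g)\<^sup>2 - (D K)\<^sup>2) \<longlongrightarrow> (L2_norm M g)\<^sup>2) (finite_subsets_at_top UNIV)" by simp
    show "(sum (\<lambda>k. (cmod (L2_inner M g (e k)))\<^sup>2) \<longlongrightarrow> (L2_norm M g)\<^sup>2) (finite_subsets_at_top UNIV)"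
      by (rule Lim_transform_eventually[OF lim], rule eventually_finite_subsets_at_top_weakI)
         (simp add: D_def partial_sum_error[OF g])
  qed
  then show ?thesis
    by (simp add: nn_integral_count_space_eq_has_sum nn_integral_eq_L2_norm[OF g])
qed

end

section \<open>Measurable fields of orthonormal bases\<close>

text \<open>
  A family of orthonormal bases of \<open>L\<^sup>2(M)\<close> that depends measurably on a parameter in \<open>N\<close>.
  Expanding each slice gives a unitary map from \<open>L\<^sup>2(N \<Otimes> M)\<close> onto \<open>L\<^sup>2\<close> of
  the index set times \<open>N\<close>. Both halves of the argument are instances: the scaled Hermite functions
  vary with the parameter \<open>\<xi>\<close>, and the constant field of Hermite functions turns the
  slicewise Fourier transform into a multiplication of coefficients. Joint measurability is built in,
  which is what makes the slicewise transforms have jointly measurable versions.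
\<close>

locale measurable_basis_field = pair_sigma_finite N M
  for N :: "'p measure" and M :: "'x measure" +
  fixes e :: "'p \<Rightarrow> 'k::countable \<Rightarrow> 'x \<Rightarrow> complex"
  assumes e_measurable [measurable]: "(\<lambda>(p, x). e p k x) \<in> borel_measurable (N \<Otimes>\<^sub>M M)"
    and basis: "AE p in N. L2_orthonormal_basis M (e p)"
begin

lemma AE_slice_L2:
  assumes f: "f \<in> L2_space (N \<Otimes>\<^sub>M M)"
  shows "AE p in N. (\<lambda>x. f (p, x)) \<in> L2_space M"
proof -
  note [measurable] = L2_space_measurable[OF f]
  have "(\<integral>\<^sup>+p. (\<integral>\<^sup>+x. ennreal ((cmod (f (p, x)))\<^sup>2) \<partial>M) \<partial>N) = (\<integral>\<^sup>+z. ennreal ((cmod (f z))\<^sup>2) \<partial>(N \<Otimes>\<^sub>M M))"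
    by (intro M2.nn_integral_fst) measurable
  also have "\<dots> < \<infinity>" using f by (subst (asm) L2_space_iff_nn_integral) auto
  finally have "AE p in N. (\<integral>\<^sup>+x. ennreal ((cmod (f (p, x)))\<^sup>2) \<partial>M) \<noteq> \<infinity>"
    by (intro nn_integral_PInf_AE) auto
  then show ?thesis using AE_space
  proof eventually_elim
    case (elim p)
    then have [measurable]: "(\<lambda>x. f (p, x)) \<in> borel_measurable M" by measurable
    show ?case using elim by (simp add: L2_space_iff_nn_integral less_top[symmetric])
  qed
qed

lemma sigma_finite_count: "sigma_finite_measure (count_space (UNIV :: 'k set))"
  by (rule sigma_finite_measure_count_space_countable) simp

definition coeffs :: "('p \<times> 'x \<Rightarrow> complex) \<Rightarrow> 'k \<times> 'p \<Rightarrow> complex" where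
  "coeffs f = (\<lambda>(k, p). L2_inner M (\<lambda>x. f (p, x)) (e p k))"

lemma coeff_measurable:
  assumes [measurable]: "f \<in> borel_measurable (N \<Otimes>\<^sub>M M)"
  shows "(\<lambda>p. L2_inner M (\<lambda>x. f (p, x)) (e p k)) \<in> borel_measurable N"
proof -
  have [measurable]: "(\<lambda>z. e (fst z) k (snd z)) \<in> borel_measurable (N \<Otimes>\<^sub>M M)"
    using e_measurable[of k] by (simp add: case_prod_unfold)
  show ?thesis unfolding L2_inner_def by measurable
qed

lemma measurable_count_pairI:
  assumes "\<And>k. (\<lambda>p. F (k, p)) \<in> borel_measurable N"
  shows "F \<in> borel_measurable (count_space (UNIV :: 'k set) \<Otimes>\<^sub>M N)"
  by (rule measurable_pair_measure_countable1) (use assms in auto)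

lemma coeffs_measurable:
  "f \<in> borel_measurable (N \<Otimes>\<^sub>M M) \<Longrightarrow> coeffs f \<in> borel_measurable (count_space UNIV \<Otimes>\<^sub>M N)"
  by (rule measurable_count_pairI) (simp add: coeffs_def coeff_measurable)

text \<open>
  Parseval's identity on almost every slice, integrated over the parameter.
\<close>

theorem coeffs_isometry:
  assumes f: "f \<in> L2_space (N \<Otimes>\<^sub>M M)"
  shows "coeffs f \<in> L2_space (count_space UNIV \<Otimes>\<^sub>M N) \<and>
    L2_norm (count_space UNIV \<Otimes>\<^sub>M N) (coeffs f) = L2_norm (N \<Otimes>\<^sub>M M) f"
proof (rule L2_norm_eqI_nn_integral[OF _ f])
  interpret C: sigma_finite_measure "count_space (UNIV :: 'k set)" by (rule sigma_finite_count)
  interpret CN: pair_sigma_finite "count_space (UNIV :: 'k set)" N ..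
  note [measurable] = L2_space_measurable[OF f]
  show m[measurable]: "coeffs f \<in> borel_measurable (count_space UNIV \<Otimes>\<^sub>M N)"
    by (intro coeffs_measurable) simp
  have "(\<integral>\<^sup>+z. ennreal ((cmod (coeffs f z))\<^sup>2) \<partial>(count_space UNIV \<Otimes>\<^sub>M N))
      = (\<integral>\<^sup>+p. (\<integral>\<^sup>+k. ennreal ((cmod (coeffs f (k, p)))\<^sup>2) \<partial>count_space UNIV) \<partial>N)"
    by (intro CN.nn_integral_snd[symmetric]) measurable
  also have "\<dots> = (\<integral>\<^sup>+p. (\<integral>\<^sup>+x. ennreal ((cmod (f (p, x)))\<^sup>2) \<partial>M) \<partial>N)"
    using basis AE_slice_L2[OF f]
  proof (intro nn_integral_cong_AE, eventually_elim)
    case (elim p)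
    then interpret L2_orthonormal_basis M "e p" by simp
    show ?case unfolding coeffs_def prod.case by (rule parseval) fact
  qed
  also have "\<dots> = (\<integral>\<^sup>+z. ennreal ((cmod (f z))\<^sup>2) \<partial>(N \<Otimes>\<^sub>M M))"
    by (intro M2.nn_integral_fst) measurable
  finally show "(\<integral>\<^sup>+z. ennreal ((cmod (coeffs f z))\<^sup>2) \<partial>(count_space UNIV \<Otimes>\<^sub>M N))
    = (\<integral>\<^sup>+z. ennreal ((cmod (f z))\<^sup>2) \<partial>(N \<Otimes>\<^sub>M M))" .
qed

lemma AE_pair_eqI:
  assumes [measurable]: "f \<in> borel_measurable (N \<Otimes>\<^sub>M M)" "g \<in> borel_measurable (N \<Otimes>\<^sub>M M)"
    and "AE p in N. AE x in M. f (p, x) = g (p, x)"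
  shows "AE z in N \<Otimes>\<^sub>M M. f z = (g z :: complex)"
  by (rule AE_pair_measure) (use assms(3) in simp_all)

lemma AE_eq_if_coeffs_eq:
  assumes f: "f \<in> L2_space (N \<Otimes>\<^sub>M M)" and g: "g \<in> L2_space (N \<Otimes>\<^sub>M M)"
    and eq: "AE p in N. \<forall>k. coeffs f (k, p) = coeffs g (k, p)"
  shows "AE p in N. AE x in M. f (p, x) = g (p, x)"
  using basis AE_slice_L2[OF f] AE_slice_L2[OF g] eq
proof eventually_elim
  case (elim p)
  then interpret L2_orthonormal_basis M "e p" by simp
  show ?case using elim by (intro AE_eq_if_coeffs_eq) (auto simp: coeffs_def)
qed

text \<open>
  The functions \<open>\<phi> k (p, x) = F (k, p) * e p k x\<close> are orthogonal on the product space and their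
  squared norms add up to that of \<open>F\<close>, so their series converges to some \<open>\<Phi>\<close>. Bessel's inequality on
  slices bounds the \<open>L\<^sup>2(N)\<close> distance between the \<open>l\<close>-th coefficient of \<open>\<Phi>\<close> and
  \<open>F (l, \<cdot>)\<close> by the distance between \<open>\<Phi>\<close> and a partial sum, which tends to \<open>0\<close>.
\<close>

theorem synthesis:
  assumes F: "F \<in> L2_space (count_space UNIV \<Otimes>\<^sub>M N)"
  shows "\<exists>\<Phi>. \<Phi> \<in> L2_space (N \<Otimes>\<^sub>M M) \<and> (AE p in N. \<forall>k. coeffs \<Phi> (k, p) = F (k, p))"
proof -
  interpret C: sigma_finite_measure "count_space (UNIV :: 'k set)" by (rule sigma_finite_count)
  interpret CN: pair_sigma_finite "count_space (UNIV :: 'k set)" N ..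
  note [measurable] = L2_space_measurable[OF F]
  have Fm [measurable]: "(\<lambda>p. F (k, p)) \<in> borel_measurable N" for k by measurable
  have [measurable]: "(\<lambda>z. e (fst z) k (snd z)) \<in> borel_measurable (N \<Otimes>\<^sub>M M)" for k
    using e_measurable[of k] by (simp add: case_prod_unfold)
  define \<phi> where "\<phi> k z = F (k, fst z) * e (fst z) k (snd z)" for k z
  have \<phi>m [measurable]: "\<phi> k \<in> borel_measurable (N \<Otimes>\<^sub>M M)" for k unfolding \<phi>_def[abs_def] by measurable
  have tot: "(\<integral>\<^sup>+k. (\<integral>\<^sup>+p. ennreal ((cmod (F (k, p)))\<^sup>2) \<partial>N) \<partial>count_space UNIV) < \<infinity>"
  proof -
    have "(\<integral>\<^sup>+k. (\<integral>\<^sup>+p. ennreal ((cmod (F (k, p)))\<^sup>2) \<partial>N) \<partial>count_space UNIV)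
       = (\<integral>\<^sup>+z. ennreal ((cmod (F z))\<^sup>2) \<partial>(count_space UNIV \<Otimes>\<^sub>M N))"
      by (intro M1.nn_integral_fst) measurable
    then show ?thesis using F by (subst (asm) L2_space_iff_nn_integral) auto
  qed
  have slice: "(\<integral>\<^sup>+z. ennreal ((cmod (\<phi> k z))\<^sup>2) \<partial>(N \<Otimes>\<^sub>M M)) = (\<integral>\<^sup>+p. ennreal ((cmod (F (k, p)))\<^sup>2) \<partial>N)" for k
  proof -
    have "(\<integral>\<^sup>+z. ennreal ((cmod (\<phi> k z))\<^sup>2) \<partial>(N \<Otimes>\<^sub>M M))
       = (\<integral>\<^sup>+p. (\<integral>\<^sup>+x. ennreal ((cmod (\<phi> k (p, x)))\<^sup>2) \<partial>M) \<partial>N)"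
      by (intro M2.nn_integral_fst[symmetric]) measurable
    also have "\<dots> = (\<integral>\<^sup>+p. ennreal ((cmod (F (k, p)))\<^sup>2) \<partial>N)"
      using basis
    proof (intro nn_integral_cong_AE, eventually_elim)
      case (elim p)
      then interpret L2_orthonormal_basis M "e p" by simp
      show ?case unfolding \<phi>_def fst_conv snd_conv
        by (simp add: nn_integral_eq_L2_norm[OF term_L2] L2_norm_term)
    qed
    finally show ?thesis .
  qed
  have fin: "(\<integral>\<^sup>+p. ennreal ((cmod (F (k, p)))\<^sup>2) \<partial>N) < \<infinity>" for k
  proof -
    have "AE k in count_space UNIV. (\<integral>\<^sup>+p. ennreal ((cmod (F (k, p)))\<^sup>2) \<partial>N) \<noteq> \<infinity>"
      using tot by (intro nn_integral_PInf_AE) auto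
    then show ?thesis by (auto simp: AE_count_space less_top)
  qed
  have \<phi>L: "\<phi> k \<in> L2_space (N \<Otimes>\<^sub>M M)" for k
    using fin[of k] by (simp add: L2_space_iff_nn_integral slice)
  have orth: "L2_inner (N \<Otimes>\<^sub>M M) (\<phi> k) (\<phi> l) = 0" if "k \<noteq> l" for k l
  proof -
    have "L2_inner (N \<Otimes>\<^sub>M M) (\<phi> k) (\<phi> l) = (\<integral>p. (\<integral>x. \<phi> k (p, x) * cnj (\<phi> l (p, x)) \<partial>M) \<partial>N)"
      unfolding L2_inner_def by (intro integral_fst'[symmetric] L2_inner_integrable \<phi>L)
    also have "\<dots> = (\<integral>p. 0 \<partial>N)"
    proof (intro integral_cong_AE)
      show "AE p in N. (\<integral>x. \<phi> k (p, x) * cnj (\<phi> l (p, x)) \<partial>M) = 0"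
        using basis
      proof eventually_elim
        case (elim p)
        then interpret L2_orthonormal_basis M "e p" by simp
        show ?case using term_orthogonal[OF that, of "F (k, p)" "F (l, p)"]
          by (simp add: \<phi>_def L2_inner_def)
      qed
    qed measurable
    finally show ?thesis by simp
  qed
  have norm: "ennreal ((L2_norm (N \<Otimes>\<^sub>M M) (\<phi> k))\<^sup>2) = (\<integral>\<^sup>+p. ennreal ((cmod (F (k, p)))\<^sup>2) \<partial>N)" for k
    using slice[of k] by (simp add: nn_integral_eq_L2_norm[OF \<phi>L])
  have "(\<lambda>k. (L2_norm (N \<Otimes>\<^sub>M M) (\<phi> k))\<^sup>2) summable_on UNIV"
    by (rule nn_integral_count_space_finite_imp_summable) (use tot in \<open>simp_all add: norm\<close>)
  from orthogonal_series_converges[of \<phi>, OF \<phi>L orth this]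
  obtain \<Phi> where \<Phi>: "L2_tendsto (N \<Otimes>\<^sub>M M) (\<lambda>n z. \<Sum>k\<in>first_indices n. \<phi> k z) \<Phi> sequentially" by auto
  have \<Phi>L: "\<Phi> \<in> L2_space (N \<Otimes>\<^sub>M M)" using \<Phi> by (simp add: L2_tendsto_def)
  note [measurable] = L2_space_measurable[OF \<Phi>L]
  have "AE p in N. coeffs \<Phi> (l, p) = F (l, p)" for l
  proof -
    define D where "D p = L2_inner M (\<lambda>x. \<Phi> (p, x)) (e p l) - F (l, p)" for p
    have Dm [measurable]: "D \<in> borel_measurable N"
      unfolding D_def by (intro borel_measurable_diff coeff_measurable Fm) measurable
    have le: "(\<integral>\<^sup>+p. ennreal ((cmod (D p))\<^sup>2) \<partial>N)
        \<le> ennreal ((L2_norm (N \<Otimes>\<^sub>M M) (\<lambda>z. (\<Sum>k\<in>first_indices n. \<phi> k z) - \<Phi> z))\<^sup>2)"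
      if n: "n > to_nat l" for n
    proof -
      \<comment> \<open>For \<open>n\<close> beyond \<open>l\<close> the \<open>l\<close>-th coefficient of a slice of \<open>R\<close> is \<open>- D p\<close>.\<close>
      define R where "R z = (\<Sum>k\<in>first_indices n. \<phi> k z) - \<Phi> z" for z
      have RL: "R \<in> L2_space (N \<Otimes>\<^sub>M M)" unfolding R_def[abs_def] by (intro L2_space_diff L2_space_sum \<phi>L \<Phi>L)
      note [measurable] = L2_space_measurable[OF RL]
      have "(\<integral>\<^sup>+p. ennreal ((cmod (D p))\<^sup>2) \<partial>N) \<le> (\<integral>\<^sup>+p. (\<integral>\<^sup>+x. ennreal ((cmod (R (p, x)))\<^sup>2) \<partial>M) \<partial>N)"
        using basis AE_slice_L2[OF \<Phi>L] AE_slice_L2[OF RL]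
      proof (intro nn_integral_mono_AE, eventually_elim)
        case (elim p)
        then interpret L2_orthonormal_basis M "e p" by simp
        have s\<Phi>: "(\<lambda>x. \<Phi> (p, x)) \<in> L2_space M" and sR: "(\<lambda>x. R (p, x)) \<in> L2_space M"
          using elim by simp_all
        have "L2_inner M (\<lambda>x. R (p, x)) (e p l) = F (l, p) - L2_inner M (\<lambda>x. \<Phi> (p, x)) (e p l)"
          unfolding R_def \<phi>_def fst_conv snd_conv using n
          by (subst L2_inner_diff_left[OF partial_sum_L2 s\<Phi> in_L2])
             (simp add: partial_sum_coeff, simp add: first_indices_def)
        then have "cmod (D p) \<le> L2_norm M (\<lambda>x. R (p, x))"
          using coeff_le_norm[OF sR, of l] by (simp add: D_def norm_minus_commute)
        then have "(cmod (D p))\<^sup>2 \<le> (L2_norm M (\<lambda>x. R (p, x)))\<^sup>2" by (intro power_mono) auto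
        then show ?case by (simp add: nn_integral_eq_L2_norm[OF sR] ennreal_leI)
      qed
      also have "\<dots> = (\<integral>\<^sup>+z. ennreal ((cmod (R z))\<^sup>2) \<partial>(N \<Otimes>\<^sub>M M))"
        by (intro M2.nn_integral_fst) measurable
      finally show ?thesis unfolding nn_integral_eq_L2_norm[OF RL] unfolding R_def[abs_def] .
    qed
    have "(\<lambda>n. ennreal ((L2_norm (N \<Otimes>\<^sub>M M) (\<lambda>z. (\<Sum>k\<in>first_indices n. \<phi> k z) - \<Phi> z))\<^sup>2)) \<longlonglongrightarrow> ennreal (0\<^sup>2)"
      using \<Phi> unfolding L2_tendsto_def by (intro tendsto_intros) auto
    then have "(\<integral>\<^sup>+p. ennreal ((cmod (D p))\<^sup>2) \<partial>N) \<le> ennreal (0\<^sup>2)"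
      by (rule tendsto_lowerbound) (auto intro!: eventually_sequentiallyI[of "Suc (to_nat l)"] le)
    then have "(\<integral>\<^sup>+p. ennreal ((cmod (D p))\<^sup>2) \<partial>N) = 0" by simp
    then have "AE p in N. D p = 0" by (simp add: nn_integral_0_iff_AE)
    then show ?thesis by (simp add: D_def coeffs_def)
  qed
  then have "AE p in N. \<forall>k. coeffs \<Phi> (k, p) = F (k, p)" by (simp add: AE_all_countable)
  with \<Phi>L show ?thesis by auto
qed

lemma AE_count_pairI:
  assumes [measurable]: "F \<in> borel_measurable (count_space (UNIV :: 'k set) \<Otimes>\<^sub>M N)"
      "G \<in> borel_measurable (count_space (UNIV :: 'k set) \<Otimes>\<^sub>M N)"
    and eq: "AE p in N. \<forall>k. F (k, p) = (G (k, p) :: complex)"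
  shows "AE z in count_space (UNIV :: 'k set) \<Otimes>\<^sub>M N. F z = G z"
proof -
  interpret C: sigma_finite_measure "count_space (UNIV :: 'k set)" by (rule sigma_finite_count)
  interpret CN: pair_sigma_finite "count_space (UNIV :: 'k set)" N ..
  show ?thesis
    by (rule CN.AE_pair_measure) (use eq in \<open>auto simp: AE_count_space AE_all_countable\<close>)
qed

lemma norm_eq_if_coeffs_eq:
  assumes \<Phi>: "\<Phi> \<in> L2_space (N \<Otimes>\<^sub>M M)" and F: "F \<in> L2_space (count_space UNIV \<Otimes>\<^sub>M N)"
    and eq: "AE p in N. \<forall>k. coeffs \<Phi> (k, p) = F (k, p)"
  shows "L2_norm (N \<Otimes>\<^sub>M M) \<Phi> = L2_norm (count_space UNIV \<Otimes>\<^sub>M N) F"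
proof -
  have "AE z in count_space UNIV \<Otimes>\<^sub>M N. coeffs \<Phi> z = F z"
    by (intro AE_count_pairI coeffs_measurable L2_space_measurable \<Phi> F eq)
  from L2_space_cong_AE(2)[OF _ L2_space_measurable[OF F] this] coeffs_isometry[OF \<Phi>]
  show ?thesis by simp
qed

end

section \<open>Hermite functions on the real line\<close>

text \<open>
  Integration by parts on the whole line in the only form needed: a derivative has integral \<open>0\<close>
  if the function vanishes at both ends.
\<close>

lemma integral_derivative_eq_0:
  fixes F f :: "real \<Rightarrow> complex"
  assumes d: "\<And>x. (F has_vector_derivative f x) (at x)" and c: "\<And>x. isCont f x"
    and i: "integrable lborel f" and t: "(F \<longlongrightarrow> 0) at_top" "(F \<longlongrightarrow> 0) at_bot"
  shows "(\<integral>x. f x \<partial>lborel) = 0"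
proof -
  have "(LBINT x=-\<infinity>..\<infinity>. f x) = 0 - 0"
    using d c i t
    by (intro interval_integral_FTC_integrable[where F=F])
       (auto simp: ereal_tendsto_simps set_integrable_def)
  then show ?thesis
    by (simp add: interval_lebesgue_integral_def set_lebesgue_integral_def)
qed

lemma integrable_exp_neg_square:
  assumes "c > 0"
  shows "integrable lborel (\<lambda>u::real. exp (- c * u\<^sup>2))"
proof -
  have "integrable lborel (normal_density 0 (sqrt (1 / (2 * c))))"
    using assms by (intro integrable_normal_density) simp
  then have "integrable lborel (\<lambda>u. sqrt (2 * pi * (sqrt (1 / (2 * c)))\<^sup>2) * normal_density 0 (sqrt (1 / (2 * c))) u)"
    by (intro integrable_mult_right)
  also have "(\<lambda>u. sqrt (2 * pi * (sqrt (1 / (2 * c)))\<^sup>2) * normal_density 0 (sqrt (1 / (2 * c))) u)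
      = (\<lambda>u. exp (- c * u\<^sup>2))"
    using assms by (auto simp: normal_density_def field_simps)
  finally show ?thesis .
qed

lemma integral_exp_neg_square: "(\<integral>u. exp (- u\<^sup>2) \<partial>lborel) = sqrt pi"
proof -
  have "(\<integral>u. normal_density 0 (sqrt (1/2)) u \<partial>lborel) = 1"
    by (intro integral_normal_density) simp
  moreover have "normal_density 0 (sqrt (1/2)) u = exp (- u\<^sup>2) / sqrt pi" for u
    by (simp add: normal_density_def)
  ultimately show ?thesis by simp
qed

text \<open>
  Hermite functions without the normalising factor, so that the recurrences have simple coefficients.
\<close>

definition hermite_gauss :: "nat \<Rightarrow> real \<Rightarrow> real" where
  "hermite_gauss n u = hermite_poly n u * exp (- u\<^sup>2 / 2)"

text \<open>
  At \<open>n = 0\<close> the truncated index \<open>n - 1\<close> is harmless, since its coefficient vanishes; this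
  saves the case distinction in all recurrences below.
\<close>

lemma hermite_poly_Suc:
  "hermite_poly (Suc n) u = 2 * u * hermite_poly n u - 2 * real n * hermite_poly (n - 1) u"
  by (cases n) auto

lemma hermite_poly_deriv:
  "(hermite_poly n has_real_derivative 2 * real n * hermite_poly (n - 1) u) (at u)"
proof (induction n rule: less_induct)
  case (less n)
  show ?case
  proof (cases n)
    case 0
    then show ?thesis by (simp add: hermite_poly.simps(1)[abs_def])
  next
    case (Suc m)
    have eq: "hermite_poly n = (\<lambda>u. 2 * u * hermite_poly m u - 2 * real m * hermite_poly (m - 1) u)"
      unfolding Suc by (rule ext) (rule hermite_poly_Suc)
    have 1: "(hermite_poly m has_real_derivative 2 * real m * hermite_poly (m - 1) u) (at u)"
      and 2: "(hermite_poly (m - 1) has_real_derivative 2 * real (m - 1) * hermite_poly (m - 1 - 1) u) (at u)"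
      using less.IH[of m] less.IH[of "m - 1"] Suc by auto
    have "(hermite_poly n has_real_derivative
        2 * hermite_poly m u + 2 * real m * (2 * u * hermite_poly (m - 1) u
          - 2 * real (m - 1) * hermite_poly (m - 1 - 1) u)) (at u)"
      unfolding eq by (rule 1 2 derivative_eq_intros refl)+ (simp add: algebra_simps)
    moreover have "2 * hermite_poly m u + 2 * real m * (2 * u * hermite_poly (m - 1) u
          - 2 * real (m - 1) * hermite_poly (m - 1 - 1) u) = 2 * real n * hermite_poly (n - 1) u"
    proof (cases m)
      case (Suc l)
      then have "2 * u * hermite_poly (m - 1) u - 2 * real (m - 1) * hermite_poly (m - 1 - 1) u = hermite_poly m u"
        using hermite_poly_Suc[of l u] by simp
      then show ?thesis using \<open>n = Suc m\<close> by (simp add: algebra_simps)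
    qed (use Suc in simp)
    ultimately show ?thesis by (simp only:)
  qed
qed

lemma hermite_gauss_mult:
  "u * hermite_gauss n u = hermite_gauss (Suc n) u / 2 + real n * hermite_gauss (n - 1) u"
  by (simp add: hermite_gauss_def hermite_poly_Suc field_simps)

lemma hermite_gauss_deriv:
  "(hermite_gauss n has_real_derivative
     real n * hermite_gauss (n - 1) u - hermite_gauss (Suc n) u / 2) (at u)"
proof -
  have "((\<lambda>u. exp (- u\<^sup>2 / 2)) has_real_derivative - u * exp (- u\<^sup>2 / 2)) (at u)"
    by (auto intro!: derivative_eq_intros)
  from DERIV_mult[OF hermite_poly_deriv[of n u] this]
  have "(hermite_gauss n has_real_derivative 2 * real n * hermite_poly (n - 1) u * exp (- u\<^sup>2 / 2)
      + - u * exp (- u\<^sup>2 / 2) * hermite_poly n u) (at u)"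
    by (simp add: hermite_gauss_def[abs_def])
  also have "2 * real n * hermite_poly (n - 1) u * exp (- u\<^sup>2 / 2)
      + - u * exp (- u\<^sup>2 / 2) * hermite_poly n u
      = real n * hermite_gauss (n - 1) u - hermite_gauss (Suc n) u / 2"
    by (simp add: hermite_gauss_def hermite_poly_Suc field_simps)
  finally show ?thesis .
qed

lemma hermite_gauss_isCont: "isCont (hermite_gauss n) u"
  by (rule DERIV_isCont[OF hermite_gauss_deriv])

lemma hermite_gauss_cont: "continuous_on A (hermite_gauss n)"
  by (simp add: continuous_at_imp_continuous_on hermite_gauss_isCont)

lemma hermite_gauss_measurable [measurable]: "hermite_gauss n \<in> borel_measurable borel"
  by (intro borel_measurable_continuous_onI hermite_gauss_cont)

lemma abs_le_exp_square:
  fixes u :: real assumes "\<delta> > 0"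
  shows "\<bar>u\<bar> \<le> (1 + 1 / \<delta>) * exp (\<delta> * u\<^sup>2)"
proof -
  have "\<bar>u\<bar> \<le> 1 + u\<^sup>2"
    using sum_squares_bound[of 1 "\<bar>u\<bar>"] by simp
  also have "\<dots> \<le> (1 + 1 / \<delta>) * (1 + \<delta> * u\<^sup>2)"
    using assms by (simp add: field_simps)
  also have "\<dots> \<le> (1 + 1 / \<delta>) * exp (\<delta> * u\<^sup>2)"
    using assms by (intro mult_left_mono exp_ge_add_one_self) auto
  finally show ?thesis .
qed

text \<open>
  Arbitrary \<open>\<delta>\<close> is what makes the induction work: half of it is spent on the factor \<open>u\<close> in the
  recurrence and half on the previous polynomial.
\<close>

lemma hermite_poly_bound:
  assumes "\<delta> > 0"
  shows "\<exists>C\<ge>0. \<forall>u. \<bar>hermite_poly n u\<bar> \<le> C * exp (\<delta> * u\<^sup>2)"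
  using assms
proof (induction n arbitrary: \<delta> rule: less_induct)
  case (less n)
  show ?case
  proof (cases n)
    case 0
    then show ?thesis using less.prems by (intro exI[of _ 1]) auto
  next
    case (Suc m)
    obtain C where C: "C \<ge> 0" "\<And>u. \<bar>hermite_poly m u\<bar> \<le> C * exp (\<delta> / 2 * u\<^sup>2)"
      using less.IH[of m "\<delta> / 2"] less.prems Suc by auto
    obtain D where D: "D \<ge> 0" "\<And>u. \<bar>hermite_poly (m - 1) u\<bar> \<le> D * exp (\<delta> * u\<^sup>2)"
      using less.IH[of "m - 1", OF _ less.prems] Suc by (meson diff_less_Suc)
    let ?E = "2 * (1 + 1 / (\<delta> / 2)) * C + 2 * real m * D"
    show ?thesis
    proof (intro exI[of _ ?E] conjI allI)
      show "?E \<ge> 0" using C D less.prems by auto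
      fix u
      have "\<bar>hermite_poly n u\<bar> \<le> 2 * (\<bar>u\<bar> * \<bar>hermite_poly m u\<bar>) + 2 * real m * \<bar>hermite_poly (m - 1) u\<bar>"
        unfolding Suc hermite_poly_Suc
        by (rule order_trans[OF abs_triangle_ineq4]) (simp add: abs_mult)
      also have "\<dots> \<le> 2 * (((1 + 1 / (\<delta> / 2)) * exp (\<delta> / 2 * u\<^sup>2)) * (C * exp (\<delta> / 2 * u\<^sup>2)))
          + 2 * real m * (D * exp (\<delta> * u\<^sup>2))"
        using C D less.prems
        by (intro add_mono mult_left_mono mult_mono abs_le_exp_square) auto
      also have "\<dots> = 2 * (1 + 1 / (\<delta> / 2)) * C * (exp (\<delta> / 2 * u\<^sup>2) * exp (\<delta> / 2 * u\<^sup>2))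
          + 2 * real m * D * exp (\<delta> * u\<^sup>2)"
        by (simp only: mult_ac)
      also have "\<dots> = ?E * exp (\<delta> * u\<^sup>2)"
        unfolding exp_add[symmetric] by (simp add: algebra_simps)
      finally show "\<bar>hermite_poly n u\<bar> \<le> ?E * exp (\<delta> * u\<^sup>2)" .
    qed
  qed
qed

text \<open>
  The rate \<open>3/8\<close> lies strictly between \<open>1/4\<close> and \<open>1/2\<close>: less than \<open>1/2\<close> to absorb the polynomial,
  more than \<open>1/4\<close> so that dividing by the weight \<open>exp (- u\<^sup>2 / 4)\<close>, which is set aside in the
  proof of completeness, still leaves a decaying factor.
\<close>

lemma hermite_gauss_bound:
  "\<exists>C\<ge>0. \<forall>u. \<bar>hermite_gauss n u\<bar> \<le> C * exp (- (3/8) * u\<^sup>2)"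
proof -
  obtain C where C: "C \<ge> 0" "\<And>u. \<bar>hermite_poly n u\<bar> \<le> C * exp (1/8 * u\<^sup>2)"
    using hermite_poly_bound[of "1/8" n] by auto
  have "\<bar>hermite_gauss n u\<bar> \<le> C * exp (- (3/8) * u\<^sup>2)" for u
  proof -
    have "\<bar>hermite_gauss n u\<bar> \<le> C * exp (1/8 * u\<^sup>2) * exp (- u\<^sup>2 / 2)"
      unfolding hermite_gauss_def abs_mult by (intro mult_mono C) (auto simp: C)
    also have "\<dots> = C * exp (- (3/8) * u\<^sup>2)"
      unfolding mult.assoc exp_add[symmetric] by (simp add: field_simps)
    finally show ?thesis .
  qed
  with C(1) show ?thesis by auto
qed

lemma tendsto_exp_neg_square:
  "((\<lambda>u::real. C * exp (- (3/8) * u\<^sup>2)) \<longlongrightarrow> 0) at_top"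
  "((\<lambda>u::real. C * exp (- (3/8) * u\<^sup>2)) \<longlongrightarrow> 0) at_bot"
proof -
  have "filterlim (\<lambda>u::real. - (3/8) * u\<^sup>2) at_bot at_top"
    by (rule filterlim_tendsto_neg_mult_at_bot[OF tendsto_const])
       (auto intro!: filterlim_pow_at_top filterlim_ident)
  from filterlim_compose[OF exp_at_bot this]
  have *: "((\<lambda>u::real. exp (- (3/8) * u\<^sup>2)) \<longlongrightarrow> 0) at_top" .
  then have "((\<lambda>u::real. exp (- (3/8) * u\<^sup>2)) \<longlongrightarrow> 0) at_bot"
    unfolding filterlim_at_bot_mirror by simp
  with * show "((\<lambda>u::real. C * exp (- (3/8) * u\<^sup>2)) \<longlongrightarrow> 0) at_top"
    "((\<lambda>u::real. C * exp (- (3/8) * u\<^sup>2)) \<longlongrightarrow> 0) at_bot"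
    by (auto intro: tendsto_mult_right_zero)
qed

lemma hermite_gauss_tendsto:
  "(hermite_gauss n \<longlongrightarrow> 0) at_top" "(hermite_gauss n \<longlongrightarrow> 0) at_bot"
proof -
  obtain C where C: "\<And>u. \<bar>hermite_gauss n u\<bar> \<le> C * exp (- (3/8) * u\<^sup>2)"
    using hermite_gauss_bound by blast
  show "(hermite_gauss n \<longlongrightarrow> 0) at_top" "(hermite_gauss n \<longlongrightarrow> 0) at_bot"
    by (rule Lim_null_comparison[OF _ tendsto_exp_neg_square(1)[of C]]
             Lim_null_comparison[OF _ tendsto_exp_neg_square(2)[of C]],
        rule always_eventually, simp only: real_norm_def, rule allI, rule C)+
qed

lemma hermite_gauss_integrable: "integrable lborel (hermite_gauss n)"
proof -
  obtain C where C: "C \<ge> 0" "\<And>u. \<bar>hermite_gauss n u\<bar> \<le> C * exp (- (3/8) * u\<^sup>2)"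
    using hermite_gauss_bound by blast
  show ?thesis
  proof (rule Bochner_Integration.integrable_bound)
    show "integrable lborel (\<lambda>u. C * exp (- (3/8) * u\<^sup>2))"
      by (intro integrable_mult_right integrable_exp_neg_square) simp
  qed (use C in auto)
qed

lemma hermite_gauss_bounded: "\<exists>C\<ge>0. \<forall>u. \<bar>hermite_gauss n u\<bar> \<le> C"
proof -
  obtain C where C: "C \<ge> 0" "\<And>u. \<bar>hermite_gauss n u\<bar> \<le> C * exp (- (3/8) * u\<^sup>2)"
    using hermite_gauss_bound by blast
  have "\<bar>hermite_gauss n u\<bar> \<le> C" for u
    using C(2)[of u] mult_left_mono[OF _ C(1), of "exp (- (3/8) * u\<^sup>2)" 1] by simp
  with C(1) show ?thesis by auto
qed

lemma hermite_gauss_mult_integrable: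
  "integrable lborel (\<lambda>u. hermite_gauss m u * hermite_gauss n u)"
proof -
  obtain C where C: "C \<ge> 0" "\<And>u. \<bar>hermite_gauss m u\<bar> \<le> C"
    using hermite_gauss_bounded by blast
  show ?thesis
  proof (rule Bochner_Integration.integrable_bound)
    show "integrable lborel (\<lambda>u. C * hermite_gauss n u)"
      by (intro integrable_mult_right hermite_gauss_integrable)
    show "AE u in lborel. norm (hermite_gauss m u * hermite_gauss n u) \<le> norm (C * hermite_gauss n u)"
      using C by (auto simp: abs_mult intro!: mult_right_mono)
  qed auto
qed

definition hermite_gram :: "nat \<Rightarrow> nat \<Rightarrow> real" where
  "hermite_gram m n = (\<integral>u. hermite_gauss m u * hermite_gauss n u \<partial>lborel)"

text \<open>
  Two relations are added: the integral of the derivative of \<open>hermite_gauss m * hermite_gauss n\<close>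
  vanishes, and multiplication by \<open>u\<close> is symmetric. In operator language, the sum says that the
  creation operator is the adjoint of the annihilation operator.
\<close>

lemma hermite_gram_Suc: "hermite_gram m (Suc n) = 2 * real m * hermite_gram (m - 1) n"
proof -
  note int = hermite_gauss_mult_integrable
  let ?f = "\<lambda>u. real m * (hermite_gauss (m - 1) u * hermite_gauss n u)
      - (hermite_gauss (Suc m) u * hermite_gauss n u) / 2
      + real n * (hermite_gauss m u * hermite_gauss (n - 1) u)
      - (hermite_gauss m u * hermite_gauss (Suc n) u) / 2"
  have der: "((\<lambda>u. hermite_gauss m u * hermite_gauss n u) has_real_derivative ?f u) (at u)" for u
    by (rule hermite_gauss_deriv derivative_eq_intros refl)+ (simp add: algebra_simps)
  have "(\<integral>u. complex_of_real (?f u) \<partial>lborel) = 0"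
  proof (rule integral_derivative_eq_0[where F="\<lambda>u. complex_of_real (hermite_gauss m u * hermite_gauss n u)"])
    show "((\<lambda>u. complex_of_real (hermite_gauss m u * hermite_gauss n u))
        has_vector_derivative complex_of_real (?f u)) (at u)" for u
      by (rule has_vector_derivative_of_real) (use der in \<open>simp add: has_real_derivative_iff_has_vector_derivative\<close>)
    show "integrable lborel (\<lambda>u. complex_of_real (?f u))"
      by (intro integrable_of_real Bochner_Integration.integrable_add Bochner_Integration.integrable_diff
          integrable_mult_right integrable_divide_zero int) 
    show "isCont (\<lambda>u. complex_of_real (?f u)) u" for u
      by (intro continuous_intros hermite_gauss_isCont) auto
    have "((\<lambda>u. complex_of_real (hermite_gauss m u * hermite_gauss n u)) \<longlongrightarrow> complex_of_real (0 * 0)) at_top"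
      "((\<lambda>u. complex_of_real (hermite_gauss m u * hermite_gauss n u)) \<longlongrightarrow> complex_of_real (0 * 0)) at_bot"
      by (intro tendsto_intros hermite_gauss_tendsto)+
    then show "((\<lambda>u. complex_of_real (hermite_gauss m u * hermite_gauss n u)) \<longlongrightarrow> 0) at_top"
      "((\<lambda>u. complex_of_real (hermite_gauss m u * hermite_gauss n u)) \<longlongrightarrow> 0) at_bot" by simp_all
  qed
  then have "(\<integral>u. ?f u \<partial>lborel) = 0" by (simp only: integral_complex_of_real of_real_eq_0_iff)
  then have 1: "real m * hermite_gram (m - 1) n - hermite_gram (Suc m) n / 2
      + real n * hermite_gram m (n - 1) - hermite_gram m (Suc n) / 2 = 0"
    unfolding hermite_gram_def using int by simp
  have "(\<integral>u. (hermite_gauss (Suc m) u * hermite_gauss n u) / 2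
        + real m * (hermite_gauss (m - 1) u * hermite_gauss n u) \<partial>lborel)
      = (\<integral>u. (u * hermite_gauss m u) * hermite_gauss n u \<partial>lborel)"
    unfolding hermite_gauss_mult by (simp add: algebra_simps)
  also have "\<dots> = (\<integral>u. hermite_gauss m u * (u * hermite_gauss n u) \<partial>lborel)"
    by (simp add: mult_ac)
  also have "\<dots> = (\<integral>u. (hermite_gauss m u * hermite_gauss (Suc n) u) / 2
        + real n * (hermite_gauss m u * hermite_gauss (n - 1) u) \<partial>lborel)"
    unfolding hermite_gauss_mult by (simp add: algebra_simps)
  finally have 2: "hermite_gram (Suc m) n / 2 + real m * hermite_gram (m - 1) n
      = hermite_gram m (Suc n) / 2 + real n * hermite_gram m (n - 1)"
    unfolding hermite_gram_def using int by simp
  from 1 2 show ?thesis by simp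
qed

lemma hermite_gram_eq: "hermite_gram m n = (if m = n then 2 ^ n * fact n * sqrt pi else 0)"
proof (induction n arbitrary: m)
  case 0
  show ?case
  proof (cases m)
    case 0
    have "hermite_gauss 0 u * hermite_gauss 0 u = exp (- u\<^sup>2)" for u
      by (simp add: hermite_gauss_def exp_add[symmetric])
    then show ?thesis using 0 integral_exp_neg_square by (simp add: hermite_gram_def)
  next
    case (Suc k)
    have "hermite_gram m 0 = hermite_gram 0 m" by (simp add: hermite_gram_def mult.commute)
    then show ?thesis using Suc hermite_gram_Suc[of 0 k] by simp
  qed
next
  case (Suc n)
  show ?case unfolding hermite_gram_Suc Suc.IH by (cases m) auto
qed

lemma hermite_fun_eq:
  "hermite_fun n u = (2 ^ n * fact n * sqrt pi) powr (- 1 / 2) * hermite_gauss n u"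
  by (simp add: hermite_fun_def hermite_gauss_def)

lemma hermite_fun_orthonormal:
  "integrable lborel (\<lambda>u. hermite_fun m u * hermite_fun n u)"
  "(\<integral>u. hermite_fun m u * hermite_fun n u \<partial>lborel) = of_bool (m = n)"
proof -
  define c where "c n = (2 ^ n * fact n * sqrt pi) powr (- 1 / 2)" for n :: nat
  have eq: "hermite_fun m u * hermite_fun n u = (c m * c n) * (hermite_gauss m u * hermite_gauss n u)" for u
    by (simp add: hermite_fun_eq c_def)
  show "integrable lborel (\<lambda>u. hermite_fun m u * hermite_fun n u)"
    unfolding eq by (intro integrable_mult_right hermite_gauss_mult_integrable)
  have "c n * c n * (2 ^ n * fact n * sqrt pi) = 1"
    unfolding c_def powr_add[symmetric] by (simp add: powr_minus divide_simps)
  then have "(c m * c n) * hermite_gram m n = of_bool (m = n)"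
    unfolding hermite_gram_eq by simp
  then show "(\<integral>u. hermite_fun m u * hermite_fun n u \<partial>lborel) = of_bool (m = n)"
    unfolding eq by (simp add: hermite_gram_def)
qed

lemma hermite_gauss_exp_integrable:
  "integrable lborel (\<lambda>u. complex_of_real (hermite_gauss n u) * exp (- \<i> * complex_of_real (t * u)))"
proof (rule Bochner_Integration.integrable_bound[OF hermite_gauss_integrable[of n]])
  show "AE u in lborel. norm (complex_of_real (hermite_gauss n u) * exp (- \<i> * complex_of_real (t * u)))
      \<le> norm (hermite_gauss n u)"
    by (simp add: norm_mult)
qed measurable

lemma hermite_gauss_fourier_0:
  "(\<integral>u. complex_of_real (hermite_gauss 0 u) * exp (- \<i> * complex_of_real (t * u)) \<partial>lborel)
    = complex_of_real (sqrt (2 * pi) * hermite_gauss 0 t)"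
proof -
  have "complex_of_real (exp (- t\<^sup>2 / 2)) = char std_normal_distribution (- t)"
    by (simp add: char_std_normal_distribution)
  also have "\<dots> = (\<integral>u. std_normal_density u *\<^sub>R exp (- \<i> * complex_of_real (t * u)) \<partial>lborel)"
    unfolding char_def by (subst integral_density) (auto simp: mult_ac)
  finally have *: "(\<integral>u. std_normal_density u *\<^sub>R exp (- \<i> * complex_of_real (t * u)) \<partial>lborel)
      = complex_of_real (exp (- t\<^sup>2 / 2))" ..
  have "(\<integral>u. complex_of_real (hermite_gauss 0 u) * exp (- \<i> * complex_of_real (t * u)) \<partial>lborel)
      = (\<integral>u. complex_of_real (sqrt (2 * pi)) * (std_normal_density u *\<^sub>R exp (- \<i> * complex_of_real (t * u))) \<partial>lborel)"
    by (intro Bochner_Integration.integral_cong refl)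
       (simp add: hermite_gauss_def std_normal_density_def scaleR_conv_of_real)
  also have "\<dots> = complex_of_real (sqrt (2 * pi)) * complex_of_real (exp (- t\<^sup>2 / 2))"
    by (subst integral_mult_right_zero) (simp only: *)
  finally show ?thesis by (simp add: hermite_gauss_def)
qed

text \<open>
  The functions \<open>hermite_gauss n\<close> are eigenfunctions of the Fourier transform. Since their derivatives
  are again linear combinations of them, integrating by parts turns the derivative into a recurrence
  for the transforms, which after extracting \<open>(- \<i>) ^ n\<close> is the recurrence of the
  Hermite polynomials.
\<close>

lemma hermite_gauss_fourier:
  "(\<integral>u. complex_of_real (hermite_gauss n u) * exp (- \<i> * complex_of_real (t * u)) \<partial>lborel)
    = (- \<i>) ^ n * complex_of_real (sqrt (2 * pi) * hermite_gauss n t)"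
proof -
  let ?E = "\<lambda>u. exp (- \<i> * complex_of_real (t * u))"
  define A where "A n = (\<integral>u. complex_of_real (hermite_gauss n u) * ?E u \<partial>lborel)" for n
  note int = hermite_gauss_exp_integrable
  have rec: "A (Suc n) = 2 * of_nat n * A (n - 1) - 2 * \<i> * t * A n" for n
  proof -
    let ?f = "\<lambda>u. of_nat n * (complex_of_real (hermite_gauss (n - 1) u) * ?E u)
        - (complex_of_real (hermite_gauss (Suc n) u) * ?E u) / 2
        - (\<i> * t) * (complex_of_real (hermite_gauss n u) * ?E u)"
    have "(\<integral>u. ?f u \<partial>lborel) = 0"
    proof (rule integral_derivative_eq_0[where F="\<lambda>u. complex_of_real (hermite_gauss n u) * ?E u"])
      fix u
      have 1: "((\<lambda>u. complex_of_real (hermite_gauss n u)) has_vector_derivative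
          complex_of_real (real n * hermite_gauss (n - 1) u - hermite_gauss (Suc n) u / 2)) (at u)"
        by (rule has_vector_derivative_of_real)
           (use hermite_gauss_deriv in \<open>simp add: has_real_derivative_iff_has_vector_derivative[symmetric]\<close>)
      have "((\<lambda>z. exp (- \<i> * (of_real t * z))) has_field_derivative ?E u * (- \<i> * t)) (at (of_real u))"
        by (auto intro!: derivative_eq_intros)
      from has_vector_derivative_real_field[OF this]
      have 2: "(?E has_vector_derivative ?E u * (- \<i> * t)) (at u)" by simp
      show "((\<lambda>u. complex_of_real (hermite_gauss n u) * ?E u) has_vector_derivative ?f u) (at u)"
        using has_vector_derivative_mult[OF 1 2] by (simp add: algebra_simps)
      show "isCont ?f u" by (intro continuous_intros hermite_gauss_isCont) auto
    next
      show "integrable lborel ?f"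
        by (intro Bochner_Integration.integrable_diff integrable_mult_right integrable_divide_zero int)
      have le: "norm (complex_of_real (hermite_gauss n u) * ?E u) \<le> \<bar>hermite_gauss n u\<bar>" for u
        by (simp add: norm_mult)
      have lim: "((\<lambda>u. \<bar>hermite_gauss n u\<bar>) \<longlongrightarrow> 0) at_top" "((\<lambda>u. \<bar>hermite_gauss n u\<bar>) \<longlongrightarrow> 0) at_bot"
        using hermite_gauss_tendsto by (auto intro: tendsto_rabs_zero)
      show "((\<lambda>u. complex_of_real (hermite_gauss n u) * ?E u) \<longlongrightarrow> 0) at_top"
         "((\<lambda>u. complex_of_real (hermite_gauss n u) * ?E u) \<longlongrightarrow> 0) at_bot"
        by (rule Lim_null_comparison[OF always_eventually[OF allI[OF le]]], rule lim)+
    qed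
    then have "of_nat n * A (n - 1) - A (Suc n) / 2 - (\<i> * t) * A n = 0"
      unfolding A_def
      by (subst (asm) Bochner_Integration.integral_diff, (intro Bochner_Integration.integrable_diff integrable_mult_right integrable_divide_zero int)+,
          subst (asm) Bochner_Integration.integral_diff, (intro integrable_mult_right integrable_divide_zero int)+)
         (simp only: integral_mult_right_zero integral_divide_zero)
    then show ?thesis by (simp add: field_simps)
  qed
  have "A n = (- \<i>) ^ n * complex_of_real (sqrt (2 * pi) * hermite_gauss n t)"
  proof (induction n rule: less_induct)
    case (less n)
    show ?case
    proof (cases n)
      case 0
      then show ?thesis using hermite_gauss_fourier_0[of t] by (simp add: A_def)
    next
      case (Suc m)
      have g: "hermite_gauss (Suc m) t = 2 * t * hermite_gauss m t - 2 * real m * hermite_gauss (m - 1) t"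
        using hermite_gauss_mult[of t m] by simp
      \<comment> \<open>The factor \<open>of_nat m\<close> covers the truncated exponent at \<open>m = 0\<close>.\<close>
      have p: "of_nat m * (- \<i>) ^ (m - 1) = - of_nat m * (- \<i>) ^ Suc m"
        by (cases m) (auto simp: algebra_simps)
      have "A n = 2 * (of_nat m * (- \<i>) ^ (m - 1)) * complex_of_real (sqrt (2 * pi) * hermite_gauss (m - 1) t)
          - 2 * \<i> * t * (- \<i>) ^ m * complex_of_real (sqrt (2 * pi) * hermite_gauss m t)"
        unfolding Suc rec using less.IH[of m] less.IH[of "m - 1"] Suc by simp
      also have "\<dots> = (- \<i>) ^ n * complex_of_real (sqrt (2 * pi) * hermite_gauss n t)"
        unfolding p Suc g by (simp add: algebra_simps)
      finally show ?thesis .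
    qed
  qed
  then show ?thesis by (simp add: A_def)
qed

section \<open>Hermite functions in several variables\<close>

text \<open>
  Lebesgue measure on \<open>real ^ 'n\<close> is the image of a product measure indexed by the standard basis,
  which is reindexed by \<open>'n\<close> here.
\<close>

lemma vec_prod_integral:
  fixes f :: "'n::finite \<Rightarrow> real \<Rightarrow> 'b::{real_normed_field, banach, second_countable_topology}"
  assumes int: "\<And>j. integrable lborel (f j)"
  shows "integrable lborel (\<lambda>x::real^'n. \<Prod>j\<in>UNIV. f j (x $ j))" (is ?int)
    and "(\<integral>x. (\<Prod>j\<in>UNIV. f j ((x::real^'n) $ j)) \<partial>lborel) = (\<Prod>j\<in>UNIV. (\<integral>u. f j u \<partial>lborel))" (is ?eq)
proof -
  let ?ax = "\<lambda>j::'n. axis j (1::real)"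
  have inj: "inj ?ax" by (auto simp: inj_on_def axis_eq_axis)
  have B: "(Basis :: (real^'n) set) = range ?ax" by (auto simp: Basis_vec_def)
  define g where "g b = f (inv ?ax b)" for b
  have g: "g (?ax j) = f j" for j unfolding g_def using inv_f_f[OF inj, of j] by simp
  interpret P: product_sigma_finite "\<lambda>_::real^'n. lborel::real measure" ..
  have comp: "(\<Sum>b\<in>Basis. y b *\<^sub>R b) $ j = y (?ax j)" for y :: "real^'n \<Rightarrow> real" and j
  proof -
    have "(\<Sum>b\<in>Basis. y b *\<^sub>R b) $ j = (\<Sum>i\<in>UNIV. y (?ax i) * (?ax i $ j))"
      unfolding B by (subst sum.reindex[OF inj]) simp
    also have "\<dots> = (\<Sum>i\<in>UNIV. if i = j then y (?ax i) else 0)"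
      by (intro sum.cong refl) (auto simp: axis_def)
    finally show ?thesis by simp
  qed
  have eq: "(\<Prod>j\<in>UNIV. f j ((\<Sum>b\<in>Basis. y b *\<^sub>R b) $ j)) = (\<Prod>b\<in>Basis. g b (y b))" for y
    unfolding comp unfolding B by (subst prod.reindex[OF inj]) (simp add: g)
  have [measurable]: "f j \<in> borel_measurable borel" for j
    using borel_measurable_integrable[OF int[of j]] by simp
  have [measurable]: "(\<lambda>x::real^'n. \<Prod>j\<in>UNIV. f j (x $ j)) \<in> borel_measurable borel"
    by measurable
  have T[measurable]: "(\<lambda>f. \<Sum>b\<in>Basis. f b *\<^sub>R b) \<in> measurable (\<Pi>\<^sub>M b\<in>Basis. lborel) (borel :: (real^'n) measure)"
    by measurable
  have gi: "integrable lborel (g b)" for b unfolding g_def by (rule int)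
  have "integrable (\<Pi>\<^sub>M b\<in>Basis. lborel) (\<lambda>y. \<Prod>b\<in>Basis. g b (y b))"
    by (intro P.product_integrable_prod gi) simp
  then show ?int
    by (subst lborel_eq[where 'a="real^'n"]) (simp add: integrable_distr_eq eq del: sum_component)
  have "(\<integral>y. (\<Prod>b\<in>Basis. g b (y b)) \<partial>(\<Pi>\<^sub>M b\<in>Basis. lborel)) = (\<Prod>b\<in>Basis. (\<integral>u. g b u \<partial>lborel))"
    by (intro P.product_integral_prod gi) simp
  also have "\<dots> = (\<Prod>j\<in>UNIV. (\<integral>u. f j u \<partial>lborel))"
    unfolding B by (subst prod.reindex[OF inj]) (simp add: g)
  finally show ?eq
    by (subst lborel_eq[where 'a="real^'n"]) (simp add: integral_distr eq del: sum_component)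
qed

lemma norm_vec_power2: "(norm (x :: real^'n))\<^sup>2 = (\<Sum>j\<in>UNIV. (x $ j)\<^sup>2)"
  unfolding power2_norm_eq_inner inner_vec_def by (simp add: power2_eq_square)

lemma exp_norm_power2: "exp (c * (norm (x :: real^'n))\<^sup>2) = (\<Prod>j\<in>UNIV. exp (c * (x $ j)\<^sup>2))"
  by (simp add: norm_vec_power2 sum_distrib_left exp_sum)

lemma integrable_exp_neg_norm_square:
  assumes "c > 0"
  shows "integrable lborel (\<lambda>x::real^'n. exp (- c * (norm x)\<^sup>2))"
  unfolding exp_norm_power2 by (intro vec_prod_integral integrable_exp_neg_square assms)

definition hermite_gauss_multi :: "nat ^ 'm \<Rightarrow> real ^ 'm \<Rightarrow> real" where
  "hermite_gauss_multi k x = (\<Prod>j\<in>UNIV. hermite_gauss (k $ j) (x $ j))"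

definition hermite_const :: "nat ^ 'm \<Rightarrow> real" where
  "hermite_const k = (\<Prod>j\<in>UNIV. (2 ^ (k $ j) * fact (k $ j) * sqrt pi) powr (- 1 / 2))"

lemma hermite_const_pos: "hermite_const k > 0"
  unfolding hermite_const_def by (intro prod_pos) simp

lemma hermite_multi_eq: "hermite_multi k x = hermite_const k * hermite_gauss_multi k x"
  by (simp add: hermite_multi_def hermite_fun_eq hermite_gauss_multi_def hermite_const_def prod.distrib)

lemma hermite_gauss_multi_measurable [measurable]: "hermite_gauss_multi k \<in> borel_measurable borel"
  unfolding hermite_gauss_multi_def[abs_def] by measurable

lemma hermite_multi_measurable [measurable]: "hermite_multi k \<in> borel_measurable borel"
  unfolding hermite_multi_eq[abs_def] by measurable

lemma hermite_gauss_multi_bound: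
  "\<exists>C\<ge>0. \<forall>x::real^'m. \<bar>hermite_gauss_multi k x\<bar> \<le> C * exp (- (3/8) * (norm x)\<^sup>2)"
proof -
  obtain C where C: "\<And>n. C n \<ge> 0" "\<And>n u. \<bar>hermite_gauss n u\<bar> \<le> C n * exp (- (3/8) * u\<^sup>2)"
    using hermite_gauss_bound by metis
  have "\<bar>hermite_gauss_multi k x\<bar> \<le> (\<Prod>j\<in>UNIV. C (k $ j)) * exp (- (3/8) * (norm x)\<^sup>2)" for x :: "real^'m"
  proof -
    have "\<bar>hermite_gauss_multi k x\<bar> \<le> (\<Prod>j\<in>UNIV. C (k $ j) * exp (- (3/8) * (x $ j)\<^sup>2))"
      unfolding hermite_gauss_multi_def abs_prod by (intro prod_mono) (use C(2) in auto)
    then show ?thesis unfolding exp_norm_power2 by (simp only: prod.distrib)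
  qed
  moreover have "(\<Prod>j\<in>UNIV. C (k $ j)) \<ge> 0" by (intro prod_nonneg) (use C in auto)
  ultimately show ?thesis by blast
qed

lemma hermite_gauss_multi_integrable: "integrable lborel (hermite_gauss_multi k)"
  unfolding hermite_gauss_multi_def[abs_def] by (intro vec_prod_integral hermite_gauss_integrable)

lemma hermite_multi_orthonormal:
  fixes k l :: "nat ^ 'm"
  shows "integrable lborel (\<lambda>x. hermite_multi k x * hermite_multi l x)"
    and "(\<integral>x. hermite_multi k x * hermite_multi l x \<partial>lborel) = of_bool (k = l)"
proof -
  note i = vec_prod_integral[of "\<lambda>j u. hermite_fun (k $ j) u * hermite_fun (l $ j) u", OF hermite_fun_orthonormal(1)]
  show "integrable lborel (\<lambda>x. hermite_multi k x * hermite_multi l x)"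
    using i(1) by (simp add: hermite_multi_def prod.distrib)
  have "(\<integral>x. hermite_multi k x * hermite_multi l x \<partial>lborel) = (\<Prod>j\<in>UNIV. of_bool (k $ j = l $ j))"
    using i(2) by (simp add: hermite_multi_def prod.distrib hermite_fun_orthonormal(2))
  also have "\<dots> = of_bool (k = l)"
  proof (cases "k = l")
    case False
    then obtain j where "k $ j \<noteq> l $ j" by (auto simp: vec_eq_iff)
    then have "(\<Prod>j\<in>UNIV. of_bool (k $ j = l $ j)) = (0::real)" by (intro prod_zero) auto
    then show ?thesis using False by simp
  qed simp
  finally show "(\<integral>x. hermite_multi k x * hermite_multi l x \<partial>lborel) = of_bool (k = l)" .
qed

definition vec_update :: "'a ^ 'm \<Rightarrow> 'm \<Rightarrow> 'a \<Rightarrow> 'a ^ 'm" where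
  "vec_update k j v = (\<chi> i. if i = j then v else k $ i)"

text \<open>
  Multiplication by a coordinate stays within the span of the Hermite functions. This is how
  orthogonality to all Hermite functions passes to all polynomials times a Gaussian.
\<close>

lemma hermite_gauss_multi_mult:
  "x $ j * hermite_gauss_multi k x
    = hermite_gauss_multi (vec_update k j (Suc (k $ j))) x / 2
      + real (k $ j) * hermite_gauss_multi (vec_update k j (k $ j - 1)) x"
proof -
  have *: "hermite_gauss_multi (vec_update k j n) x
      = hermite_gauss n (x $ j) * (\<Prod>i\<in>UNIV - {j}. hermite_gauss (k $ i) (x $ i))" for n
    unfolding hermite_gauss_multi_def
    by (subst prod.remove[of UNIV j]) (auto simp: vec_update_def intro!: prod.cong)
  have "vec_update k j (k $ j) = k" by (simp add: vec_update_def vec_eq_iff)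
  with *[of "k $ j"] have "x $ j * hermite_gauss_multi k x
      = (x $ j * hermite_gauss (k $ j) (x $ j)) * (\<Prod>i\<in>UNIV - {j}. hermite_gauss (k $ i) (x $ i))"
    by simp
  then show ?thesis unfolding hermite_gauss_mult * by (simp add: algebra_simps)
qed

lemma exp_inner_eq_prod:
  "exp (- \<i> * complex_of_real (\<xi> \<bullet> x)) = (\<Prod>j\<in>UNIV. exp (- \<i> * complex_of_real (\<xi> $ j * x $ j)))"
proof -
  have "- \<i> * complex_of_real (\<xi> \<bullet> x) = (\<Sum>j\<in>UNIV. - \<i> * complex_of_real (\<xi> $ j * x $ j))"
    by (simp add: inner_vec_def sum_distrib_left)
  then show ?thesis by (simp only: exp_sum[OF finite])
qed

definition hermite_degree :: "nat ^ 'm \<Rightarrow> nat" where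
  "hermite_degree k = (\<Sum>j\<in>UNIV. k $ j)"

lemma hermite_gauss_multi_fourier:
  fixes k :: "nat ^ 'n"
  shows "integrable lborel (\<lambda>x. complex_of_real (hermite_gauss_multi k x) * exp (- \<i> * complex_of_real (\<xi> \<bullet> x)))"
    and "(\<integral>x. complex_of_real (hermite_gauss_multi k x) * exp (- \<i> * complex_of_real (\<xi> \<bullet> x)) \<partial>lborel)
      = (- \<i>) ^ hermite_degree k * complex_of_real (sqrt (2 * pi) ^ CARD('n) * hermite_gauss_multi k \<xi>)"
proof -
  note i = vec_prod_integral[of "\<lambda>j u. complex_of_real (hermite_gauss (k $ j) u) * exp (- \<i> * complex_of_real (\<xi> $ j * u))",
    OF hermite_gauss_exp_integrable]
  have eq: "complex_of_real (hermite_gauss_multi k x) * exp (- \<i> * complex_of_real (\<xi> \<bullet> x))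
      = (\<Prod>j\<in>UNIV. complex_of_real (hermite_gauss (k $ j) (x $ j)) * exp (- \<i> * complex_of_real (\<xi> $ j * x $ j)))" for x
    unfolding exp_inner_eq_prod prod.distrib hermite_gauss_multi_def of_real_prod ..
  show "integrable lborel (\<lambda>x. complex_of_real (hermite_gauss_multi k x) * exp (- \<i> * complex_of_real (\<xi> \<bullet> x)))"
    unfolding eq by (rule i(1))
  show "(\<integral>x. complex_of_real (hermite_gauss_multi k x) * exp (- \<i> * complex_of_real (\<xi> \<bullet> x)) \<partial>lborel)
      = (- \<i>) ^ hermite_degree k * complex_of_real (sqrt (2 * pi) ^ CARD('n) * hermite_gauss_multi k \<xi>)"
    unfolding eq unfolding i(2) hermite_gauss_fourier
    by (simp add: prod.distrib hermite_degree_def power_sum hermite_gauss_multi_def)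
qed

lemma fourier_L1_hermite_multi:
  "fourier_L1 (\<lambda>x. complex_of_real (hermite_multi k x)) \<xi>
    = (- \<i>) ^ hermite_degree k * complex_of_real (hermite_multi k \<xi>)"
proof -
  have c: "(2 * pi) powr (- real CARD('a) / 2) * sqrt (2 * pi) ^ CARD('a) = 1"
  proof -
    have "sqrt (2 * pi) ^ CARD('a) = (2 * pi) powr (real CARD('a) / 2)"
      by (simp add: powr_half_sqrt[symmetric] powr_realpow[symmetric] powr_powr)
    then show ?thesis by (simp add: powr_add[symmetric])
  qed
  have "fourier_L1 (\<lambda>x. complex_of_real (hermite_multi k x)) \<xi>
      = complex_of_real ((2 * pi) powr (- real CARD('a) / 2)) * (complex_of_real (hermite_const k) *
        (\<integral>x. complex_of_real (hermite_gauss_multi k x) * exp (- \<i> * complex_of_real (\<xi> \<bullet> x)) \<partial>lborel))"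
    unfolding fourier_L1_def by (subst integral_mult_right_zero[symmetric]) (simp add: hermite_multi_eq mult_ac)
  also have "\<dots> = (- \<i>) ^ hermite_degree k * complex_of_real
      (((2 * pi) powr (- real CARD('a) / 2) * sqrt (2 * pi) ^ CARD('a)) * (hermite_const k * hermite_gauss_multi k \<xi>))"
    unfolding hermite_gauss_multi_fourier(2) by (simp add: mult_ac)
  finally show ?thesis unfolding c hermite_multi_eq by simp
qed

section \<open>Injectivity of the Fourier transform\<close>

lemma lborel_scale_integral:
  fixes f :: "'a::euclidean_space \<Rightarrow> 'b::{banach, second_countable_topology}"
  assumes c: "c > 0"
  shows "integrable lborel (\<lambda>x. f (c *\<^sub>R x)) \<longleftrightarrow> integrable lborel f" (is ?A)
    and "(\<integral>x. f (c *\<^sub>R x) \<partial>lborel) = (1 / c ^ DIM('a)) *\<^sub>R (\<integral>x. f x \<partial>lborel)" (is ?B)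
proof -
  have meas: "f \<in> borel_measurable borel" if "(\<lambda>x. f (c *\<^sub>R x)) \<in> borel_measurable borel"
  proof -
    have "(\<lambda>y. (\<lambda>x. f (c *\<^sub>R x)) ((1/c) *\<^sub>R y)) \<in> borel_measurable borel"
      using that by (rule measurable_compose[rotated]) measurable
    then show ?thesis using c by simp
  qed
  have L: "lborel = density (distr lborel borel (\<lambda>x::'a. c *\<^sub>R x)) (\<lambda>_. ennreal (c ^ DIM('a)))"
    using lborel_affine[of c "0::'a"] c by simp
  have int: "integrable lborel f \<longleftrightarrow> integrable lborel (\<lambda>x. f (c *\<^sub>R x))"
    if [measurable]: "f \<in> borel_measurable borel"
  proof -
    have "integrable lborel f \<longleftrightarrow> integrable lborel (\<lambda>x. c ^ DIM('a) *\<^sub>R f (c *\<^sub>R x))"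
      using c by (subst L) (simp add: integrable_density integrable_distr_eq)
    moreover have "integrable lborel (\<lambda>x. f (c *\<^sub>R x))"
      if "integrable lborel (\<lambda>x. c ^ DIM('a) *\<^sub>R f (c *\<^sub>R x))"
      using integrable_scaleR_right[of "1 / c ^ DIM('a)", OF that] c by simp
    ultimately show ?thesis by auto
  qed
  show ?A
  proof
    assume i: "integrable lborel (\<lambda>x. f (c *\<^sub>R x))"
    then have "f \<in> borel_measurable borel"
      using borel_measurable_integrable[OF i] by (intro meas) simp
    with i int show "integrable lborel f" by simp
  next
    assume i: "integrable lborel f"
    then have "f \<in> borel_measurable borel" using borel_measurable_integrable[OF i] by simp
    with i int show "integrable lborel (\<lambda>x. f (c *\<^sub>R x))" by simp
  qed
  show ?B
  proof (cases "integrable lborel f")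
    case True
    then have [measurable]: "f \<in> borel_measurable borel" using borel_measurable_integrable[OF True] by simp
    have "(\<integral>x. f x \<partial>lborel) = c ^ DIM('a) *\<^sub>R (\<integral>x. f (c *\<^sub>R x) \<partial>lborel)"
      using c by (subst L) (simp add: integral_density integral_distr)
    then show ?thesis using c by simp
  next
    case False
    then show ?thesis using \<open>?A\<close> by (simp add: not_integrable_integral_eq)
  qed
qed

text \<open>
  Justifies the exchanges of integrals below: a product of functions of separate variables times a
  bounded kernel.
\<close>

lemma lborel_pair_integrable_mult:
  fixes f :: "'a::euclidean_space \<Rightarrow> complex" and g :: "'b::euclidean_space \<Rightarrow> complex"
  assumes f: "integrable lborel f" and g: "integrable lborel g"
    and h: "h \<in> borel_measurable (lborel \<Otimes>\<^sub>M lborel)" "\<And>x y. cmod (h (x, y)) \<le> C"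
  shows "integrable (lborel \<Otimes>\<^sub>M lborel) (\<lambda>(x, y). f x * g y * h (x, y))"
proof -
  have [measurable]: "f \<in> borel_measurable borel" "g \<in> borel_measurable borel"
    using borel_measurable_integrable[OF f] borel_measurable_integrable[OF g] by simp_all
  have "integrable (lborel \<Otimes>\<^sub>M lborel) (\<lambda>(x, y). f x * g y)"
  proof (rule lborel_pair.Fubini_integrable)
    show "integrable lborel (\<lambda>x. \<integral>y. norm (case (x, y) of (x, y) \<Rightarrow> f x * g y) \<partial>lborel)"
      using f g by (simp add: norm_mult)
    show "AE x in lborel. integrable lborel (\<lambda>y. case (x, y) of (x, y) \<Rightarrow> f x * g y)"
      using g by simp
  qed measurable
  then have i: "integrable (lborel \<Otimes>\<^sub>M lborel) (\<lambda>z. C * cmod (f (fst z) * g (snd z)))"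
    by (intro integrable_mult_right integrable_norm) (simp add: case_prod_unfold)
  have h': "(\<lambda>z. h (fst z, snd z)) \<in> borel_measurable (lborel \<Otimes>\<^sub>M lborel)" using h(1) by simp
  show ?thesis
  proof (rule Bochner_Integration.integrable_bound[OF i])
    show "(\<lambda>(x, y). f x * g y * h (x, y)) \<in> borel_measurable (lborel \<Otimes>\<^sub>M lborel)"
      unfolding case_prod_unfold by (intro borel_measurable_times h') measurable
    have "cmod (f x * g y * h (x, y)) \<le> C * cmod (f x * g y)" for x y
      using mult_left_mono[OF h(2)[of x y] norm_ge_zero[of "f x * g y"]]
      by (simp add: norm_mult mult_ac)
    moreover have "C \<ge> 0" using order_trans[OF norm_ge_zero h(2)] .
    ultimately show "AE z in lborel \<Otimes>\<^sub>M lborel. norm (case z of (x, y) \<Rightarrow> f x * g y * h (x, y))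
        \<le> norm (C * cmod (f (fst z) * g (snd z)))"
      by (auto simp: abs_mult)
  qed
qed

lemma hermite_gauss_multi_0: "hermite_gauss_multi 0 (x :: real^'n) = exp (- (1/2) * (norm x)\<^sup>2)"
  unfolding exp_norm_power2 by (simp add: hermite_gauss_multi_def hermite_gauss_def)

text \<open>
  Closed sets form an intersection stable generator of the Borel sets, so the integrals over all
  Borel sets vanish.
\<close>

lemma AE_zero_if_closed_integrals_zero:
  fixes w :: "'a::euclidean_space \<Rightarrow> complex"
  assumes w: "integrable lborel w"
    and zero: "\<And>C. closed C \<Longrightarrow> (\<integral>x. indicator C x *\<^sub>R w x \<partial>lborel) = 0"
  shows "AE x in lborel. w x = 0"
proof -
  have si: "set_integrable lborel A w" if "A \<in> sets borel" for A
    unfolding set_integrable_def by (rule integrable_mult_indicator) (use that w in auto)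
  have all: "(LINT x:A|lborel. w x) = 0" if "A \<in> sets borel" for A
  proof -
    have "Int_stable (Collect closed :: 'a set set)" by (auto simp: Int_stable_def)
    moreover have "Collect closed \<subseteq> Pow (UNIV :: 'a set)" by simp
    moreover have "A \<in> sigma_sets UNIV (Collect closed)" using that unfolding borel_eq_closed by simp
    ultimately show ?thesis
    proof (induction rule: sigma_sets_induct_disjoint)
      case (basic A)
      then show ?case using zero by (simp add: set_lebesgue_integral_def)
    next
      case empty
      show ?case by (simp add: set_lebesgue_integral_def)
    next
      case (compl A)
      then have A: "A \<in> sets borel" unfolding borel_eq_closed by simp
      have "(LINT x:A \<union> (UNIV - A)|lborel. w x) = (LINT x:A|lborel. w x) + (LINT x:UNIV - A|lborel. w x)"
        using A by (intro set_integral_Un si) auto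
      moreover have "A \<union> (UNIV - A) = UNIV" by auto
      ultimately show ?case using zero[of UNIV] compl by (simp add: set_lebesgue_integral_def)
    next
      case (union A)
      then have A: "A i \<in> sets borel" for i unfolding borel_eq_closed by auto
      have "(LINT x:(\<Union>i. A i)|lborel. w x) = (\<Sum>i. LINT x:A i|lborel. w x)"
        using A union(1) by (intro lebesgue_integral_countable_add si) (auto simp: disjoint_family_on_def)
      then show ?case using union by simp
    qed
  qed
  have re: "integrable lborel (\<lambda>x. Re (w x))" and im: "integrable lborel (\<lambda>x. Im (w x))"
    using w by auto
  have "AE x in lborel. Re (w x) = 0"
  proof (rule density_unique_real[OF re])
    fix A :: "'a set" assume "A \<in> sets lborel"
    then have A: "A \<in> sets borel" by simp
    have "(LINT x:A|lborel. Re (w x)) = Re (LINT x:A|lborel. w x)"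
      using integral_Re[OF si[OF A, unfolded set_integrable_def]]
      by (simp add: set_lebesgue_integral_def)
    then show "(LINT x:A|lborel. Re (w x)) = (LINT x:A|lborel. 0)" using all[OF A] by simp
  qed simp
  moreover have "AE x in lborel. Im (w x) = 0"
  proof (rule density_unique_real[OF im])
    fix A :: "'a set" assume "A \<in> sets lborel"
    then have A: "A \<in> sets borel" by simp
    have "(LINT x:A|lborel. Im (w x)) = Im (LINT x:A|lborel. w x)"
      using integral_Im[OF si[OF A, unfolded set_integrable_def]]
      by (simp add: set_lebesgue_integral_def)
    then show "(LINT x:A|lborel. Im (w x)) = (LINT x:A|lborel. 0)" using all[OF A] by simp
  qed simp
  ultimately show ?thesis by eventually_elim (simp add: complex_eq_iff)
qed

lemma gauss_integral_pos: "(\<integral>z. hermite_gauss_multi 0 (z :: real^'n) \<partial>lborel) > 0"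
proof -
  have "complex_of_real (\<integral>z. hermite_gauss_multi 0 (z :: real^'n) \<partial>lborel) = complex_of_real (sqrt (2 * pi) ^ CARD('n))"
    using hermite_gauss_multi_fourier(2)[of "0 :: nat^'n" 0]
    by (simp add: hermite_degree_def hermite_gauss_multi_0)
  then have "(\<integral>z. hermite_gauss_multi 0 (z :: real^'n) \<partial>lborel) = sqrt (2 * pi) ^ CARD('n)"
    by (simp only: of_real_eq_iff)
  then show ?thesis by simp
qed

text \<open>
  The Gaussian is, up to a constant, its own Fourier transform; writing it as an integral of
  characters and exchanging the integrals leaves the Fourier transform of \<open>v\<close>.
\<close>

lemma fourier_zero_imp_gauss_zero:
  fixes v :: "real^'n \<Rightarrow> complex"
  assumes v: "integrable lborel v"
    and zero: "\<And>\<xi>. (\<integral>x. v x * exp (- \<i> * complex_of_real (\<xi> \<bullet> x)) \<partial>lborel) = 0"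
  shows "(\<integral>x. v x * complex_of_real (hermite_gauss_multi 0 (c *\<^sub>R (y - x))) \<partial>lborel) = 0"
proof -
  define G where "G \<zeta> = complex_of_real (hermite_gauss_multi 0 \<zeta>)" for \<zeta> :: "real^'n"
  have G: "integrable lborel G" unfolding G_def by (intro integrable_of_real hermite_gauss_multi_integrable)
  let ?h = "\<lambda>(x, \<zeta>). exp (- \<i> * complex_of_real ((c *\<^sub>R (y - x)) \<bullet> \<zeta>))"
  have h: "?h \<in> borel_measurable (lborel \<Otimes>\<^sub>M lborel)"
    unfolding case_prod_unfold by measurable
  have int: "integrable (lborel \<Otimes>\<^sub>M lborel) (\<lambda>(x, \<zeta>). v x * G \<zeta> * ?h (x, \<zeta>))"
    by (rule lborel_pair_integrable_mult[OF v G h, of 1]) simp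
  have inv: "(\<integral>\<zeta>. G \<zeta> * exp (- \<i> * complex_of_real (w \<bullet> \<zeta>)) \<partial>lborel) = complex_of_real (sqrt (2 * pi) ^ CARD('n)) * G w" for w
    unfolding G_def using hermite_gauss_multi_fourier(2)[of "0 :: nat^'n" w] by (simp add: hermite_degree_def)
  have "complex_of_real (sqrt (2 * pi) ^ CARD('n)) * (\<integral>x. v x * G (c *\<^sub>R (y - x)) \<partial>lborel)
      = (\<integral>x. (\<integral>\<zeta>. v x * G \<zeta> * ?h (x, \<zeta>) \<partial>lborel) \<partial>lborel)"
    unfolding prod.case mult.assoc integral_mult_right_zero inv
    by (subst integral_mult_right_zero[symmetric]) (simp add: mult_ac)
  also have "\<dots> = (\<integral>\<zeta>. (\<integral>x. v x * G \<zeta> * ?h (x, \<zeta>) \<partial>lborel) \<partial>lborel)"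
    using lborel_pair.Fubini_integral[of "\<lambda>x \<zeta>. v x * G \<zeta> * ?h (x, \<zeta>)"] int
    by (simp add: case_prod_unfold)
  also have "\<dots> = (\<integral>\<zeta>. 0 \<partial>(lborel :: (real^'n) measure))"
  proof (intro Bochner_Integration.integral_cong refl)
    fix \<zeta> :: "real^'n"
    have "v x * G \<zeta> * ?h (x, \<zeta>) = (G \<zeta> * exp (- \<i> * complex_of_real ((c *\<^sub>R y) \<bullet> \<zeta>)))
        * (v x * exp (- \<i> * complex_of_real ((- c *\<^sub>R \<zeta>) \<bullet> x)))" for x
    proof -
      have "- \<i> * complex_of_real ((c *\<^sub>R (y - x)) \<bullet> \<zeta>)
          = - \<i> * complex_of_real ((c *\<^sub>R y) \<bullet> \<zeta>) + - \<i> * complex_of_real ((- c *\<^sub>R \<zeta>) \<bullet> x)"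
        by (simp add: algebra_simps inner_commute)
      then show ?thesis by (simp only: prod.case exp_add mult_ac)
    qed
    then show "(\<integral>x. v x * G \<zeta> * ?h (x, \<zeta>) \<partial>lborel) = 0"
      by (simp only: integral_mult_right_zero zero mult_zero_right)
  qed
  finally show ?thesis by (simp add: G_def)
qed

text \<open>
  If the transform of \<open>v\<close> vanishes, so do all convolutions of \<open>v\<close> with Gaussians. Letting the
  Gaussians shrink to a point mass shows that \<open>v\<close> annihilates every bounded continuous integrable
  test function. The indicators of closed sets, weighted by a Gaussian to stay integrable, are
  limits of such test functions.
\<close>

theorem fourier_injective:
  fixes v :: "real^'n \<Rightarrow> complex"
  assumes v: "integrable lborel v"
    and zero: "\<And>\<xi>. (\<integral>x. v x * exp (- \<i> * complex_of_real (\<xi> \<bullet> x)) \<partial>lborel) = 0"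
  shows "AE x in lborel. v x = 0"
proof -
  have [measurable]: "v \<in> borel_measurable borel" using borel_measurable_integrable[OF v] by simp
  define g where "g z = hermite_gauss_multi 0 z" for z :: "real^'n"
  have g: "integrable lborel g" unfolding g_def by (rule hermite_gauss_multi_integrable)
  have gpos: "g z \<ge> 0" for z by (simp add: g_def hermite_gauss_multi_0)
  have [measurable]: "g \<in> borel_measurable borel" unfolding g_def[abs_def] by measurable
  define I where "I = (\<integral>z. g z \<partial>lborel)"
  have I: "I > 0" unfolding I_def g_def by (rule gauss_integral_pos)
  have test: "(\<integral>x. v x * complex_of_real (\<phi> x) \<partial>lborel) = 0"
    if \<phi>i: "integrable lborel \<phi>" and \<phi>c: "continuous_on UNIV \<phi>" and B: "\<And>x. \<bar>\<phi> x\<bar> \<le> B" for \<phi> :: "real^'n \<Rightarrow> real" and B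
  proof -
    have [measurable]: "\<phi> \<in> borel_measurable borel" by (rule borel_measurable_continuous_onI[OF \<phi>c])
    have B0: "B \<ge> 0" using B[of undefined] by linarith
    have step: "(\<integral>x. v x * complex_of_real (\<integral>z. \<phi> (x + \<delta> *\<^sub>R z) * g z \<partial>lborel) \<partial>lborel) = 0" if \<delta>: "\<delta> > 0" for \<delta>
    proof -
      have sub: "(\<integral>z. \<phi> (x + \<delta> *\<^sub>R z) * g z \<partial>lborel)
          = (1 / \<delta> ^ CARD('n)) * (\<integral>y. \<phi> y * g ((1 / \<delta>) *\<^sub>R (y - x)) \<partial>lborel)" for x
      proof -
        have "(\<integral>z. \<phi> (x + \<delta> *\<^sub>R z) * g z \<partial>lborel) = (\<integral>z. (\<lambda>y. \<phi> (x + y) * g ((1 / \<delta>) *\<^sub>R y)) (\<delta> *\<^sub>R z) \<partial>lborel)"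
          using \<delta> by simp
        also have "\<dots> = (1 / \<delta> ^ CARD('n)) * (\<integral>y. \<phi> (x + y) * g ((1 / \<delta>) *\<^sub>R y) \<partial>lborel)"
          by (subst lborel_scale_integral(2)[OF \<delta>]) simp
        also have "(\<integral>y. \<phi> (x + y) * g ((1 / \<delta>) *\<^sub>R y) \<partial>lborel) = (\<integral>y. \<phi> y * g ((1 / \<delta>) *\<^sub>R (y - x)) \<partial>lborel)"
        proof -
          have "(\<integral>y. \<phi> y * g ((1 / \<delta>) *\<^sub>R (y - x)) \<partial>lborel)
              = (\<integral>y. \<phi> y * g ((1 / \<delta>) *\<^sub>R (y - x)) \<partial>distr lborel borel ((+) x))"
            by (simp add: lborel_distr_plus)
          also have "\<dots> = (\<integral>y. \<phi> (x + y) * g ((1 / \<delta>) *\<^sub>R (x + y - x)) \<partial>lborel)"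
            by (intro integral_distr) measurable
          finally show ?thesis by simp
        qed
        finally show ?thesis .
      qed
      let ?h = "\<lambda>(x, y). complex_of_real (g ((1 / \<delta>) *\<^sub>R (y - x)))"
      have h: "?h \<in> borel_measurable (lborel \<Otimes>\<^sub>M lborel)" unfolding case_prod_unfold by measurable
      have int: "integrable (lborel \<Otimes>\<^sub>M lborel) (\<lambda>(x, y). v x * complex_of_real (\<phi> y) * ?h (x, y))"
        by (rule lborel_pair_integrable_mult[OF v integrable_of_real[OF \<phi>i] h, of 1]) (simp add: g_def hermite_gauss_multi_0)
      have "(\<integral>x. v x * complex_of_real (\<integral>y. \<phi> y * g ((1 / \<delta>) *\<^sub>R (y - x)) \<partial>lborel) \<partial>lborel)
          = (\<integral>x. (\<integral>y. v x * complex_of_real (\<phi> y) * ?h (x, y) \<partial>lborel) \<partial>lborel)"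
        by (simp add: mult.assoc flip: of_real_mult)
      also have "\<dots> = (\<integral>y. (\<integral>x. v x * complex_of_real (\<phi> y) * ?h (x, y) \<partial>lborel) \<partial>lborel)"
        using lborel_pair.Fubini_integral[of "\<lambda>x y. v x * complex_of_real (\<phi> y) * ?h (x, y)"] int
        by (simp add: case_prod_unfold)
      also have "\<dots> = (\<integral>y. complex_of_real (\<phi> y) * (\<integral>x. v x * complex_of_real (g ((1 / \<delta>) *\<^sub>R (y - x))) \<partial>lborel) \<partial>lborel)"
        by (simp add: mult_ac flip: integral_mult_right_zero)
      also have "\<dots> = 0"
        unfolding g_def by (simp only: fourier_zero_imp_gauss_zero[OF v zero] mult_zero_right integral_zero)
      finally show ?thesis unfolding sub of_real_mult mult.left_commute[of _ "complex_of_real (1 / _)"]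
        by (simp only: integral_mult_right_zero mult_zero_right)
    qed
    \<comment> \<open>Now the Gaussians shrink to a point mass, with total mass \<open>I\<close> throughout.\<close>
    define \<delta> where "\<delta> n = 1 / real (Suc n)" for n
    have \<delta>: "\<delta> n > 0" "\<delta> \<longlonglongrightarrow> 0" for n unfolding \<delta>_def using LIMSEQ_inverse_real_of_nat by (auto simp: inverse_eq_divide)
    define K where "K n x = (\<integral>z. \<phi> (x + \<delta> n *\<^sub>R z) * g z \<partial>lborel)" for n x
    have [measurable]: "K n \<in> borel_measurable borel" for n unfolding K_def[abs_def] by measurable
    have bnd: "\<bar>\<phi> w * g z\<bar> \<le> B * g z" for w z using gpos[of z] B[of w] by (simp add: abs_mult mult_right_mono)
    have Kl: "(\<lambda>n. K n x) \<longlonglongrightarrow> \<phi> x * I" for x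
    proof -
      have "(\<lambda>n. K n x) \<longlonglongrightarrow> (\<integral>z. \<phi> x * g z \<partial>lborel)"
        unfolding K_def
      proof (rule integral_dominated_convergence[where w="\<lambda>z. B * g z"])
        show "integrable lborel (\<lambda>z. B * g z)" using g by simp
        show "AE z in lborel. (\<lambda>n. \<phi> (x + \<delta> n *\<^sub>R z) * g z) \<longlonglongrightarrow> \<phi> x * g z"
        proof (intro AE_I2 tendsto_mult tendsto_const)
          fix z
          have "(\<lambda>n. x + \<delta> n *\<^sub>R z) \<longlonglongrightarrow> x + 0 *\<^sub>R z" by (intro tendsto_intros \<delta>)
          then show "(\<lambda>n. \<phi> (x + \<delta> n *\<^sub>R z)) \<longlonglongrightarrow> \<phi> x"
            by (intro continuous_on_tendsto_compose[OF \<phi>c]) auto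
        qed
      qed (use bnd in auto)
      then show ?thesis by (simp add: I_def)
    qed
    have Kb: "\<bar>K n x\<bar> \<le> B * I" for n x
    proof -
      have "\<bar>K n x\<bar> \<le> (\<integral>z. \<bar>\<phi> (x + \<delta> n *\<^sub>R z) * g z\<bar> \<partial>lborel)" unfolding K_def by (rule integral_abs_bound)
      also have "\<dots> \<le> (\<integral>z. B * g z \<partial>lborel)"
        by (rule integral_mono') (use bnd g B0 gpos in auto)
      finally show ?thesis by (simp add: I_def)
    qed
    have "(\<lambda>n. \<integral>x. v x * complex_of_real (K n x) \<partial>lborel) \<longlonglongrightarrow> (\<integral>x. v x * complex_of_real (\<phi> x * I) \<partial>lborel)"
    proof (rule integral_dominated_convergence[where w="\<lambda>x. (B * I) * cmod (v x)"])
      show "integrable lborel (\<lambda>x. (B * I) * cmod (v x))" using v by simp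
      show "AE x in lborel. (\<lambda>n. v x * complex_of_real (K n x)) \<longlonglongrightarrow> v x * complex_of_real (\<phi> x * I)"
        by (intro AE_I2 tendsto_intros Kl)
      show "AE x in lborel. norm (v x * complex_of_real (K n x)) \<le> (B * I) * cmod (v x)" for n
      proof (intro AE_I2)
        fix x
        show "norm (v x * complex_of_real (K n x)) \<le> (B * I) * cmod (v x)"
          using mult_left_mono[OF Kb[of n x] norm_ge_zero[of "v x"]] by (simp add: norm_mult mult.commute)
      qed
    qed measurable
    moreover have "(\<integral>x. v x * complex_of_real (K n x) \<partial>lborel) = 0" for n
      unfolding K_def by (rule step[OF \<delta>(1)])
    ultimately have "(\<integral>x. v x * complex_of_real (\<phi> x * I) \<partial>lborel) = 0"
      by (simp add: LIMSEQ_const_iff)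
    moreover have "(\<integral>x. v x * complex_of_real (\<phi> x * I) \<partial>lborel) = complex_of_real I * (\<integral>x. v x * complex_of_real (\<phi> x) \<partial>lborel)"
      by (subst integral_mult_right_zero[symmetric]) (simp add: mult_ac)
    ultimately show ?thesis using I by simp
  qed
  have closed: "(\<integral>x. indicator C x *\<^sub>R (v x * complex_of_real (g x)) \<partial>lborel) = 0" if C: "closed C" for C
  proof (cases "C = {}")
    case False
    \<comment> \<open>Continuous functions with values in \<open>[0, 1]\<close> that decrease to the indicator of \<open>C\<close>.\<close>
    define \<phi> where "\<phi> n x = max 0 (1 - real n * infdist x C)" for n and x :: "real^'n"
    have \<phi>c: "continuous_on UNIV (\<phi> n)" for n unfolding \<phi>_def by (intro continuous_intros)
    have \<phi>b: "0 \<le> \<phi> n x" "\<phi> n x \<le> 1" for n x by (auto simp: \<phi>_def infdist_nonneg)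
    have [measurable]: "\<phi> n \<in> borel_measurable borel" for n by (rule borel_measurable_continuous_onI[OF \<phi>c])
    have gc: "continuous_on UNIV g" unfolding g_def hermite_gauss_multi_0 by (intro continuous_intros)
    have g1: "g x \<le> 1" for x by (simp add: g_def hermite_gauss_multi_0)
    have le: "\<bar>\<phi> n x * g x\<bar> \<le> g x" for n x
      using mult_right_mono[OF \<phi>b(2) gpos, of n x x] \<phi>b(1)[of n x] gpos[of x] by (simp add: abs_mult)
    have [measurable]: "C \<in> sets borel" using C by (rule borel_closed)
    have "(\<lambda>n. \<integral>x. v x * complex_of_real (\<phi> n x * g x) \<partial>lborel)
        \<longlonglongrightarrow> (\<integral>x. v x * complex_of_real (indicator C x * g x) \<partial>lborel)"
    proof (rule integral_dominated_convergence[where w="\<lambda>x. cmod (v x)"])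
      show "integrable lborel (\<lambda>x. cmod (v x))" using v by simp
      have lim: "(\<lambda>n. \<phi> n x) \<longlonglongrightarrow> indicator C x" for x
      proof (cases "x \<in> C")
        case True
        then show ?thesis by (simp add: \<phi>_def)
      next
        case F: False
        then have pos: "infdist x C > 0"
          using in_closed_iff_infdist_zero[OF C False, of x] infdist_nonneg[of x C] by linarith
        obtain N where N: "1 / infdist x C < real N" using reals_Archimedean2 by blast
        have "\<phi> n x = 0" if "n \<ge> N" for n
        proof -
          have "1 / infdist x C \<le> real n" using N that by linarith
          then have "1 \<le> real n * infdist x C" using pos by (simp add: divide_simps)
          then show ?thesis by (simp add: \<phi>_def)
        qed
        then show ?thesis using F by (auto intro!: tendsto_eventually eventually_sequentiallyI[of N])
      qed
      show "AE x in lborel. (\<lambda>n. v x * complex_of_real (\<phi> n x * g x)) \<longlonglongrightarrow> v x * complex_of_real (indicator C x * g x)"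
        by (intro AE_I2 tendsto_intros lim)
      show "AE x in lborel. norm (v x * complex_of_real (\<phi> n x * g x)) \<le> cmod (v x)" for n
      proof (intro AE_I2)
        fix x
        have "\<bar>\<phi> n x * g x\<bar> \<le> 1" using le[of n x] g1[of x] by linarith
        from mult_left_mono[OF this norm_ge_zero[of "v x"]]
        show "norm (v x * complex_of_real (\<phi> n x * g x)) \<le> cmod (v x)"
          by (simp add: norm_mult abs_mult)
      qed
    qed measurable
    moreover have "(\<integral>x. v x * complex_of_real (\<phi> n x * g x) \<partial>lborel) = 0" for n
    proof (rule test)
      show "integrable lborel (\<lambda>x. \<phi> n x * g x)"
        by (rule Bochner_Integration.integrable_bound[OF g]) (use le gpos in auto)
      show "continuous_on UNIV (\<lambda>x. \<phi> n x * g x)" by (intro continuous_intros \<phi>c gc)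
      show "\<bar>\<phi> n x * g x\<bar> \<le> 1" for x using le[of n x] g1[of x] by linarith
    qed
    ultimately have "(\<integral>x. v x * complex_of_real (indicator C x * g x) \<partial>lborel) = 0"
      by (simp add: LIMSEQ_const_iff)
    moreover have "indicator C x *\<^sub>R (v x * complex_of_real (g x)) = v x * complex_of_real (indicator C x * g x)" for x
      by (simp add: scaleR_conv_of_real mult_ac)
    ultimately show ?thesis by simp
  qed simp
  have "integrable lborel (\<lambda>x. v x * complex_of_real (g x))"
  proof (rule Bochner_Integration.integrable_bound[OF v])
    show "AE x in lborel. norm (v x * complex_of_real (g x)) \<le> norm (v x)"
      using mult_left_mono[of "g _" 1 "cmod (v _)"] by (auto simp: norm_mult g_def hermite_gauss_multi_0)
  qed measurable
  from AE_zero_if_closed_integrals_zero[OF this closed]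
  show ?thesis by (simp add: g_def hermite_gauss_multi_0)
qed

section \<open>Completeness of the Hermite functions\<close>

lemma norm_exp_partial_sum_le: "norm (\<Sum>i<N. (z::complex) ^ i /\<^sub>R fact i) \<le> exp (norm z)"
proof -
  have "norm (\<Sum>i<N. z ^ i /\<^sub>R fact i) \<le> (\<Sum>i<N. norm z ^ i /\<^sub>R fact i)"
    by (rule order_trans[OF norm_sum]) (simp add: norm_power)
  also have "\<dots> \<le> exp (norm z)"
    unfolding exp_def by (intro sum_le_suminf summable_exp_generic) auto
  finally show ?thesis .
qed

text \<open>
  Orthogonality to the Hermite functions makes all moments of \<open>g\<close> times a Gaussian vanish, and
  the exponential series then makes its Fourier transform vanish. The hypothesis
  asks for integrability against a Gaussian instead of square integrability: in the proof of
  \<open>fourier_L1_hermite_pair\<close> the theorem is applied to a function that is only known to be the sum of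
  a bounded function and an \<open>L\<^sup>2\<close> function.
\<close>

theorem hermite_multi_complete:
  fixes g :: "real^'n \<Rightarrow> complex"
  assumes meas [measurable]: "g \<in> borel_measurable borel"
    and int: "integrable lborel (\<lambda>x. g x * complex_of_real (exp (- (1/4) * (norm x)\<^sup>2)))"
    and zero: "\<And>k. (\<integral>x. g x * complex_of_real (hermite_multi k x) \<partial>lborel) = 0"
  shows "AE x in lborel. g x = 0"
proof -
  have base: "has_bochner_integral lborel (\<lambda>x. g x * complex_of_real (hermite_gauss_multi k x)) 0" for k
  proof -
    obtain C where C: "C \<ge> 0" "\<And>x::real^'n. \<bar>hermite_gauss_multi k x\<bar> \<le> C * exp (- (3/8) * (norm x)\<^sup>2)"
      using hermite_gauss_multi_bound by metis
    have "integrable lborel (\<lambda>x. g x * complex_of_real (hermite_gauss_multi k x))"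
    proof (rule Bochner_Integration.integrable_bound)
      show "integrable lborel (\<lambda>x. complex_of_real C * (g x * complex_of_real (exp (- (1/4) * (norm x)\<^sup>2))))"
        by (intro integrable_mult_right int)
      have "\<bar>hermite_gauss_multi k x\<bar> \<le> C * exp (- (1/4) * (norm x)\<^sup>2)" for x :: "real^'n"
        by (rule order_trans[OF C(2)], intro mult_left_mono C(1)) simp
      from mult_left_mono[OF this norm_ge_zero[of "g _"]]
      show "AE x in lborel. norm (g x * complex_of_real (hermite_gauss_multi k x))
          \<le> norm (complex_of_real C * (g x * complex_of_real (exp (- (1/4) * (norm x)\<^sup>2))))"
        using C(1) by (intro AE_I2) (simp add: norm_mult mult_ac)
    qed measurable
    moreover have "complex_of_real (hermite_const k) * (\<integral>x. g x * complex_of_real (hermite_gauss_multi k x) \<partial>lborel) = 0"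
      using zero[of k] unfolding hermite_multi_eq
      by (subst integral_mult_right_zero[symmetric]) (simp add: mult_ac)
    ultimately show ?thesis using hermite_const_pos[of k] by (simp add: has_bochner_integral_iff)
  qed
  have moments: "has_bochner_integral lborel (\<lambda>x. g x * complex_of_real ((\<xi> \<bullet> x) ^ n * hermite_gauss_multi k x)) 0" for n k \<xi>
  proof (induction n arbitrary: k)
    case 0
    then show ?case using base by simp
  next
    case (Suc n)
    let ?t = "\<lambda>k x. g x * complex_of_real ((\<xi> \<bullet> x) ^ n * hermite_gauss_multi k x)"
    have eq: "g x * complex_of_real ((\<xi> \<bullet> x) ^ Suc n * hermite_gauss_multi k x)
        = (\<Sum>j\<in>UNIV. complex_of_real (\<xi> $ j / 2) * ?t (vec_update k j (Suc (k $ j))) x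
            + complex_of_real (\<xi> $ j * real (k $ j)) * ?t (vec_update k j (k $ j - 1)) x)" for x
    proof -
      have "(\<xi> \<bullet> x) ^ Suc n * hermite_gauss_multi k x
          = (\<xi> \<bullet> x) ^ n * (\<Sum>j\<in>UNIV. \<xi> $ j * (x $ j * hermite_gauss_multi k x))"
      proof -
        have "(\<xi> \<bullet> x) * hermite_gauss_multi k x = (\<Sum>j\<in>UNIV. \<xi> $ j * (x $ j * hermite_gauss_multi k x))"
          by (simp add: inner_vec_def sum_distrib_right mult.assoc)
        then show ?thesis by simp
      qed
      also have "\<dots> = (\<Sum>j\<in>UNIV. \<xi> $ j / 2 * ((\<xi> \<bullet> x) ^ n * hermite_gauss_multi (vec_update k j (Suc (k $ j))) x)
            + \<xi> $ j * real (k $ j) * ((\<xi> \<bullet> x) ^ n * hermite_gauss_multi (vec_update k j (k $ j - 1)) x))"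
        unfolding hermite_gauss_multi_mult sum_distrib_left by (intro sum.cong refl) (simp add: algebra_simps)
      finally show ?thesis
        by (simp only: of_real_sum of_real_add of_real_mult sum_distrib_left distrib_left mult_ac)
    qed
    have "has_bochner_integral lborel (\<lambda>x. \<Sum>j\<in>UNIV. complex_of_real (\<xi> $ j / 2) * ?t (vec_update k j (Suc (k $ j))) x
            + complex_of_real (\<xi> $ j * real (k $ j)) * ?t (vec_update k j (k $ j - 1)) x)
        (\<Sum>j\<in>UNIV. complex_of_real (\<xi> $ j / 2) * 0 + complex_of_real (\<xi> $ j * real (k $ j)) * 0)"
      by (intro has_bochner_integral_sum has_bochner_integral_add has_bochner_integral_mult_right Suc.IH)
    then show ?case unfolding eq by simp
  qed
  define v where "v x = g x * complex_of_real (hermite_gauss_multi 0 x)" for x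
  have [measurable]: "v \<in> borel_measurable borel" unfolding v_def[abs_def] by measurable
  have "AE x in lborel. v x = 0"
  proof (rule fourier_injective)
    show "integrable lborel v" using base[of 0] by (simp add: v_def[abs_def] has_bochner_integral_iff)
    fix \<xi> :: "real^'n"
    define z where "z x = - \<i> * complex_of_real (\<xi> \<bullet> x)" for x
    have [measurable]: "z \<in> borel_measurable borel" unfolding z_def[abs_def] by measurable
    have "(\<lambda>N. \<integral>x. v x * (\<Sum>i<N. z x ^ i /\<^sub>R fact i) \<partial>lborel) \<longlonglongrightarrow> (\<integral>x. v x * exp (z x) \<partial>lborel)"
    proof (rule integral_dominated_convergence[where w="\<lambda>x. exp ((norm \<xi>)\<^sup>2) * norm (g x * complex_of_real (exp (- (1/4) * (norm x)\<^sup>2)))"])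
      show "integrable lborel (\<lambda>x. exp ((norm \<xi>)\<^sup>2) * norm (g x * complex_of_real (exp (- (1/4) * (norm x)\<^sup>2))))"
        by (intro integrable_mult_right integrable_norm int)
      show "AE x in lborel. (\<lambda>N. v x * (\<Sum>i<N. z x ^ i /\<^sub>R fact i)) \<longlonglongrightarrow> v x * exp (z x)"
        using exp_converges by (intro AE_I2 tendsto_intros) (simp add: sums_def)
      show "AE x in lborel. norm (v x * (\<Sum>i<N. z x ^ i /\<^sub>R fact i))
          \<le> exp ((norm \<xi>)\<^sup>2) * norm (g x * complex_of_real (exp (- (1/4) * (norm x)\<^sup>2)))" for N
      proof (intro AE_I2)
        fix x
        \<comment> \<open>Half of the Gaussian is spent on absorbing the exponential.\<close>
        have "norm (z x) \<le> norm \<xi> * norm x" by (simp add: z_def norm_mult Cauchy_Schwarz_ineq2)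
        also have "\<dots> \<le> (norm \<xi>)\<^sup>2 + (1/4) * (norm x)\<^sup>2"
          using sum_squares_bound[of "norm \<xi>" "norm x / 2"] by (simp add: power_divide)
        finally have "exp (norm (z x)) \<le> exp ((norm \<xi>)\<^sup>2 + (1/4) * (norm x)\<^sup>2)" by simp
        with norm_exp_partial_sum_le[of "z x" N]
        have "norm (\<Sum>i<N. z x ^ i /\<^sub>R fact i) \<le> exp ((norm \<xi>)\<^sup>2 + (1/4) * (norm x)\<^sup>2)" by linarith
        then have "norm (v x) * norm (\<Sum>i<N. z x ^ i /\<^sub>R fact i)
            \<le> norm (v x) * exp ((norm \<xi>)\<^sup>2 + (1/4) * (norm x)\<^sup>2)" by (rule mult_left_mono) simp
        also have "\<dots> = norm (g x) * (exp (- (1/2) * (norm x)\<^sup>2) * exp ((norm \<xi>)\<^sup>2 + (1/4) * (norm x)\<^sup>2))"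
          by (simp add: v_def hermite_gauss_multi_0 norm_mult)
        also have "exp (- (1/2) * (norm x)\<^sup>2) * exp ((norm \<xi>)\<^sup>2 + (1/4) * (norm x)\<^sup>2)
            = exp ((norm \<xi>)\<^sup>2) * exp (- (1/4) * (norm x)\<^sup>2)"
          unfolding exp_add[symmetric] by (simp add: algebra_simps)
        finally show "norm (v x * (\<Sum>i<N. z x ^ i /\<^sub>R fact i))
            \<le> exp ((norm \<xi>)\<^sup>2) * norm (g x * complex_of_real (exp (- (1/4) * (norm x)\<^sup>2)))"
          by (simp add: norm_mult mult_ac)
      qed
    qed measurable
    moreover have "(\<integral>x. v x * (\<Sum>i<N. z x ^ i /\<^sub>R fact i) \<partial>lborel) = 0" for N
    proof -
      have "has_bochner_integral lborel (\<lambda>x. \<Sum>i<N. ((- \<i>) ^ i / fact i) * (g x * complex_of_real ((\<xi> \<bullet> x) ^ i * hermite_gauss_multi 0 x)))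
          (\<Sum>i<N. ((- \<i>) ^ i / fact i) * 0)"
        by (intro has_bochner_integral_sum has_bochner_integral_mult_right moments)
      moreover have "v x * (\<Sum>i<N. z x ^ i /\<^sub>R fact i)
          = (\<Sum>i<N. ((- \<i>) ^ i / fact i) * (g x * complex_of_real ((\<xi> \<bullet> x) ^ i * hermite_gauss_multi 0 x)))" for x
        unfolding sum_distrib_left v_def z_def power_mult_distrib
        by (intro sum.cong refl) (simp add: scaleR_conv_of_real divide_inverse mult_ac)
      ultimately show ?thesis by (simp add: has_bochner_integral_iff)
    qed
    ultimately show "(\<integral>x. v x * exp (- \<i> * complex_of_real (\<xi> \<bullet> x)) \<partial>lborel) = 0"
      by (simp add: LIMSEQ_const_iff z_def)
  qed
  then show ?thesis by (simp add: v_def hermite_gauss_multi_0)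
qed

definition hermite_C :: "nat ^ 'm \<Rightarrow> real ^ 'm \<Rightarrow> complex" where
  "hermite_C k x = complex_of_real (hermite_multi k x)"

lemma hermite_C_measurable [measurable]: "hermite_C k \<in> borel_measurable borel"
  unfolding hermite_C_def[abs_def] by measurable

lemma gaussian_in_L2: "(\<lambda>x::real^'n. complex_of_real (exp (- (1/4) * (norm x)\<^sup>2))) \<in> L2_space lborel"
proof -
  have "(cmod (complex_of_real (exp (- (1/4) * (norm x)\<^sup>2))))\<^sup>2 = exp (- (1/2) * (norm x)\<^sup>2)" for x :: "real^'n"
    by (simp add: power2_eq_square exp_add[symmetric])
  then show ?thesis using integrable_exp_neg_norm_square[of "1/2", where 'n='n]
    unfolding L2_space_def by simp
qed

lemma hermite_C_basis: "L2_orthonormal_basis (lborel :: (real^'n) measure) hermite_C"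
proof
  fix k l :: "nat^'n"
  show "hermite_C k \<in> L2_space lborel"
    using hermite_multi_orthonormal(1)[of k k] by (simp add: L2_space_def hermite_C_def power2_eq_square)
  show "L2_inner lborel (hermite_C k) (hermite_C l) = of_bool (k = l)"
    using hermite_multi_orthonormal(2)[of k l]
    by (simp add: L2_inner_def hermite_C_def flip: of_real_mult)
next
  fix g :: "real^'n \<Rightarrow> complex"
  assume g: "g \<in> L2_space lborel" and z: "\<And>k. L2_inner lborel g (hermite_C k) = 0"
  show "AE x in lborel. g x = 0"
  proof (rule hermite_multi_complete)
    show "g \<in> borel_measurable borel" using L2_space_measurable[OF g] by simp
    show "integrable lborel (\<lambda>x. g x * complex_of_real (exp (- (1/4) * (norm x)\<^sup>2)))"
      by (rule L2_integrable_mult[OF g gaussian_in_L2])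
    show "(\<integral>x. g x * complex_of_real (hermite_multi k x) \<partial>lborel) = 0" for k
      using z[of k] by (simp add: L2_inner_def hermite_C_def)
  qed
qed

interpretation hermite: L2_orthonormal_basis "lborel :: (real^'n) measure" hermite_C
  by (rule hermite_C_basis)

text \<open>
  Up to a constant, a dilation by \<open>sqrt \<tau>\<close> carries the unscaled basis to the scaled one.
\<close>

lemma hermite_scaled_basis:
  assumes \<tau>: "\<tau> > 0"
  shows "L2_orthonormal_basis (lborel :: (real^'n) measure) (hermite_scaled \<tau>)"
proof
  define s where "s = sqrt \<tau>"
  define c where "c = \<tau> powr (real CARD('n) / 4)"
  have s: "s > 0" using \<tau> by (simp add: s_def)
  have cs: "c * c = s ^ CARD('n)"
    using \<tau> by (simp add: c_def s_def powr_half_sqrt[symmetric] powr_realpow[symmetric] powr_powr powr_add[symmetric])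
  have c: "c > 0" using \<tau> by (simp add: c_def)
  have eq: "hermite_scaled \<tau> k x = complex_of_real c * hermite_C k (s *\<^sub>R x)" for k and x :: "real^'n"
    by (simp add: hermite_scaled_def hermite_C_def c_def s_def)
  fix k l :: "nat^'n"
  have "integrable lborel (\<lambda>x. (cmod (hermite_C k (s *\<^sub>R x)))\<^sup>2)"
    using L2_space_integrable[OF hermite.in_L2[of k]]
      lborel_scale_integral(1)[OF s, of "\<lambda>y. (cmod (hermite_C k y))\<^sup>2"] by simp
  then have "integrable lborel (\<lambda>x. (c * c) * (cmod (hermite_C k (s *\<^sub>R x)))\<^sup>2)"
    by (intro integrable_mult_right)
  then have "integrable lborel (\<lambda>x. (cmod (hermite_scaled \<tau> k x))\<^sup>2)"
    by (simp add: eq norm_mult power_mult_distrib power2_eq_square mult_ac)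
  moreover have "hermite_scaled \<tau> k \<in> borel_measurable lborel"
    unfolding eq[abs_def] by measurable
  ultimately show "hermite_scaled \<tau> k \<in> L2_space lborel" by (simp add: L2_space_def)
  have "L2_inner lborel (hermite_scaled \<tau> k) (hermite_scaled \<tau> l)
      = (\<integral>x. complex_of_real (c * c) * (\<lambda>y. hermite_C k y * cnj (hermite_C l y)) (s *\<^sub>R x) \<partial>lborel)"
    by (simp add: L2_inner_def eq mult_ac)
  also have "\<dots> = L2_inner lborel (hermite_C k) (hermite_C l)"
    unfolding integral_mult_right_zero
      lborel_scale_integral(2)[OF s, of "\<lambda>y. hermite_C k y * cnj (hermite_C l y)"] cs
    using s by (simp add: L2_inner_def scaleR_conv_of_real)
  finally show "L2_inner lborel (hermite_scaled \<tau> k) (hermite_scaled \<tau> l) = of_bool (k = l)"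
    by (simp add: hermite.orthonormal)
next
  define s where "s = sqrt \<tau>"
  define c where "c = \<tau> powr (real CARD('n) / 4)"
  have s: "s > 0" using \<tau> by (simp add: s_def)
  have c: "c > 0" using \<tau> by (simp add: c_def)
  have eq: "hermite_scaled \<tau> k x = complex_of_real c * hermite_C k (s *\<^sub>R x)" for k and x :: "real^'n"
    by (simp add: hermite_scaled_def hermite_C_def c_def s_def)
  fix g :: "real^'n \<Rightarrow> complex"
  assume g: "g \<in> L2_space lborel" and z: "\<And>k. L2_inner lborel g (hermite_scaled \<tau> k) = 0"
  have [measurable]: "g \<in> borel_measurable borel" using L2_space_measurable[OF g] by simp
  have s': "1 / s > 0" using s by simp
  define h where "h y = g ((1 / s) *\<^sub>R y)" for y
  have hL: "h \<in> L2_space lborel"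
    using lborel_scale_integral(1)[OF s', of "\<lambda>y. (cmod (g y))\<^sup>2"] L2_space_integrable[OF g]
    unfolding L2_space_def h_def by simp
  have "L2_inner lborel h (hermite_C k) = 0" for k
  proof -
    have "complex_of_real c * (\<integral>x. (\<lambda>y. h y * cnj (hermite_C k y)) (s *\<^sub>R x) \<partial>lborel) = L2_inner lborel g (hermite_scaled \<tau> k)"
      unfolding L2_inner_def using s
      by (subst integral_mult_right_zero[symmetric]) (simp add: eq h_def mult_ac)
    then have "(\<integral>x. (\<lambda>y. h y * cnj (hermite_C k y)) (s *\<^sub>R x) \<partial>lborel) = 0" using z[of k] c by simp
    then show ?thesis unfolding lborel_scale_integral(2)[OF s, of "\<lambda>y. h y * cnj (hermite_C k y)"] L2_inner_def
      using s by simp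
  qed
  then have "AE y in lborel. h y = 0" by (rule hermite.complete[OF hL])
  then have "(\<integral>y. (cmod (g ((1 / s) *\<^sub>R y)))\<^sup>2 \<partial>lborel) = (\<integral>y. 0 \<partial>(lborel :: (real^'n) measure))"
    by (intro integral_cong_AE) (auto simp: h_def)
  then have "L2_norm lborel g = 0"
    using s by (simp add: lborel_scale_integral(2)[OF s', of "\<lambda>y. (cmod (g y))\<^sup>2"] L2_norm_def)
  then show "AE x in lborel. g x = 0" by (rule L2_norm_eq_0_AE[OF g])
qed

section \<open>The Fourier transform in Hermite coordinates\<close>

lemma hermite_C_integrable: "integrable lborel (hermite_C k)"
  unfolding hermite_C_def[abs_def] hermite_multi_eq
  by (intro integrable_of_real integrable_mult_right hermite_gauss_multi_integrable)

lemma fourier_L1_measurable: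
  assumes "integrable lborel u"
  shows "fourier_L1 u \<in> borel_measurable (borel :: (real^'n) measure)"
proof -
  have [measurable]: "u \<in> borel_measurable borel" using borel_measurable_integrable[OF assms] by simp
  show ?thesis unfolding fourier_L1_def[abs_def] by measurable
qed

lemma fourier_L1_bounded:
  fixes u :: "real^'n \<Rightarrow> complex"
  shows "\<exists>B\<ge>0. \<forall>\<xi>. cmod (fourier_L1 u \<xi>) \<le> B"
proof (intro exI conjI allI)
  let ?B = "(2 * pi) powr (- real CARD('n) / 2) * (\<integral>x. cmod (u x) \<partial>lborel)"
  show "0 \<le> ?B" by (intro mult_nonneg_nonneg integral_nonneg_AE) auto
  fix \<xi> :: "real^'n"
  have "cmod (\<integral>x. u x * exp (- \<i> * complex_of_real (\<xi> \<bullet> x)) \<partial>lborel) \<le> (\<integral>x. cmod (u x) \<partial>lborel)"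
    using integral_norm_bound[of lborel "\<lambda>x. u x * exp (- \<i> * complex_of_real (\<xi> \<bullet> x))"] by (simp add: norm_mult)
  then show "cmod (fourier_L1 u \<xi>) \<le> ?B"
    unfolding fourier_L1_def norm_mult by (intro mult_mono) auto
qed

text \<open>
  The multiplication formula: the transform moves from \<open>u\<close> to the Hermite function, which is an
  eigenfunction.
\<close>

lemma fourier_L1_coeff:
  fixes u :: "real^'n \<Rightarrow> complex"
  assumes u: "integrable lborel u"
  shows "(\<integral>\<xi>. fourier_L1 u \<xi> * hermite_C k \<xi> \<partial>lborel)
    = (- \<i>) ^ hermite_degree k * (\<integral>x. u x * hermite_C k x \<partial>lborel)"
proof -
  let ?c = "complex_of_real ((2 * pi) powr (- real CARD('n) / 2))"
  let ?h = "\<lambda>(x, \<xi>). exp (- \<i> * complex_of_real (\<xi> \<bullet> x))"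
  have h: "?h \<in> borel_measurable (lborel \<Otimes>\<^sub>M lborel)"
    unfolding case_prod_unfold by measurable
  have int: "integrable (lborel \<Otimes>\<^sub>M lborel) (\<lambda>(x, \<xi>). u x * hermite_C k \<xi> * ?h (x, \<xi>))"
    by (rule lborel_pair_integrable_mult[OF u hermite_C_integrable h, of 1]) simp
  have 1: "fourier_L1 u \<xi> * hermite_C k \<xi> = ?c * (\<integral>x. u x * hermite_C k \<xi> * ?h (x, \<xi>) \<partial>lborel)" for \<xi>
  proof -
    have "(\<integral>x. u x * hermite_C k \<xi> * ?h (x, \<xi>) \<partial>lborel)
        = hermite_C k \<xi> * (\<integral>x. u x * exp (- \<i> * complex_of_real (\<xi> \<bullet> x)) \<partial>lborel)"
      by (subst integral_mult_right_zero[symmetric]) (simp add: mult_ac)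
    then show ?thesis by (simp add: fourier_L1_def mult_ac)
  qed
  have 2: "?c * (\<integral>\<xi>. u x * hermite_C k \<xi> * ?h (x, \<xi>) \<partial>lborel) = u x * fourier_L1 (hermite_C k) x" for x
  proof -
    have "(\<integral>\<xi>. u x * hermite_C k \<xi> * ?h (x, \<xi>) \<partial>lborel)
        = u x * (\<integral>\<xi>. hermite_C k \<xi> * exp (- \<i> * complex_of_real (x \<bullet> \<xi>)) \<partial>lborel)"
      by (subst integral_mult_right_zero[symmetric]) (simp add: mult_ac inner_commute)
    then show ?thesis by (simp add: fourier_L1_def mult_ac)
  qed
  have "(\<integral>\<xi>. fourier_L1 u \<xi> * hermite_C k \<xi> \<partial>lborel)
      = ?c * (\<integral>\<xi>. (\<integral>x. u x * hermite_C k \<xi> * ?h (x, \<xi>) \<partial>lborel) \<partial>lborel)"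
    unfolding 1 by (rule integral_mult_right_zero)
  also have "\<dots> = ?c * (\<integral>x. (\<integral>\<xi>. u x * hermite_C k \<xi> * ?h (x, \<xi>) \<partial>lborel) \<partial>lborel)"
    using lborel_pair.Fubini_integral[of "\<lambda>x \<xi>. u x * hermite_C k \<xi> * ?h (x, \<xi>)"] int
    by (simp add: case_prod_unfold)
  also have "\<dots> = (\<integral>x. u x * fourier_L1 (hermite_C k) x \<partial>lborel)"
    unfolding 2[symmetric] by (rule integral_mult_right_zero[symmetric])
  also have "\<dots> = (- \<i>) ^ hermite_degree k * (\<integral>x. u x * hermite_C k x \<partial>lborel)"
    unfolding hermite_C_def[abs_def] fourier_L1_hermite_multi
    by (subst integral_mult_right_zero[symmetric]) (simp add: mult_ac)
  finally show ?thesis .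
qed

text \<open>
  The Fourier transform on \<open>L\<^sup>2\<close> in Hermite coordinates. In this form it is visibly unitary
  and invertible, and it does not depend on the choice of a representative.
\<close>

definition hermite_fourier_pair :: "(real^'n \<Rightarrow> complex) \<Rightarrow> (real^'n \<Rightarrow> complex) \<Rightarrow> bool" where
  "hermite_fourier_pair g G \<longleftrightarrow> (\<forall>k. L2_inner lborel G (hermite_C k)
     = (- \<i>) ^ hermite_degree k * L2_inner lborel g (hermite_C k))"

lemma L2_inner_hermite_C: "L2_inner lborel g (hermite_C k) = (\<integral>x. g x * hermite_C k x \<partial>lborel)"
  by (simp add: L2_inner_def hermite_C_def)

lemma phase_summable:
  assumes "g \<in> L2_space (lborel :: (real^'n) measure)" "cmod w = 1"
  shows "(\<lambda>k. (cmod (w ^ hermite_degree k * L2_inner lborel g (hermite_C k)))\<^sup>2) summable_on UNIV"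
  using hermite.coeffs_summable[OF assms(1)] assms(2) by (simp add: norm_mult norm_power)

text \<open>
  The transform of \<open>u\<close> is a bounded function with square summable Hermite coefficients. The
  \<open>L\<^sup>2\<close> function \<open>s\<close> with the same coefficients must coincide with it by completeness, which
  shows that the transform is square integrable in the first place.
\<close>

lemma fourier_L1_hermite_pair:
  fixes u :: "real^'n \<Rightarrow> complex"
  assumes u: "integrable lborel u" and uL: "u \<in> L2_space lborel"
  shows "fourier_L1 u \<in> L2_space lborel \<and> hermite_fourier_pair u (fourier_L1 u)"
proof -
  note [measurable] = fourier_L1_measurable[OF u]
  obtain s where sL: "s \<in> L2_space lborel"
    and s: "\<And>k. L2_inner lborel s (hermite_C k) = (- \<i>) ^ hermite_degree k * L2_inner lborel u (hermite_C k)"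
    using hermite.riesz_fischer[OF phase_summable[OF uL, of "- \<i>"]] by (auto simp: L2_tendsto_def)
  note [measurable] = L2_space_measurable[OF sL]
  obtain B where B: "B \<ge> 0" "\<And>\<xi>. cmod (fourier_L1 u \<xi>) \<le> B" using fourier_L1_bounded by metis
  have bi: "integrable lborel (\<lambda>\<xi>. fourier_L1 u \<xi> * w \<xi>)" if w: "integrable lborel w" for w :: "real^'n \<Rightarrow> complex"
  proof (rule Bochner_Integration.integrable_bound)
    show "integrable lborel (\<lambda>\<xi>. complex_of_real B * w \<xi>)" using w by (intro integrable_mult_right)
    show "AE \<xi> in lborel. norm (fourier_L1 u \<xi> * w \<xi>) \<le> norm (complex_of_real B * w \<xi>)"
      using B by (auto simp: norm_mult intro!: mult_right_mono)
    show "(\<lambda>\<xi>. fourier_L1 u \<xi> * w \<xi>) \<in> borel_measurable lborel"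
      using borel_measurable_integrable[OF w] by measurable
  qed
  have "AE \<xi> in lborel. fourier_L1 u \<xi> - s \<xi> = 0"
  proof (rule hermite_multi_complete)
    show "(\<lambda>\<xi>. fourier_L1 u \<xi> - s \<xi>) \<in> borel_measurable borel"
      using L2_space_measurable[OF sL] by simp
    have "integrable lborel (\<lambda>x::real^'n. complex_of_real (exp (- (1/4) * (norm x)\<^sup>2)))"
      by (intro integrable_of_real integrable_exp_neg_norm_square) simp
    then show "integrable lborel (\<lambda>\<xi>. (fourier_L1 u \<xi> - s \<xi>) * complex_of_real (exp (- (1/4) * (norm \<xi>)\<^sup>2)))"
      unfolding left_diff_distrib
      by (intro Bochner_Integration.integrable_diff bi L2_integrable_mult[OF sL gaussian_in_L2])
    fix k :: "nat^'n"
    have "(\<integral>\<xi>. (fourier_L1 u \<xi> - s \<xi>) * hermite_C k \<xi> \<partial>lborel)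
        = (\<integral>\<xi>. fourier_L1 u \<xi> * hermite_C k \<xi> \<partial>lborel) - (\<integral>\<xi>. s \<xi> * hermite_C k \<xi> \<partial>lborel)"
      unfolding left_diff_distrib
      by (intro Bochner_Integration.integral_diff bi hermite_C_integrable L2_integrable_mult sL hermite.in_L2)
    also have "\<dots> = 0"
      using s[of k] unfolding L2_inner_hermite_C fourier_L1_coeff[OF u] by simp
    finally show "(\<integral>\<xi>. (fourier_L1 u \<xi> - s \<xi>) * complex_of_real (hermite_multi k \<xi>) \<partial>lborel) = 0"
      by (simp add: hermite_C_def)
  qed
  then have "AE \<xi> in lborel. s \<xi> = fourier_L1 u \<xi>" by auto
  then have "fourier_L1 u \<in> L2_space lborel"
    by (intro L2_space_cong_AE(1)[OF sL]) simp_all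
  moreover have "hermite_fourier_pair u (fourier_L1 u)"
    unfolding hermite_fourier_pair_def L2_inner_hermite_C fourier_L1_coeff[OF u] by simp
  ultimately show ?thesis by simp
qed

lemma hermite_fourier_pair_unique:
  assumes "hermite_fourier_pair g G" "hermite_fourier_pair g G'" "G \<in> L2_space lborel" "G' \<in> L2_space lborel"
  shows "AE \<xi> in lborel. G \<xi> = G' \<xi>"
  by (rule hermite.AE_eq_if_coeffs_eq) (use assms in \<open>auto simp: hermite_fourier_pair_def\<close>)

lemma hermite_fourier_pair_unique_left:
  assumes "hermite_fourier_pair g G" "hermite_fourier_pair g' G" "g \<in> L2_space lborel" "g' \<in> L2_space lborel"
  shows "AE x in lborel. g x = g' x"
proof (rule hermite.AE_eq_if_coeffs_eq)
  fix k
  have "(- \<i>) ^ hermite_degree k * L2_inner lborel g (hermite_C k)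
      = (- \<i>) ^ hermite_degree k * L2_inner lborel g' (hermite_C k)"
    using assms(1,2) unfolding hermite_fourier_pair_def by metis
  then show "L2_inner lborel g (hermite_C k) = L2_inner lborel g' (hermite_C k)" by simp
qed (use assms in auto)

text \<open>
  Partial sums of the Hermite expansion of \<open>g\<close> are integrable and their transforms converge, so
  the choice in the definition ranges over a nonempty set. Whatever approximating sequence belongs to
  the chosen function, continuity of the inner product determines its coefficients.
\<close>

theorem fourier_L2_hermite_pair:
  fixes g :: "real^'n \<Rightarrow> complex"
  assumes g: "g \<in> L2_space lborel"
  shows "fourier_L2 g \<in> L2_space lborel \<and> hermite_fourier_pair g (fourier_L2 g)"
proof -
  define P where "P G u \<longleftrightarrow> (\<forall>n::nat. integrable lborel (u n)) \<and>
        L2_tendsto lborel u g sequentially \<and>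
        L2_tendsto lborel (\<lambda>n. fourier_L1 (u n)) G sequentially" for G and u :: "nat \<Rightarrow> real^'n \<Rightarrow> complex"
  define c where "c k = L2_inner lborel g (hermite_C k)" for k
  define u where "u n x = (\<Sum>k\<in>first_indices n. c k * hermite_C k x)" for n x
  obtain G where G: "L2_tendsto lborel (\<lambda>n x. \<Sum>k\<in>first_indices n. ((- \<i>) ^ hermite_degree k * c k) * hermite_C k x) G sequentially"
    using hermite.riesz_fischer[OF phase_summable[OF g, of "- \<i>"]] by (auto simp: c_def)
  have ui: "integrable lborel (u n)" for n
    unfolding u_def[abs_def] by (intro Bochner_Integration.integrable_sum integrable_mult_right hermite_C_integrable)
  have "fourier_L1 (u n) = (\<lambda>\<xi>. \<Sum>k\<in>first_indices n. ((- \<i>) ^ hermite_degree k * c k) * hermite_C k \<xi>)" for n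
  proof
    fix \<xi>
    show "fourier_L1 (u n) \<xi> = (\<Sum>k\<in>first_indices n. ((- \<i>) ^ hermite_degree k * c k) * hermite_C k \<xi>)"
    proof -
      have ci: "integrable lborel (\<lambda>x. hermite_C k x * exp (- \<i> * complex_of_real (\<xi> \<bullet> x)))" for k :: "nat^'n"
      proof (rule Bochner_Integration.integrable_bound[OF hermite_C_integrable[of k]])
        show "AE x in lborel. norm (hermite_C k x * exp (- \<i> * complex_of_real (\<xi> \<bullet> x))) \<le> norm (hermite_C k x)"
          by (simp add: norm_mult)
      qed measurable
      have "(\<integral>x. u n x * exp (- \<i> * complex_of_real (\<xi> \<bullet> x)) \<partial>lborel)
          = (\<integral>x. (\<Sum>k\<in>first_indices n. c k * (hermite_C k x * exp (- \<i> * complex_of_real (\<xi> \<bullet> x)))) \<partial>lborel)"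
        by (simp add: u_def sum_distrib_right mult.assoc)
      also have "\<dots> = (\<Sum>k\<in>first_indices n. c k * (\<integral>x. hermite_C k x * exp (- \<i> * complex_of_real (\<xi> \<bullet> x)) \<partial>lborel))"
        by (subst Bochner_Integration.integral_sum) (intro integrable_mult_right ci, simp only: integral_mult_right_zero)
      finally have "fourier_L1 (u n) \<xi> = (\<Sum>k\<in>first_indices n. c k * fourier_L1 (hermite_C k) \<xi>)"
        unfolding fourier_L1_def by (simp add: sum_distrib_left mult_ac)
      then show ?thesis
        unfolding hermite_C_def[abs_def] fourier_L1_hermite_multi by (simp add: mult_ac)
    qed
  qed
  with G have "L2_tendsto lborel (\<lambda>n. fourier_L1 (u n)) G sequentially" by simp
  moreover have "L2_tendsto lborel u g sequentially"
    using hermite.expansion_first_indices[OF g] unfolding u_def[abs_def] c_def .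
  ultimately have "P G u" using ui unfolding P_def by simp
  then have "\<exists>G u. P G u" by blast
  then have "\<exists>u. P (SOME G. \<exists>u. P G u) u" by (rule someI_ex)
  then obtain v where v: "P (fourier_L2 g) v" unfolding fourier_L2_def P_def by blast
  have "hermite_fourier_pair g (fourier_L2 g)"
    unfolding hermite_fourier_pair_def
  proof
    fix k
    have 1: "(\<lambda>n. L2_inner lborel (fourier_L1 (v n)) (hermite_C k)) \<longlonglongrightarrow> L2_inner lborel (fourier_L2 g) (hermite_C k)"
      using v unfolding P_def by (intro L2_tendsto_inner hermite.in_L2) auto
    have 2: "(\<lambda>n. (- \<i>) ^ hermite_degree k * L2_inner lborel (v n) (hermite_C k))
        \<longlonglongrightarrow> (- \<i>) ^ hermite_degree k * L2_inner lborel g (hermite_C k)"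
      using v unfolding P_def by (intro tendsto_intros L2_tendsto_inner hermite.in_L2) auto
    have "\<forall>\<^sub>F n in sequentially. v n \<in> L2_space lborel" using v unfolding P_def L2_tendsto_def by auto
    then have "\<forall>\<^sub>F n in sequentially. (- \<i>) ^ hermite_degree k * L2_inner lborel (v n) (hermite_C k)
        = L2_inner lborel (fourier_L1 (v n)) (hermite_C k)"
    proof eventually_elim
      case (elim n)
      have "integrable lborel (v n)" using v by (simp add: P_def)
      from fourier_L1_hermite_pair[OF this elim] show ?case by (simp add: hermite_fourier_pair_def)
    qed
    from Lim_transform_eventually[OF 2 this] 1
    show "L2_inner lborel (fourier_L2 g) (hermite_C k) = (- \<i>) ^ hermite_degree k * L2_inner lborel g (hermite_C k)"
      by (intro LIMSEQ_unique)
  qed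
  then show ?thesis using v unfolding P_def L2_tendsto_def by auto
qed

theorem fourier_L2_inv_hermite_pair:
  fixes G :: "real^'n \<Rightarrow> complex"
  assumes G: "G \<in> L2_space lborel"
  shows "fourier_L2_inv G \<in> L2_space lborel \<and> hermite_fourier_pair (fourier_L2_inv G) G"
proof -
  obtain g where gL: "g \<in> L2_space lborel"
    and g: "\<And>k. L2_inner lborel g (hermite_C k) = \<i> ^ hermite_degree k * L2_inner lborel G (hermite_C k)"
    using hermite.riesz_fischer[OF phase_summable[OF G, of "\<i>"]] by (auto simp: L2_tendsto_def)
  have "(- \<i>) ^ n * \<i> ^ n = 1" for n :: nat by (simp flip: power_mult_distrib)
  then have "hermite_fourier_pair g G"
    unfolding hermite_fourier_pair_def g by (simp flip: mult.assoc)
  with fourier_L2_hermite_pair[OF gL] have "AE \<xi> in lborel. fourier_L2 g \<xi> = G \<xi>"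
    using G by (intro hermite_fourier_pair_unique) auto
  with gL have "\<exists>g. g \<in> L2_space lborel \<and> (AE \<xi> in lborel. fourier_L2 g \<xi> = G \<xi>)" by blast
  from someI_ex[OF this] have L: "fourier_L2_inv G \<in> L2_space lborel"
    and ae: "AE \<xi> in lborel. fourier_L2 (fourier_L2_inv G) \<xi> = G \<xi>"
    unfolding fourier_L2_inv_def by auto
  have "L2_inner lborel G (hermite_C k) = L2_inner lborel (fourier_L2 (fourier_L2_inv G)) (hermite_C k)" for k
  proof (intro L2_inner_cong_AE L2_space_measurable G hermite.in_L2)
    show "AE \<xi> in lborel. G \<xi> = fourier_L2 (fourier_L2_inv G) \<xi>" using ae by eventually_elim simp
  qed (use fourier_L2_hermite_pair[OF L] in simp)
  then have "hermite_fourier_pair (fourier_L2_inv G) G"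
    using fourier_L2_hermite_pair[OF L] unfolding hermite_fourier_pair_def by simp
  with L show ?thesis by simp
qed

section \<open>The slicewise transforms\<close>

lemma hermite_scaled_measurable [measurable]:
  "(\<lambda>(\<xi>, x). hermite_scaled (norm \<xi>) k x) \<in> borel_measurable ((lborel :: (real^'n) measure) \<Otimes>\<^sub>M (lborel :: (real^'m) measure))"
  unfolding hermite_scaled_def case_prod_unfold by measurable

interpretation hermite_field: measurable_basis_field
  "lborel :: (real^'m) measure" "lborel :: (real^'n) measure" "\<lambda>_. hermite_C"
proof
  show "(\<lambda>(p, x). hermite_C k x) \<in> borel_measurable ((lborel :: (real^'m) measure) \<Otimes>\<^sub>M (lborel :: (real^'n) measure))" for k
    unfolding case_prod_unfold by measurable
qed (simp add: hermite_C_basis)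

interpretation scaled_field: measurable_basis_field
  "lborel :: (real^'n) measure" "lborel :: (real^'m) measure" "\<lambda>\<xi>. hermite_scaled (norm \<xi>)"
proof
  show "(\<lambda>(p, x). hermite_scaled (norm p) k x) \<in> borel_measurable ((lborel :: (real^'n) measure) \<Otimes>\<^sub>M (lborel :: (real^'m) measure))" for k
    by (rule hermite_scaled_measurable)
  have "AE \<xi> in lborel. \<xi> \<noteq> (0 :: real^'n)" by (rule AE_lborel_singleton)
  then show "AE \<xi> in lborel. L2_orthonormal_basis (lborel :: (real^'m) measure) (hermite_scaled (norm (\<xi> :: real^'n)))"
    by eventually_elim (simp add: hermite_scaled_basis)
qed

lemma phase_twist:
  fixes F :: "(nat^'n) \<times> 'p \<Rightarrow> complex"
  assumes F: "F \<in> L2_space (count_space UNIV \<Otimes>\<^sub>M N)" and w: "cmod w = 1"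
  shows "(\<lambda>(k, p). w ^ hermite_degree k * F (k, p)) \<in> L2_space (count_space UNIV \<Otimes>\<^sub>M N)
    \<and> L2_norm (count_space UNIV \<Otimes>\<^sub>M N) (\<lambda>(k, p). w ^ hermite_degree k * F (k, p)) = L2_norm (count_space UNIV \<Otimes>\<^sub>M N) F"
proof (rule L2_norm_eqI_nn_integral[OF _ F])
  note [measurable] = L2_space_measurable[OF F]
  show "(\<lambda>(k, p). w ^ hermite_degree k * F (k, p)) \<in> borel_measurable (count_space UNIV \<Otimes>\<^sub>M N)"
    unfolding case_prod_unfold by measurable
  show "(\<integral>\<^sup>+z. ennreal ((cmod (case z of (k, p) \<Rightarrow> w ^ hermite_degree k * F (k, p)))\<^sup>2) \<partial>(count_space UNIV \<Otimes>\<^sub>M N))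
    = (\<integral>\<^sup>+z. ennreal ((cmod (F z))\<^sup>2) \<partial>(count_space UNIV \<Otimes>\<^sub>M N))"
    using w by (intro nn_integral_cong) (simp add: case_prod_unfold norm_mult norm_power)
qed

text \<open>
  Multiplying the Hermite coefficients in the second variable by \<open>w ^ hermite_degree k\<close> produces a
  jointly measurable function of both variables: with \<open>w = - \<i>\<close> the
  slicewise Fourier transform, with \<open>w = \<i>\<close> its inverse.
\<close>

lemma twisted_synthesis:
  fixes f :: "(real^'m) \<times> (real^'n) \<Rightarrow> complex"
  assumes f: "f \<in> L2_space lborel" and w: "cmod w = 1"
  shows "\<exists>g. g \<in> L2_space lborel \<and> L2_norm lborel g = L2_norm lborel f \<and>
    (AE x' in lborel. (\<lambda>x''. g (x', x'')) \<in> L2_space lborel \<and> (\<lambda>x''. f (x', x'')) \<in> L2_space lborel \<and>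
      (\<forall>k. L2_inner lborel (\<lambda>x''. g (x', x'')) (hermite_C k)
        = w ^ hermite_degree k * L2_inner lborel (\<lambda>x''. f (x', x'')) (hermite_C k)))"
proof -
  have fL: "f \<in> L2_space (lborel \<Otimes>\<^sub>M lborel)" using f by (simp add: lborel_prod)
  note c = hermite_field.coeffs_isometry[OF fL]
  note t = phase_twist[OF conjunct1[OF c] w]
  obtain g where g: "g \<in> L2_space (lborel \<Otimes>\<^sub>M lborel)"
    and ge: "AE p in lborel. \<forall>k. hermite_field.coeffs g (k, p) = w ^ hermite_degree k * hermite_field.coeffs f (k, p)"
    using hermite_field.synthesis[OF conjunct1[OF t]] by auto
  have "L2_norm (lborel \<Otimes>\<^sub>M lborel) g = L2_norm (lborel \<Otimes>\<^sub>M lborel) f"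
    using hermite_field.norm_eq_if_coeffs_eq[OF g conjunct1[OF t]] ge t c by simp
  moreover have "AE x' in lborel. (\<lambda>x''. g (x', x'')) \<in> L2_space lborel \<and> (\<lambda>x''. f (x', x'')) \<in> L2_space lborel \<and>
      (\<forall>k. L2_inner lborel (\<lambda>x''. g (x', x'')) (hermite_C k)
        = w ^ hermite_degree k * L2_inner lborel (\<lambda>x''. f (x', x'')) (hermite_C k))"
    using ge hermite_field.AE_slice_L2[OF g] hermite_field.AE_slice_L2[OF fL]
    by eventually_elim (simp add: hermite_field.coeffs_def)
  ultimately show ?thesis using g by (auto simp: lborel_prod)
qed

lemma AE_lborel_pair_eqI:
  fixes f g :: "(real^'m) \<times> (real^'n) \<Rightarrow> complex"
  assumes "f \<in> borel_measurable lborel" "g \<in> borel_measurable lborel"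
    and "AE p in lborel. AE x in lborel. f (p, x) = g (p, x)"
  shows "AE z in lborel. f z = g z"
proof -
  have "AE z in lborel \<Otimes>\<^sub>M lborel. f z = g z"
    by (rule hermite_field.AE_pair_eqI) (use assms in \<open>simp_all add: lborel_prod\<close>)
  then show ?thesis unfolding lborel_prod .
qed

lemma AE_lborel_pair_eqD:
  fixes f g :: "(real^'m) \<times> (real^'n) \<Rightarrow> complex"
  assumes "AE z in lborel. f z = g z"
  shows "AE p in lborel. AE x in lborel. f (p, x) = g (p, x)"
  using assms unfolding lborel_prod[symmetric] by (rule lborel_pair.AE_pair)

lemma AE_lborel_commute:
  fixes f g :: "(real^'m) \<times> (real^'n) \<Rightarrow> complex"
  assumes [measurable]: "f \<in> borel_measurable lborel" "g \<in> borel_measurable lborel"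
  shows "(AE p in lborel. AE x in lborel. f (p, x) = g (p, x)) \<longleftrightarrow>
    (AE x in lborel. AE p in lborel. f (p, x) = g (p, x))"
proof (rule lborel_pair.AE_commute)
  have [measurable]: "f \<in> borel_measurable (lborel \<Otimes>\<^sub>M lborel)" "g \<in> borel_measurable (lborel \<Otimes>\<^sub>M lborel)"
    using assms by (simp_all add: lborel_prod)
  show "{z \<in> space (lborel \<Otimes>\<^sub>M lborel). f (fst z, snd z) = g (fst z, snd z)} \<in> sets (lborel \<Otimes>\<^sub>M lborel)"
    by measurable
qed

lemma AE_lborel_slice_L2:
  fixes f :: "(real^'m) \<times> (real^'n) \<Rightarrow> complex"
  assumes "f \<in> L2_space lborel"
  shows "AE p in lborel. (\<lambda>x. f (p, x)) \<in> L2_space lborel"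
  by (rule hermite_field.AE_slice_L2) (use assms in \<open>simp add: lborel_prod\<close>)

lemma hermite_fourier_pair_cong:
  assumes p: "hermite_fourier_pair g G"
    and L: "g \<in> L2_space lborel" "g' \<in> L2_space lborel" "G \<in> L2_space lborel" "G' \<in> L2_space lborel"
    and eq: "AE x in lborel. g x = g' x" "AE x in lborel. G x = G' x"
  shows "hermite_fourier_pair g' G'"
proof -
  have "L2_inner lborel g (hermite_C k) = L2_inner lborel g' (hermite_C k)"
    "L2_inner lborel G (hermite_C k) = L2_inner lborel G' (hermite_C k)" for k
    by (intro L2_inner_cong_AE L2_space_measurable L hermite.in_L2 eq)+
  then show ?thesis using p by (simp add: hermite_fourier_pair_def)
qed

lemma AE_AE_trans:
  assumes "AE p in M. AE x in N. f p x = h p x" "AE p in M. AE x in N. g p x = h p x"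
  shows "AE p in M. AE x in N. f p x = g p x"
  using assms
proof eventually_elim
  case (elim p)
  then show ?case by eventually_elim simp
qed

text \<open>
  The jointly measurable function with the multiplied coefficients is an admissible choice in the
  definition, and any two admissible choices agree almost everywhere on the product.
\<close>

theorem fourier_slices_spec:
  fixes f :: "(real^'m) \<times> (real^'n) \<Rightarrow> complex"
  assumes f: "f \<in> L2_space lborel"
  shows "fourier_slices f \<in> L2_space lborel \<and> L2_norm lborel (fourier_slices f) = L2_norm lborel f \<and>
    (AE x' in lborel. hermite_fourier_pair (\<lambda>x''. f (x', x'')) (\<lambda>\<xi>. fourier_slices f (x', \<xi>)))"
proof -
  obtain g where gL: "g \<in> L2_space lborel" and gn: "L2_norm lborel g = L2_norm lborel f"
    and gs: "AE x' in lborel. (\<lambda>x''. g (x', x'')) \<in> L2_space lborel \<and> (\<lambda>x''. f (x', x'')) \<in> L2_space lborel \<and>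
      (\<forall>k. L2_inner lborel (\<lambda>x''. g (x', x'')) (hermite_C k)
        = (- \<i>) ^ hermite_degree k * L2_inner lborel (\<lambda>x''. f (x', x'')) (hermite_C k))"
    using twisted_synthesis[OF f, of "- \<i>"] by auto
  have gt: "AE x' in lborel. AE \<xi> in lborel. g (x', \<xi>) = fourier_L2 (\<lambda>x''. f (x', x'')) \<xi>"
    using gs
  proof eventually_elim
    case (elim x')
    then show ?case
      using fourier_L2_hermite_pair[of "\<lambda>x''. f (x', x'')"]
      by (intro hermite_fourier_pair_unique[of "\<lambda>x''. f (x', x'')"]) (auto simp: hermite_fourier_pair_def)
  qed
  then have "\<exists>\<Phi>. \<Phi> \<in> borel_measurable lborel \<and>
      (AE x' in lborel. AE \<xi> in lborel. \<Phi> (x', \<xi>) = fourier_L2 (\<lambda>x''. f (x', x'')) \<xi>)"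
    using L2_space_measurable[OF gL] by blast
  from someI_ex[OF this] have m: "fourier_slices f \<in> borel_measurable lborel"
    and s: "AE x' in lborel. AE \<xi> in lborel. fourier_slices f (x', \<xi>) = fourier_L2 (\<lambda>x''. f (x', x'')) \<xi>"
    unfolding fourier_slices_def by auto
  have ae: "AE z in lborel. g z = fourier_slices f z"
    by (rule AE_lborel_pair_eqI[OF L2_space_measurable[OF gL] m AE_AE_trans[OF gt s]])
  note L = L2_space_cong_AE[OF gL m ae]
  have "AE x' in lborel. hermite_fourier_pair (\<lambda>x''. f (x', x'')) (\<lambda>\<xi>. fourier_slices f (x', \<xi>))"
    using gs AE_lborel_pair_eqD[OF ae] AE_lborel_slice_L2[OF L(1)]
  proof eventually_elim
    case (elim x')
    have "hermite_fourier_pair (\<lambda>x''. f (x', x'')) (\<lambda>\<xi>. g (x', \<xi>))"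
      using elim(1) by (simp add: hermite_fourier_pair_def)
    then show ?case by (rule hermite_fourier_pair_cong) (use elim in auto)
  qed
  with L gn show ?thesis by simp
qed

theorem fourier_inv_slices_spec:
  fixes \<Phi> :: "(real^'m) \<times> (real^'n) \<Rightarrow> complex"
  assumes \<Phi>: "\<Phi> \<in> L2_space lborel"
  shows "fourier_inv_slices \<Phi> \<in> L2_space lborel \<and> L2_norm lborel (fourier_inv_slices \<Phi>) = L2_norm lborel \<Phi> \<and>
    (AE x' in lborel. hermite_fourier_pair (\<lambda>x''. fourier_inv_slices \<Phi> (x', x'')) (\<lambda>\<xi>. \<Phi> (x', \<xi>)))"
proof -
  obtain g where gL: "g \<in> L2_space lborel" and gn: "L2_norm lborel g = L2_norm lborel \<Phi>"
    and gs: "AE x' in lborel. (\<lambda>x''. g (x', x'')) \<in> L2_space lborel \<and> (\<lambda>x''. \<Phi> (x', x'')) \<in> L2_space lborel \<and>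
      (\<forall>k. L2_inner lborel (\<lambda>x''. g (x', x'')) (hermite_C k)
        = \<i> ^ hermite_degree k * L2_inner lborel (\<lambda>x''. \<Phi> (x', x'')) (hermite_C k))"
    using twisted_synthesis[OF \<Phi>, of "\<i>"] by auto
  have ii: "(- \<i>) ^ n * \<i> ^ n = 1" for n :: nat by (simp flip: power_mult_distrib)
  have gp: "AE x' in lborel. hermite_fourier_pair (\<lambda>x''. g (x', x'')) (\<lambda>\<xi>. \<Phi> (x', \<xi>))"
    using gs by eventually_elim (simp add: hermite_fourier_pair_def ii flip: mult.assoc)
  have gt: "AE x' in lborel. AE x'' in lborel. g (x', x'') = fourier_L2_inv (\<lambda>\<xi>. \<Phi> (x', \<xi>)) x''"
    using gs gp
  proof eventually_elim
    case (elim x')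
    then show ?case
      using fourier_L2_inv_hermite_pair[of "\<lambda>\<xi>. \<Phi> (x', \<xi>)"]
      by (intro hermite_fourier_pair_unique_left[of _ "\<lambda>\<xi>. \<Phi> (x', \<xi>)"]) auto
  qed
  then have "\<exists>f. f \<in> borel_measurable lborel \<and>
      (AE x' in lborel. AE x'' in lborel. f (x', x'') = fourier_L2_inv (\<lambda>\<xi>. \<Phi> (x', \<xi>)) x'')"
    using L2_space_measurable[OF gL] by blast
  from someI_ex[OF this] have m: "fourier_inv_slices \<Phi> \<in> borel_measurable lborel"
    and s: "AE x' in lborel. AE x'' in lborel. fourier_inv_slices \<Phi> (x', x'') = fourier_L2_inv (\<lambda>\<xi>. \<Phi> (x', \<xi>)) x''"
    unfolding fourier_inv_slices_def by auto
  have ae: "AE z in lborel. g z = fourier_inv_slices \<Phi> z"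
    by (rule AE_lborel_pair_eqI[OF L2_space_measurable[OF gL] m AE_AE_trans[OF gt s]])
  note L = L2_space_cong_AE[OF gL m ae]
  have "AE x' in lborel. hermite_fourier_pair (\<lambda>x''. fourier_inv_slices \<Phi> (x', x'')) (\<lambda>\<xi>. \<Phi> (x', \<xi>))"
    using gs gp AE_lborel_pair_eqD[OF ae] AE_lborel_slice_L2[OF L(1)]
  proof eventually_elim
    case (elim x')
    from elim(2) show ?case by (rule hermite_fourier_pair_cong) (use elim in auto)
  qed
  with L gn show ?thesis by simp
qed

lemma L2_space_swap:
  fixes f :: "(real^'a) \<times> (real^'b) \<Rightarrow> complex"
  assumes f: "f \<in> L2_space lborel"
  shows "(\<lambda>(y, x). f (x, y)) \<in> L2_space lborel \<and> L2_norm lborel (\<lambda>(y, x). f (x, y)) = L2_norm lborel f"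
proof (rule L2_norm_eqI_nn_integral[OF _ f])
  have [measurable]: "f \<in> borel_measurable (lborel \<Otimes>\<^sub>M lborel)"
    using L2_space_measurable[OF f] by (simp add: lborel_prod)
  have m [measurable]: "(\<lambda>(y, x). f (x, y)) \<in> borel_measurable (lborel \<Otimes>\<^sub>M lborel)" by measurable
  then show "(\<lambda>(y, x). f (x, y)) \<in> borel_measurable lborel" by (simp add: lborel_prod)
  have "(\<integral>\<^sup>+z. ennreal ((cmod (case z of (y, x) \<Rightarrow> f (x, y)))\<^sup>2) \<partial>(lborel \<Otimes>\<^sub>M lborel))
      = (\<integral>\<^sup>+y. (\<integral>\<^sup>+x. ennreal ((cmod (f (x, y)))\<^sup>2) \<partial>lborel) \<partial>lborel)"
    by (subst lborel.nn_integral_fst[symmetric]) simp_all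
  also have "\<dots> = (\<integral>\<^sup>+z. ennreal ((cmod (f z))\<^sup>2) \<partial>(lborel \<Otimes>\<^sub>M lborel))"
    by (intro lborel_pair.nn_integral_snd) measurable
  finally show "(\<integral>\<^sup>+z. ennreal ((cmod (case z of (y, x) \<Rightarrow> f (x, y)))\<^sup>2) \<partial>lborel) = (\<integral>\<^sup>+z. ennreal ((cmod (f z))\<^sup>2) \<partial>lborel)"
    unfolding lborel_prod .
qed

text \<open>
  In \<open>measurable_basis_field\<close> the parameter comes first; the parameter \<open>\<xi>\<close> of the scaled Hermite
  transform is the second argument.
\<close>

abbreviation swap_args :: "('a \<times> 'b \<Rightarrow> 'c) \<Rightarrow> 'b \<times> 'a \<Rightarrow> 'c" where
  "swap_args f \<equiv> (\<lambda>(y, x). f (x, y))"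

lemma L2_space_swap_pair:
  fixes f :: "(real^'a) \<times> (real^'b) \<Rightarrow> complex"
  assumes "f \<in> L2_space lborel"
  shows "swap_args f \<in> L2_space (lborel \<Otimes>\<^sub>M lborel)"
    "L2_norm (lborel \<Otimes>\<^sub>M lborel) (swap_args f) = L2_norm lborel f"
  using L2_space_swap[OF assms] by (simp_all add: lborel_prod)

text \<open>
  On almost every slice the function from \<open>synthesis\<close> is the limit of the Hermite series, by its
  \<open>expansion\<close>; uniqueness of limits identifies it with the chosen sum.
\<close>

theorem Hsc_inv_slices_spec:
  fixes F :: "(nat^'m) \<times> (real^'n) \<Rightarrow> complex"
  assumes F: "F \<in> L2_space Gamma_measure"
  shows "Hsc_inv_slices F \<in> L2_space lborel \<and> L2_norm lborel (Hsc_inv_slices F) = L2_norm Gamma_measure F \<and>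
    (AE \<xi> in lborel. \<forall>k. scaled_field.coeffs (swap_args (Hsc_inv_slices F)) (k, \<xi>) = F (k, \<xi>))"
proof -
  note F' = F[unfolded Gamma_measure_def]
  have basis: "AE \<xi> in lborel. L2_orthonormal_basis (lborel :: (real^'m) measure) (hermite_scaled (norm (\<xi> :: real^'n)))"
    by (rule scaled_field.basis)
  obtain \<Psi> where \<Psi>: "\<Psi> \<in> L2_space (lborel \<Otimes>\<^sub>M lborel)"
    and c: "AE \<xi> in lborel. \<forall>k. scaled_field.coeffs \<Psi> (k, \<xi>) = F (k, \<xi>)"
    using scaled_field.synthesis[OF F'] by auto
  define g where "g = swap_args \<Psi>"
  have gL: "g \<in> L2_space lborel" and gn: "L2_norm lborel g = L2_norm (lborel \<Otimes>\<^sub>M lborel) \<Psi>"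
    using L2_space_swap[of \<Psi>] \<Psi> by (simp_all add: lborel_prod g_def)
  have gt: "AE \<xi> in lborel. AE x' in lborel. g (x', \<xi>) = Hsc_inv \<xi> (\<lambda>k. F (k, \<xi>)) x'"
    using c scaled_field.AE_slice_L2[OF \<Psi>] basis
  proof eventually_elim
    case (elim \<xi>)
    interpret B: L2_orthonormal_basis "lborel :: (real^'m) measure" "hermite_scaled (norm \<xi>)" by (rule elim(3))
    have lim: "L2_tendsto lborel (\<lambda>K x. \<Sum>k\<in>K. F (k, \<xi>) * hermite_scaled (norm \<xi>) k x) (\<lambda>x. \<Psi> (\<xi>, x)) (finite_subsets_at_top UNIV)"
      using B.expansion[OF elim(2)] elim(1) by (simp add: scaled_field.coeffs_def)
    from lim have "\<exists>g. L2_tendsto lborel (\<lambda>K x. \<Sum>k\<in>K. F (k, \<xi>) * hermite_scaled (norm \<xi>) k x) g (finite_subsets_at_top UNIV)"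
      by blast
    from someI_ex[OF this]
    have "L2_tendsto lborel (\<lambda>K x. \<Sum>k\<in>K. F (k, \<xi>) * hermite_scaled (norm \<xi>) k x)
        (Hsc_inv \<xi> (\<lambda>k. F (k, \<xi>))) (finite_subsets_at_top UNIV)"
      unfolding Hsc_inv_def .
    from L2_tendsto_unique[OF lim this]
    have "AE x in lborel. \<Psi> (\<xi>, x) = Hsc_inv \<xi> (\<lambda>k. F (k, \<xi>)) x" by simp
    then show ?case by (simp add: g_def)
  qed
  then have "\<exists>\<Phi>. \<Phi> \<in> borel_measurable lborel \<and>
      (AE \<xi> in lborel. AE x' in lborel. \<Phi> (x', \<xi>) = Hsc_inv \<xi> (\<lambda>k. F (k, \<xi>)) x')"
    using L2_space_measurable[OF gL] by blast
  from someI_ex[OF this] have m: "Hsc_inv_slices F \<in> borel_measurable lborel"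
    and s: "AE \<xi> in lborel. AE x' in lborel. Hsc_inv_slices F (x', \<xi>) = Hsc_inv \<xi> (\<lambda>k. F (k, \<xi>)) x'"
    unfolding Hsc_inv_slices_def by auto
  have aes: "AE \<xi> in lborel. AE x' in lborel. g (x', \<xi>) = Hsc_inv_slices F (x', \<xi>)"
    by (rule AE_AE_trans[OF gt s])
  then have ae: "AE z in lborel. g z = Hsc_inv_slices F z"
    using AE_lborel_commute[OF L2_space_measurable[OF gL] m]
    by (intro AE_lborel_pair_eqI[OF L2_space_measurable[OF gL] m]) simp
  note L = L2_space_cong_AE[OF gL m ae]
  have "AE \<xi> in lborel. \<forall>k. scaled_field.coeffs (swap_args (Hsc_inv_slices F)) (k, \<xi>) = F (k, \<xi>)"
    using c aes scaled_field.AE_slice_L2[OF \<Psi>] scaled_field.AE_slice_L2[OF L2_space_swap_pair(1)[OF L(1)]] basis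
  proof eventually_elim
    case (elim \<xi>)
    interpret B: L2_orthonormal_basis "lborel :: (real^'m) measure" "hermite_scaled (norm \<xi>)" by (rule elim(5))
    have "L2_inner lborel (\<lambda>x. Hsc_inv_slices F (x, \<xi>)) (hermite_scaled (norm \<xi>) k)
        = L2_inner lborel (\<lambda>x. \<Psi> (\<xi>, x)) (hermite_scaled (norm \<xi>) k)" for k
    proof (intro L2_inner_cong_AE L2_space_measurable B.in_L2)
      show "AE x in lborel. Hsc_inv_slices F (x, \<xi>) = \<Psi> (\<xi>, x)"
        using elim(2) by eventually_elim (simp add: g_def)
    qed (use elim in simp_all)
    then show ?case using elim(1) by (simp add: scaled_field.coeffs_def)
  qed
  moreover have "L2_norm lborel g = L2_norm Gamma_measure F"
    unfolding gn Gamma_measure_def by (rule scaled_field.norm_eq_if_coeffs_eq[OF \<Psi> F' c])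
  ultimately show ?thesis using L by simp
qed

section \<open>The transform of the whole space\<close>

lemma calG_eq_coeffs: "calG f = scaled_field.coeffs (swap_args (fourier_slices f))"
  by (simp add: calG_def Hsc_def scaled_field.coeffs_def fun_eq_iff)

theorem calG_isometry:
  fixes f :: "(real^'m) \<times> (real^'n) \<Rightarrow> complex"
  assumes "f \<in> L2_space lborel"
  shows "calG f \<in> L2_space Gamma_measure \<and> L2_norm Gamma_measure (calG f) = L2_norm lborel f"
proof -
  have s: "fourier_slices f \<in> L2_space lborel" "L2_norm lborel (fourier_slices f) = L2_norm lborel f"
    using fourier_slices_spec[OF assms] by simp_all
  show ?thesis
    using scaled_field.coeffs_isometry[OF L2_space_swap_pair(1)[OF s(1)]] L2_space_swap_pair(2)[OF s(1)] s(2)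
    unfolding calG_eq_coeffs Gamma_measure_def by simp
qed

theorem calG_inv_isometry:
  fixes F :: "(nat^'m) \<times> (real^'n) \<Rightarrow> complex"
  assumes "F \<in> L2_space Gamma_measure"
  shows "calG_inv F \<in> L2_space lborel \<and> L2_norm lborel (calG_inv F) = L2_norm Gamma_measure F"
proof -
  have s: "Hsc_inv_slices F \<in> L2_space lborel" "L2_norm lborel (Hsc_inv_slices F) = L2_norm Gamma_measure F"
    using Hsc_inv_slices_spec[OF assms] by simp_all
  show ?thesis using fourier_inv_slices_spec[OF s(1)] s(2) by (simp add: calG_inv_def)
qed

text \<open>
  \<open>calG f\<close> consists of the scaled Hermite coefficients of \<open>fourier_slices f\<close>, which determine that
  function; its slices form Fourier pairs with those of \<open>f\<close> and with those of
  \<open>calG_inv (calG f)\<close>. The two steps use slices in different variables, so the exceptional null sets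
  are exchanged by Fubini's theorem.
\<close>

theorem calG_inv_calG:
  fixes f :: "(real^'m) \<times> (real^'n) \<Rightarrow> complex"
  assumes f: "f \<in> L2_space lborel"
  shows "AE x in lborel. f x = calG_inv (calG f) x"
proof -
  define \<Phi> where "\<Phi> = fourier_slices f"
  define \<Phi>' where "\<Phi>' = Hsc_inv_slices (calG f)"
  have \<Phi>: "\<Phi> \<in> L2_space lborel" "AE x' in lborel. hermite_fourier_pair (\<lambda>x''. f (x', x'')) (\<lambda>\<xi>. \<Phi> (x', \<xi>))"
    using fourier_slices_spec[OF f] by (auto simp: \<Phi>_def)
  have G: "calG f \<in> L2_space Gamma_measure" using calG_isometry[OF f] by simp
  have \<Phi>': "\<Phi>' \<in> L2_space lborel" "AE \<xi> in lborel. \<forall>k. scaled_field.coeffs (swap_args \<Phi>') (k, \<xi>) = calG f (k, \<xi>)"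
    using Hsc_inv_slices_spec[OF G] by (auto simp: \<Phi>'_def)
  have "AE \<xi> in lborel. AE x' in lborel. swap_args \<Phi>' (\<xi>, x') = swap_args \<Phi> (\<xi>, x')"
    by (rule scaled_field.AE_eq_if_coeffs_eq)
       (use \<Phi>'(2) in \<open>auto simp: L2_space_swap_pair \<Phi> \<Phi>' calG_eq_coeffs \<Phi>_def[symmetric]\<close>)
  then have eq: "AE x' in lborel. AE \<xi> in lborel. \<Phi>' (x', \<xi>) = \<Phi> (x', \<xi>)"
    using AE_lborel_commute[OF L2_space_measurable[OF \<Phi>'(1)] L2_space_measurable[OF \<Phi>(1)]] by simp
  have f': "calG_inv (calG f) \<in> L2_space lborel" using calG_inv_isometry[OF G] by simp
  have p: "AE x' in lborel. hermite_fourier_pair (\<lambda>x''. calG_inv (calG f) (x', x'')) (\<lambda>\<xi>. \<Phi>' (x', \<xi>))"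
    using fourier_inv_slices_spec[OF \<Phi>'(1)] by (simp add: calG_inv_def \<Phi>'_def)
  have "AE x' in lborel. AE x'' in lborel. f (x', x'') = calG_inv (calG f) (x', x'')"
    using \<Phi>(2) p eq AE_lborel_slice_L2[OF f] AE_lborel_slice_L2[OF f']
      AE_lborel_slice_L2[OF \<Phi>(1)] AE_lborel_slice_L2[OF \<Phi>'(1)]
  proof eventually_elim
    case (elim x')
    have "hermite_fourier_pair (\<lambda>x''. calG_inv (calG f) (x', x'')) (\<lambda>\<xi>. \<Phi> (x', \<xi>))"
      using elim(2) by (rule hermite_fourier_pair_cong) (use elim in auto)
    with elim(1) show ?case by (rule hermite_fourier_pair_unique_left) (use elim in auto)
  qed
  then show ?thesis by (intro AE_lborel_pair_eqI L2_space_measurable f f')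
qed

theorem calG_calG_inv:
  fixes F :: "(nat^'m) \<times> (real^'n) \<Rightarrow> complex"
  assumes F: "F \<in> L2_space Gamma_measure"
  shows "AE p in Gamma_measure. F p = calG (calG_inv F) p"
proof -
  have basis: "AE \<xi> in lborel. L2_orthonormal_basis (lborel :: (real^'m) measure) (hermite_scaled (norm (\<xi> :: real^'n)))"
    by (rule scaled_field.basis)
  define \<Phi> where "\<Phi> = Hsc_inv_slices F"
  define \<Phi>' where "\<Phi>' = fourier_slices (calG_inv F)"
  have \<Phi>: "\<Phi> \<in> L2_space lborel" "AE \<xi> in lborel. \<forall>k. scaled_field.coeffs (swap_args \<Phi>) (k, \<xi>) = F (k, \<xi>)"
    using Hsc_inv_slices_spec[OF F] by (auto simp: \<Phi>_def)
  have f: "calG_inv F \<in> L2_space lborel" using calG_inv_isometry[OF F] by simp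
  have p: "AE x' in lborel. hermite_fourier_pair (\<lambda>x''. calG_inv F (x', x'')) (\<lambda>\<xi>. \<Phi> (x', \<xi>))"
    using fourier_inv_slices_spec[OF \<Phi>(1)] by (simp add: calG_inv_def \<Phi>_def)
  have \<Phi>': "\<Phi>' \<in> L2_space lborel"
    "AE x' in lborel. hermite_fourier_pair (\<lambda>x''. calG_inv F (x', x'')) (\<lambda>\<xi>. \<Phi>' (x', \<xi>))"
    using fourier_slices_spec[OF f] by (auto simp: \<Phi>'_def)
  have "AE x' in lborel. AE \<xi> in lborel. \<Phi>' (x', \<xi>) = \<Phi> (x', \<xi>)"
    using \<Phi>'(2) p AE_lborel_slice_L2[OF \<Phi>(1)] AE_lborel_slice_L2[OF \<Phi>'(1)]
  proof eventually_elim
    case (elim x')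
    then show ?case by (intro hermite_fourier_pair_unique)
  qed
  then have "AE \<xi> in lborel. AE x' in lborel. \<Phi>' (x', \<xi>) = \<Phi> (x', \<xi>)"
    using AE_lborel_commute[OF L2_space_measurable[OF \<Phi>'(1)] L2_space_measurable[OF \<Phi>(1)]] by simp
  then have "AE \<xi> in lborel. \<forall>k. F (k, \<xi>) = calG (calG_inv F) (k, \<xi>)"
    using \<Phi>(2) scaled_field.AE_slice_L2[OF L2_space_swap_pair(1)[OF \<Phi>(1)]]
      scaled_field.AE_slice_L2[OF L2_space_swap_pair(1)[OF \<Phi>'(1)]] basis
  proof eventually_elim
    case (elim \<xi>)
    interpret B: L2_orthonormal_basis "lborel :: (real^'m) measure" "hermite_scaled (norm \<xi>)" by (rule elim(5))
    have "L2_inner lborel (\<lambda>x. \<Phi>' (x, \<xi>)) (hermite_scaled (norm \<xi>) k)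
        = L2_inner lborel (\<lambda>x. \<Phi> (x, \<xi>)) (hermite_scaled (norm \<xi>) k)" for k
      by (intro L2_inner_cong_AE L2_space_measurable B.in_L2) (use elim in simp_all)
    then show ?case using elim(2) by (simp add: calG_eq_coeffs scaled_field.coeffs_def \<Phi>'_def)
  qed
  moreover have "calG (calG_inv F) \<in> L2_space Gamma_measure" using calG_isometry[OF f] by simp
  ultimately show ?thesis
    using F unfolding Gamma_measure_def
    by (intro scaled_field.AE_count_pairI L2_space_measurable)
qed

theorem theorem3p1:
  "(\<forall>f :: (real ^ 'm) \<times> (real ^ 'n) \<Rightarrow> complex. f \<in> L2_space lborel \<longrightarrow>
      calG f \<in> L2_space Gamma_measure \<and>
      L2_norm Gamma_measure (calG f) = L2_norm lborel f \<and>
      (AE x in lborel. f x = calG_inv (calG f) x)) \<and>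
   (\<forall>F :: (nat ^ 'm) \<times> (real ^ 'n) \<Rightarrow> complex. F \<in> L2_space Gamma_measure \<longrightarrow>
      calG_inv F \<in> L2_space lborel \<and>
      L2_norm lborel (calG_inv F) = L2_norm Gamma_measure F \<and>
      (AE p in Gamma_measure. F p = calG (calG_inv F) p))"
  using calG_isometry calG_inv_calG calG_inv_isometry calG_calG_inv by blast

end
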